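(* Let $m,n\ge 1$ and let $\mathfrak g=\mathfrak{gl}(m,n)$ be the general linear Lie superalgebra over $\mathbb C$. The universal enveloping superalgebra $U(\mathfrak g)$ is the associative unital $\mathbb C$-superalgebra generated by the elements $$e_{\alpha_i},\ f_{\alpha_i}\ (1\le i<m+n),\qquad h_{\alpha_j}\ (1\le j\le m+n,\ j\ne m),\qquad e_{mm}$$ (with $e_{\alpha_m},f_{\alpha_m}$ odd and all other generators even) subject to the following defining relations, where $[x,y]=xy-(-1)^{\bar x\bar y}yx$ and $h_{\alpha_m}:=e_{mm}+\sum_{i=m+1}^{m+n}h_{\alpha_i}$: (a1) $h_{\alpha_i}h_{\alpha_j}=h_{\alpha_j}h_{\alpha_i}$, $h_{\alpha_i}e_{mm}=e_{mm}h_{\alpha_i}$; (a2) $h_{\alpha_i}e_{\alpha_j}-e_{\alpha_j}h_{\alpha_i}=a_{ij}e_{\alpha_j}$, $e_{mm}e_{\alpha_j}-e_{\alpha_j}e_{mm}=a_{mj}e_{\alpha_j}$; (a3) $h_{\alpha_i}f_{\alpha_j}-f_{\alpha_j}h_{\alpha_i}=-a_{ij}f_{\alpha_j}$, $e_{mm}f_{\alpha_j}-f_{\alpha_j}e_{mm}=-a_{mj}f_{\alpha_j}$; (a4) $e_{\alpha_i}f_{\alpha_j}-f_{\alpha_j}e_{\alpha_i}=\delta_{ij}h_{\alpha_i}$ if $i\ne m$ or $j\neq m$, and $e_{\alpha_m}f_{\alpha_m}+f_{\alpha_m}e_{\alpha_m}=h_{\alpha_m}$; (a5) $e_{\alpha_i}e_{\alpha_j}=e_{\alpha_j}e_{\alpha_i}$,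 $f_{\alpha_i}f_{\alpha_j}=f_{\alpha_j}f_{\alpha_i}$ if $|i-j|>1$; (a6) $e_{\alpha_i}^2e_{\alpha_j}-2e_{\alpha_i}e_{\alpha_j}e_{\alpha_i}+e_{\alpha_j}e_{\alpha_i}^2=0$ if $|i-j|=1$, $i\ne m$; (a7) $f_{\alpha_i}^2f_{\alpha_j}-2f_{\alpha_i}f_{\alpha_j}f_{\alpha_i}+f_{\alpha_j}f_{\alpha_i}^2=0$ if $|i-j|=1$, $i\ne m$; (a8) $e_{\alpha_m}^2=f_{\alpha_m}^2=0$; (a9) $[e_{\alpha_m},[e_{\alpha_{m-1}},[e_{\alpha_m},e_{\alpha_{m+1}}]]]=0$; (a10) $[f_{\alpha_m},[f_{\alpha_{m-1}},[f_{\alpha_m},f_{\alpha_{m+1}}]]]=0$.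
   Context: $\mathfrak g=\mathfrak{gl}(m,n)$ has basis the matrix units $e_{ij}$, $1\le i,j\le m+n$, with $e_{ij}$ even if $i,j\le m$ or $i,j>m$ and odd otherwise. In $U(\mathfrak g)$: $e_{\alpha_i}=e_{i,i+1}$, $f_{\alpha_i}=e_{i+1,i}$ for $1\le i<m+n$; $h_{\alpha_i}=e_{ii}-e_{i+1,i+1}$ for $1\le i<m+n$, $i\ne m$; $h_{\alpha_{m+n}}=e_{m+n,m+n}$. The $(m+n)\times(m+n-1)$ integer matrix $(a_{ij})$ is: for $1\le i\le m+n-1$, $i\neq m$: $a_{ii}=2$, $a_{ij}=-1$ if $|i-j|=1$, and $a_{ij}=0$ otherwise; for $i=m$: $a_{m,m-1}=-1$, $a_{mm}=1$, and all other $a_{mj}=0$; for $i=m+n$: $a_{m+n,m+n-1}=-1$ and all other $a_{m+n,j}=0$. Relations containing generators whose index is out of range (for instance (a9), (a10) when $m=1$ or $n=1$) are omitted. *)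

theory Defs
  imports
    "HOL-Library.Poly_Mapping"
    "HOL-Library.Z2"
    "HOL-Algebra.QuotRing"
    "Jordan_Normal_Form.Matrix"
begin

section \<open>Superalgebras over the complex numbers\<close>

text \<open>
  Superspaces and associative superalgebras are HOL-Algebra structures with an additional
  grading by \<^typ>\<open>bit\<close>, the field with two elements.  For superspaces which are not
  algebras (Lie superalgebras) the fields \<^const>\<open>monoid.mult\<close> and \<^const>\<open>one\<close> carry no meaning,
  as for modules in HOL-Algebra.
\<close>

record 'a superalgebra = "(complex, 'a) module" +
  grade :: "bit \<Rightarrow> 'a set"

definition super_sign :: "bit \<Rightarrow> bit \<Rightarrow> complex"
  where "super_sign a b = (if a = 1 \<and> b = 1 then -1 else 1)"

definition hom_part :: "('a, 'z) superalgebra_scheme \<Rightarrow> bit \<Rightarrow> 'a \<Rightarrow> 'a"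
  where "hom_part A a x = (THE u. u \<in> grade A a \<and> (\<exists>v \<in> grade A (a + 1). x = u \<oplus>\<^bsub>A\<^esub> v))"

text \<open>
  For homogeneous \<open>x\<close>, \<open>y\<close> of parities \<open>a\<close>, \<open>b\<close> this is \<open>x y - (-1)\<^sup>a\<^sup>b y x\<close>; it is extended
  bilinearly to all elements.
\<close>

definition super_bracket :: "('a, 'z) superalgebra_scheme \<Rightarrow> 'a \<Rightarrow> 'a \<Rightarrow> 'a"
  where "super_bracket A x y =
    (\<Oplus>\<^bsub>A\<^esub>a\<in>UNIV. \<Oplus>\<^bsub>A\<^esub>b\<in>UNIV. (hom_part A a x \<otimes>\<^bsub>A\<^esub> hom_part A b y)
        \<ominus>\<^bsub>A\<^esub> super_sign a b \<odot>\<^bsub>A\<^esub> (hom_part A b y \<otimes>\<^bsub>A\<^esub> hom_part A a x))"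

definition super_quot :: "('a, 'z) superalgebra_scheme \<Rightarrow> 'a set \<Rightarrow> 'a set superalgebra"
  where "super_quot A I =
    ring.extend (A Quot I)
      \<lparr>smult = (\<lambda>c C. \<Union>x\<in>C. I +>\<^bsub>A\<^esub> (c \<odot>\<^bsub>A\<^esub> x)),
       grade = (\<lambda>a. (\<lambda>x. I +>\<^bsub>A\<^esub> x) ` grade A a)\<rparr>"

definition superalgebra_iso ::
    "('a, 'y) superalgebra_scheme \<Rightarrow> ('b, 'z) superalgebra_scheme \<Rightarrow> ('a \<Rightarrow> 'b) set"
  where "superalgebra_iso A B =
    {\<phi> \<in> ring_iso A B.
      (\<forall>c. \<forall>x \<in> carrier A. \<phi> (c \<odot>\<^bsub>A\<^esub> x) = c \<odot>\<^bsub>B\<^esub> \<phi> x) \<and>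
      (\<forall>a. \<phi> ` grade A a = grade B a)}"


section \<open>Free superalgebras and presentations\<close>

text \<open>
  The free associative unital algebra is the monoid algebra of the free monoid: finitely supported
  complex functions on words with convolution product, where \<^class>\<open>monoid_add\<close> on words is
  concatenation.
\<close>

datatype 'x word = Word (letters: "'x list")

instantiation word :: (type) monoid_add
begin

definition zero_word :: "'a word"
  where "zero_word = Word []"

definition plus_word :: "'a word \<Rightarrow> 'a word \<Rightarrow> 'a word"
  where "plus_word v w = Word (letters v @ letters w)"

instance
  by standard (auto simp: zero_word_def plus_word_def)

end

type_synonym 'x free_alg = "'x word \<Rightarrow>\<^sub>0 complex"

definition gen :: "'x \<Rightarrow> 'x free_alg"
  where "gen x = Poly_Mapping.single (Word [x]) 1"

definition free_scalar :: "complex \<Rightarrow> 'x free_alg"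
  where "free_scalar c = Poly_Mapping.single 0 c"

definition free_superalgebra :: "'x set \<Rightarrow> ('x \<Rightarrow> bit) \<Rightarrow> 'x free_alg superalgebra"
  where "free_superalgebra X p =
    \<lparr>carrier = {q. \<forall>w \<in> Poly_Mapping.keys q. set (letters w) \<subseteq> X},
     monoid.mult = (*), one = 1, zero = 0, add = (+),
     smult = (\<lambda>c q. free_scalar c * q),
     grade = (\<lambda>a. {q. \<forall>w \<in> Poly_Mapping.keys q. set (letters w) \<subseteq> X \<and> sum_list (map p (letters w)) = a})\<rparr>"

text \<open>
  A relation \<open>R\<close> holds of the two sides of each defining relation.  Both sides have to lie in the
  free superalgebra on \<open>X\<close>, and their difference has to be homogeneous.
\<close>

definition relation_ideal ::
    "'x set \<Rightarrow> ('x \<Rightarrow> bit) \<Rightarrow> ('x free_alg \<Rightarrow> 'x free_alg \<Rightarrow> bool) \<Rightarrow> 'x free_alg set"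
  where "relation_ideal X p R = Idl\<^bsub>free_superalgebra X p\<^esub> {l - r | l r. R l r}"

definition presented_superalgebra ::
    "'x set \<Rightarrow> ('x \<Rightarrow> bit) \<Rightarrow> ('x free_alg \<Rightarrow> 'x free_alg \<Rightarrow> bool) \<Rightarrow> 'x free_alg set superalgebra"
  where "presented_superalgebra X p R =
    super_quot (free_superalgebra X p) (relation_ideal X p R)"

definition presented_class ::
    "'x set \<Rightarrow> ('x \<Rightarrow> bit) \<Rightarrow> ('x free_alg \<Rightarrow> 'x free_alg \<Rightarrow> bool) \<Rightarrow> 'x free_alg \<Rightarrow> 'x free_alg set"
  where "presented_class X p R q = relation_ideal X p R +>\<^bsub>free_superalgebra X p\<^esub> q"

text \<open>
  The superalgebra \<open>A\<close> is generated by the elements \<open>g x\<close> (\<open>x \<in> X\<close>), of parity \<open>p x\<close>, subject to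
  the defining relations \<open>R\<close>.
\<close>

definition has_presentation ::
    "('a, 'z) superalgebra_scheme \<Rightarrow> 'x set \<Rightarrow> ('x \<Rightarrow> bit) \<Rightarrow>
      ('x free_alg \<Rightarrow> 'x free_alg \<Rightarrow> bool) \<Rightarrow> ('x \<Rightarrow> 'a) \<Rightarrow> bool"
  where "has_presentation A X p R g \<longleftrightarrow>
    (\<exists>\<phi> \<in> superalgebra_iso (presented_superalgebra X p R) A.
      \<forall>x \<in> X. \<phi> (presented_class X p R (gen x)) = g x)"


section \<open>Lie superalgebras and universal enveloping superalgebras\<close>

record 'g lie_superalgebra = "'g superalgebra" +
  lie_bracket :: "'g \<Rightarrow> 'g \<Rightarrow> 'g"

definition lie_superalgebra_of :: "'a superalgebra \<Rightarrow> 'a lie_superalgebra"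
  where "lie_superalgebra_of A = superalgebra.extend A \<lparr>lie_bracket = super_bracket A\<rparr>"

text \<open>
  The universal enveloping superalgebra is the quotient \<open>T(g) / (x y - (-1)\<^sup>a\<^sup>b y x - [x, y])\<close> of the
  tensor superalgebra.  As \<open>g\<close> is the direct sum of its homogeneous parts, \<open>T(g)\<close> is
  generated by symbols \<open>(a, x)\<close> with \<open>x\<close> in the part of parity \<open>a\<close>, subject to linearity in \<open>x\<close>.
\<close>

definition uea_generators :: "'g lie_superalgebra \<Rightarrow> (bit \<times> 'g) set"
  where "uea_generators g = {(a, x). x \<in> grade g a}"

inductive uea_relation ::
    "'g lie_superalgebra \<Rightarrow> (bit \<times> 'g) free_alg \<Rightarrow> (bit \<times> 'g) free_alg \<Rightarrow> bool"
  for g :: "'g lie_superalgebra"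
  where
    add: "x \<in> grade g a \<Longrightarrow> y \<in> grade g a \<Longrightarrow>
      uea_relation g (gen (a, x \<oplus>\<^bsub>g\<^esub> y)) (gen (a, x) + gen (a, y))"
  | smult: "x \<in> grade g a \<Longrightarrow>
      uea_relation g (gen (a, c \<odot>\<^bsub>g\<^esub> x)) (free_scalar c * gen (a, x))"
  | bracket: "x \<in> grade g a \<Longrightarrow> y \<in> grade g b \<Longrightarrow>
      uea_relation g
        (gen (a, x) * gen (b, y) - free_scalar (super_sign a b) * (gen (b, y) * gen (a, x)))
        (gen (a + b, lie_bracket g x y))"

definition uea :: "'g lie_superalgebra \<Rightarrow> (bit \<times> 'g) free_alg set superalgebra"
  where "uea g = presented_superalgebra (uea_generators g) fst (uea_relation g)"

definition uea_map :: "'g lie_superalgebra \<Rightarrow> 'g \<Rightarrow> (bit \<times> 'g) free_alg set"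
  where "uea_map g x =
    presented_class (uea_generators g) fst (uea_relation g)
      (gen (0, hom_part g 0 x) + gen (1, hom_part g 1 x))"


section \<open>The general linear Lie superalgebra\<close>

text \<open>Matrices are indexed from \<open>0\<close>; \<open>block_parity m i\<close> is \<open>0\<close> for the first \<open>m\<close> indices.\<close>

definition block_parity :: "nat \<Rightarrow> nat \<Rightarrow> bit"
  where "block_parity m i = (if i < m then 0 else 1)"

definition super_mat :: "nat \<Rightarrow> nat \<Rightarrow> complex mat superalgebra"
  where "super_mat m n =
    module.extend (module_mat TYPE(complex) (m + n) (m + n))
      \<lparr>grade = (\<lambda>a. {M \<in> carrier_mat (m + n) (m + n).
          \<forall>i < m + n. \<forall>j < m + n. block_parity m i + block_parity m j \<noteq> a \<longrightarrow> M $$ (i, j) = 0})\<rparr>"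

definition gl :: "nat \<Rightarrow> nat \<Rightarrow> complex mat lie_superalgebra"
  where "gl m n = lie_superalgebra_of (super_mat m n)"

text \<open>The matrix unit \<open>e\<^sub>i\<^sub>j\<close> in the \<open>1\<close>-based numbering \<open>1 \<le> i, j \<le> m + n\<close>.\<close>

definition mat_unit :: "nat \<Rightarrow> nat \<Rightarrow> nat \<Rightarrow> nat \<Rightarrow> complex mat"
  where "mat_unit m n i j =
    mat (m + n) (m + n) (\<lambda>(r, c). if r + 1 = i \<and> c + 1 = j then 1 else 0)"

definition gl_coeff :: "nat \<Rightarrow> nat \<Rightarrow> nat \<Rightarrow> nat \<Rightarrow> int"
  where "gl_coeff m n i j =
    (if i = m then (if j + 1 = m then -1 else if j = m then 1 else 0)
     else if i = m + n then (if j + 1 = m + n then -1 else 0)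
     else (if i = j then 2 else if i = j + 1 \<or> j = i + 1 then -1 else 0))"

text \<open>
  \<open>E i\<close>, \<open>F i\<close>, \<open>H i\<close> stand for the generators \<open>e\<close>, \<open>f\<close>, \<open>h\<close> with index \<open>\<alpha>\<^sub>i\<close>, and \<open>Emm\<close> for
  \<open>e\<^sub>m\<^sub>m\<close>; \<open>H m\<close> is not a generator.
\<close>

datatype gl_gen = E nat | F nat | H nat | Emm

definition gl_generators :: "nat \<Rightarrow> nat \<Rightarrow> gl_gen set"
  where "gl_generators m n =
    E ` {1..<m + n} \<union> F ` {1..<m + n} \<union> H ` ({1..m + n} - {m}) \<union> {Emm}"

definition gl_parity :: "nat \<Rightarrow> gl_gen \<Rightarrow> bit"
  where "gl_parity m x = (if x = E m \<or> x = F m then 1 else 0)"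

fun gl_gen_mat :: "nat \<Rightarrow> nat \<Rightarrow> gl_gen \<Rightarrow> complex mat"
  where
    "gl_gen_mat m n (E i) = mat_unit m n i (i + 1)"
  | "gl_gen_mat m n (F i) = mat_unit m n (i + 1) i"
  | "gl_gen_mat m n (H i) =
      (if i = m + n then mat_unit m n (m + n) (m + n)
       else mat_unit m n i i - mat_unit m n (i + 1) (i + 1))"
  | "gl_gen_mat m n Emm = mat_unit m n m m"

definition gl_h :: "nat \<Rightarrow> nat \<Rightarrow> nat \<Rightarrow> gl_gen free_alg"
  where "gl_h m n i =
    (if i = m then gen Emm + (\<Sum>j = m + 1..m + n. gen (H j)) else gen (H i))"

definition gl_bracket :: "nat \<Rightarrow> nat \<Rightarrow> gl_gen free_alg \<Rightarrow> gl_gen free_alg \<Rightarrow> gl_gen free_alg"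
  where "gl_bracket m n = super_bracket (free_superalgebra (gl_generators m n) (gl_parity m))"

abbreviation (input) gl_e :: "nat \<Rightarrow> gl_gen free_alg" where "gl_e i \<equiv> gen (E i)"
abbreviation (input) gl_f :: "nat \<Rightarrow> gl_gen free_alg" where "gl_f i \<equiv> gen (F i)"
abbreviation (input) gl_emm :: "gl_gen free_alg" where "gl_emm \<equiv> gen Emm"

text \<open>
  In the commutators of \<open>h\<close> with \<open>e\<close>, \<open>f\<close> and \<open>h\<close> the index of \<open>h\<close> ranges over the generators only,
  so it is different from \<open>m\<close>; row \<open>m\<close> of the coefficient matrix belongs to \<open>e\<^sub>m\<^sub>m\<close>.
\<close>

inductive gl_relation :: "nat \<Rightarrow> nat \<Rightarrow> gl_gen free_alg \<Rightarrow> gl_gen free_alg \<Rightarrow> bool"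
  for m n :: nat
  where
    a1: "i \<in> {1..m + n} - {m} \<Longrightarrow> j \<in> {1..m + n} - {m} \<Longrightarrow>
      gl_relation m n (gl_h m n i * gl_h m n j) (gl_h m n j * gl_h m n i)"
  | a1': "i \<in> {1..m + n} - {m} \<Longrightarrow>
      gl_relation m n (gl_h m n i * gl_emm) (gl_emm * gl_h m n i)"
  | a2: "i \<in> {1..m + n} - {m} \<Longrightarrow> j \<in> {1..<m + n} \<Longrightarrow>
      gl_relation m n (gl_h m n i * gl_e j - gl_e j * gl_h m n i)
        (of_int (gl_coeff m n i j) * gl_e j)"
  | a2': "j \<in> {1..<m + n} \<Longrightarrow>
      gl_relation m n (gl_emm * gl_e j - gl_e j * gl_emm) (of_int (gl_coeff m n m j) * gl_e j)"
  | a3: "i \<in> {1..m + n} - {m} \<Longrightarrow> j \<in> {1..<m + n} \<Longrightarrow>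
      gl_relation m n (gl_h m n i * gl_f j - gl_f j * gl_h m n i)
        (- of_int (gl_coeff m n i j) * gl_f j)"
  | a3': "j \<in> {1..<m + n} \<Longrightarrow>
      gl_relation m n (gl_emm * gl_f j - gl_f j * gl_emm) (- of_int (gl_coeff m n m j) * gl_f j)"
  | a4: "i \<in> {1..<m + n} \<Longrightarrow> j \<in> {1..<m + n} \<Longrightarrow> i \<noteq> m \<or> j \<noteq> m \<Longrightarrow>
      gl_relation m n (gl_e i * gl_f j - gl_f j * gl_e i) (if i = j then gl_h m n i else 0)"
  | a4': "gl_relation m n (gl_e m * gl_f m + gl_f m * gl_e m) (gl_h m n m)"
  | a5: "i \<in> {1..<m + n} \<Longrightarrow> j \<in> {1..<m + n} \<Longrightarrow> \<bar>int i - int j\<bar> > 1 \<Longrightarrow>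
      gl_relation m n (gl_e i * gl_e j) (gl_e j * gl_e i)"
  | a5': "i \<in> {1..<m + n} \<Longrightarrow> j \<in> {1..<m + n} \<Longrightarrow> \<bar>int i - int j\<bar> > 1 \<Longrightarrow>
      gl_relation m n (gl_f i * gl_f j) (gl_f j * gl_f i)"
  | a6: "i \<in> {1..<m + n} \<Longrightarrow> j \<in> {1..<m + n} \<Longrightarrow> \<bar>int i - int j\<bar> = 1 \<Longrightarrow> i \<noteq> m \<Longrightarrow>
      gl_relation m n (gl_e i ^ 2 * gl_e j - 2 * gl_e i * gl_e j * gl_e i + gl_e j * gl_e i ^ 2) 0"
  | a7: "i \<in> {1..<m + n} \<Longrightarrow> j \<in> {1..<m + n} \<Longrightarrow> \<bar>int i - int j\<bar> = 1 \<Longrightarrow> i \<noteq> m \<Longrightarrow>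
      gl_relation m n (gl_f i ^ 2 * gl_f j - 2 * gl_f i * gl_f j * gl_f i + gl_f j * gl_f i ^ 2) 0"
  | a8: "gl_relation m n (gl_e m ^ 2) 0"
  | a8': "gl_relation m n (gl_f m ^ 2) 0"
  | a9: "m \<ge> 2 \<Longrightarrow> n \<ge> 2 \<Longrightarrow>
      gl_relation m n
        (gl_bracket m n (gl_e m) (gl_bracket m n (gl_e (m - 1)) (gl_bracket m n (gl_e m) (gl_e (m + 1))))) 0"
  | a10: "m \<ge> 2 \<Longrightarrow> n \<ge> 2 \<Longrightarrow>
      gl_relation m n
        (gl_bracket m n (gl_f m) (gl_bracket m n (gl_f (m - 1)) (gl_bracket m n (gl_f m) (gl_f (m + 1))))) 0"

end

theory Submission
  imports Defs
begin

text \<open>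
  Both algebras are given by generators and relations, so it suffices to find mutually inverse
  substitutions of generators that respect the relations; no basis theorem is needed.  From the
  presented algebra to \<open>U(gl(m,n))\<close> each generator goes to its matrix, and the relations are
  identities between brackets of matrix units.  In the other direction the matrix unit \<open>e\<^sub>i\<^sub>j\<close> goes
  to an iterated commutator of the generators \<open>e\<close> (for \<open>i < j\<close>) or \<open>f\<close> (for \<open>i > j\<close>), and one has to
  show that these elements bracket like matrix units.  By the super Jacobi identity, the set of
  elements whose bracket with every one of them is the expected one is closed under brackets.  Hence
  only brackets with the Chevalley generators need be computed, and the sign-twisted exchange of
  \<open>e\<close> and \<open>f\<close> reduces these to brackets with the upper triangular elements.  The critical case is
  \<open>[e\<^sub>k, e\<^sub>i\<^sub>j] = 0\<close> for \<open>i < k\<close> and \<open>k + 1 < j\<close>, which comes from the Serre relations if \<open>k \<noteq> m\<close>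
  and from the quartic relation if \<open>k = m\<close>.
\<close>

section \<open>Root vectors from Chevalley generators\<close>

text \<open>The obstacle at an odd simple root: let u, x, v be three consecutive generators. As u
  and v commute, [[u,x],v] = [u,[x,v]]. Bracketing both forms with x and using [x,[u,x]] = [x,[x,v]]
  = 0 gives [[u,x],[x,v]] with opposite signs if x is even, so twice the bracket vanishes and
  division by 2 finishes. If x is odd, the sign in the Leibniz rule makes both values equal; nothing
  follows, and the quartic relation has to supply the vanishing.

  Parities are arguments of the bracket and not a grading of the ring. The computations can then be
  done in an ungraded ring type, where super Jacobi is a polynomial identity in arbitrary elements,
  while homogeneity is checked separately in the free algebras.

  The diagonal units e_ii, rather than the h's, serve as Cartan elements: their action on a root
  vector depends only on its two end indices.\<close>

definition koszul :: "bit \<Rightarrow> bit \<Rightarrow> 'a::ring \<Rightarrow> 'a"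
  where "koszul a b x = (if a = 1 \<and> b = 1 then - x else x)"

text \<open>\<open>a\<close> and \<open>b\<close> are formal labels for the parities of
  \<open>x\<close> and \<open>y\<close>. The sign (-1)^(ab) is applied by \<open>koszul\<close>
  without scalars, so the calculus works in any ring.\<close>

definition sbr :: "bit \<Rightarrow> bit \<Rightarrow> 'a::ring \<Rightarrow> 'a \<Rightarrow> 'a"
  where "sbr a b x y = x * y - koszul a b (y * x)"

abbreviation com :: "'a::ring \<Rightarrow> 'a \<Rightarrow> 'a"
  where "com x y \<equiv> x * y - y * x"

lemma koszul_simps [simp]:
  "koszul 0 b x = x" "koszul a 0 x = x" "koszul 1 1 x = - x"
  "koszul a b 0 = 0" "koszul a b (x + y) = koszul a b x + koszul a b y"
  "koszul a b (x - y) = koszul a b x - koszul a b y"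
  "koszul a b (- x) = - koszul a b x"
  by (auto simp: koszul_def)

lemma sbr_simps [simp]:
  "sbr a b 0 y = 0" "sbr a b x 0 = 0"
  "sbr a b (- x) y = - sbr a b x y" "sbr a b x (- y) = - sbr a b x y"
  by (auto simp: sbr_def koszul_def)

lemma sbr_diff_right: "sbr a b x (y - z) = sbr a b x y - sbr a b x z"
  by (auto simp: sbr_def koszul_def algebra_simps)

lemma sbr_koszul_right: "sbr a b x (koszul c d y) = koszul c d (sbr a b x y)"
  by (auto simp: sbr_def koszul_def algebra_simps)

lemma koszul_koszul: "koszul a b (koszul a b x) = x"
  by (auto simp: koszul_def)

lemma sbr_swap: "sbr b a y x = - koszul a b (sbr a b x y)"
  by (auto simp: sbr_def koszul_def algebra_simps)

text \<open>For each of the eight choices of labels this is an identity between noncommutative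
  polynomials. In this form, bracketing with [x,y] is the supercommutator of bracketing with x and
  with y, which is what closure under brackets needs later.\<close>

lemma sbr_jacobi:
  "sbr (a + b) c (sbr a b x y) z = sbr a (b + c) x (sbr b c y z) - koszul a b (sbr b (a + c) y (sbr a c x z))"
  by (cases a; cases b; cases c) (auto simp: sbr_def koszul_def algebra_simps)


text \<open>Moving x past y costs a fixed sign and moving it past z costs none, so x passes yz and
  zy with the same sign. Used to lengthen root vectors at either end.\<close>

lemma sbr_com_eq_0:
  assumes "sbr a b x y = 0" and "com x z = 0"
  shows "sbr a b x (com y z) = 0" and "sbr a b x (com z y) = 0"
proof -
  have 1: "x * y = koszul a b (y * x)" and 2: "x * z = z * x"
    using assms by (simp_all add: sbr_def)
  have "x * (y * z) = koszul a b (y * (z * x))"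
    using 1 2 by (metis (no_types) koszul_def minus_mult_left mult.assoc)
  moreover have "x * (z * y) = koszul a b (z * (y * x))"
    using 1 2 by (metis (no_types) koszul_def minus_mult_right mult.assoc)
  ultimately show "sbr a b x (com y z) = 0" "sbr a b x (com z y) = 0"
    by (simp_all add: sbr_def algebra_simps)
qed

text \<open>The left-normed commutator of e_i, ..., e_(j-1) stands for e_ij when i < j; the value 0
  is a filler otherwise. Plain commutators suffice: e_ij is odd only if i \<le> m < j, while the
  next factor e_j is odd only if j = m.\<close>

fun root_vec :: "(nat \<Rightarrow> 'a::ring) \<Rightarrow> nat \<Rightarrow> nat \<Rightarrow> 'a"
  where
    "root_vec e i 0 = 0"
  | "root_vec e i (Suc j) =
      (if j < i then 0 else if j = i then e i else com (root_vec e i j) (e j))"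

text \<open>Parities of \<open>e\<^sub>i\<^sub>j\<close> (numbered from \<open>1\<close>) and of the generators with index \<open>\<alpha>\<^sub>k\<close>.\<close>

definition unit_par :: "nat \<Rightarrow> nat \<Rightarrow> nat \<Rightarrow> bit"
  where "unit_par m i j = (if i \<le> m \<longleftrightarrow> j \<le> m then 0 else 1)"

definition odd_at :: "nat \<Rightarrow> nat \<Rightarrow> bit"
  where "odd_at m k = (if k = m then 1 else 0)"

lemma unit_par_same [simp]: "unit_par m i i = 0"
  by (simp add: unit_par_def)

lemma unit_par_Suc [simp]: "unit_par m k (Suc k) = odd_at m k"
  by (auto simp: unit_par_def odd_at_def)

lemma unit_par_Suc': "unit_par m (Suc k) k = odd_at m k"
  by (auto simp: unit_par_def odd_at_def)

lemma unit_par_sym: "unit_par m k l = unit_par m l k"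
  by (auto simp: unit_par_def)

lemma unit_par_add: "unit_par m i j + unit_par m j k = unit_par m i k"
  by (auto simp: unit_par_def)

text \<open>The relations of one triangular half, kept abstract because they serve the e's, the f's
  and sign changes of both. \<open>N\<close> stands for m + n. In \<open>odd_quartic\<close> each
  inner bracket has an even factor, so only the outermost one is an anticommutator.\<close>

locale serre =
  fixes N m :: nat and e :: "nat \<Rightarrow> 'a::ring"
  assumes torsion_free: "\<And>x::'a. x + x = 0 \<Longrightarrow> x = 0"
    and far: "\<lbrakk>1 \<le> i; i + 1 < j; j < N\<rbrakk> \<Longrightarrow> e i * e j = e j * e i"
    and serre: "\<lbrakk>1 \<le> i; i < N; 1 \<le> j; j < N; i = j + 1 \<or> j = i + 1; i \<noteq> m\<rbrakk> \<Longrightarrow>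
      com (e i) (com (e i) (e j)) = 0"
    and odd_square: "e m * e m = 0"
    and odd_quartic: "\<lbrakk>2 \<le> m; m + 1 < N\<rbrakk> \<Longrightarrow>
      sbr 1 1 (e m) (com (e (m - 1)) (com (e m) (e (m + 1)))) = 0"
begin

abbreviation "rv \<equiv> root_vec e"

section \<open>Brackets of a generator with the root vectors of its own half\<close>

lemma com_root_vec_eq_0:
  assumes "\<And>k. i \<le> k \<Longrightarrow> k < j \<Longrightarrow> com x (e k) = 0"
  shows "com x (rv i j) = 0"
  using assms
proof (induction j)
  case (Suc j)
  then have "com x (rv i j) = 0" by simp
  moreover have "i \<le> j \<Longrightarrow> com x (e j) = 0" using Suc.prems by simp
  ultimately show ?case
    using sbr_com_eq_0(1)[of 0 0 x "rv i j" "e j"] Suc.prems[of i]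
    by (auto simp: sbr_def not_less)
qed simp

lemma com_gen_left_of:
  assumes "1 \<le> k" "k + 1 < i" "j \<le> N"
  shows "com (e k) (rv i j) = 0"
  by (rule com_root_vec_eq_0) (use assms far[of k] in auto)

lemma com_gen_right_of:
  assumes "1 \<le> i" "j < k" "k < N"
  shows "com (e k) (rv i j) = 0"
  by (rule com_root_vec_eq_0) (use assms far[of _ k] in auto)

text \<open>For j > k the generator \<open>e j\<close> commutes with \<open>rv i k\<close>, so by
  the Jacobi identity the last bracket of the recursion moves into the right factor.\<close>

lemma root_vec_split:
  assumes "1 \<le> i" "i < k" "k < j" "j \<le> N"
  shows "rv i j = com (rv i k) (rv k j)"
  using assms(3,4)
proof (induction j)
  case (Suc j)
  show ?case
  proof (cases "j = k")
    case True
    with assms show ?thesis by simp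
  next
    case False
    with Suc have IH: "rv i j = com (rv i k) (rv k j)" and j: "k < j" "j < N" by auto
    have "com (e j) (rv i k) = 0"
      using assms j by (intro com_gen_right_of) auto
    then have *: "e j * rv i k = rv i k * e j" by simp
    have "rv i (Suc j) = com (com (rv i k) (rv k j)) (e j)"
      using IH j assms by simp
    also have "\<dots> = com (rv i k) (com (rv k j) (e j))"
      using * by (simp add: algebra_simps) (metis mult.assoc)
    finally show ?thesis using j by simp
  qed
qed simp

text \<open>For odd x = e_k and y = e_(k+1) the bracket expands to xxy - yxx, which vanishes because
  xx = 0; for even x it is the Serre relation.\<close>

lemma serre_up:
  assumes "1 \<le> k" "k + 1 < N"
  shows "sbr (odd_at m k) (odd_at m k) (e k) (com (e k) (e (k + 1))) = 0"
proof (cases "k = m")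
  case True
  have "e m * e m = 0" by (rule odd_square)
  then have "\<And>z. e m * (e m * z) = 0" by (metis mult.assoc mult_zero_left)
  then show ?thesis using True \<open>e m * e m = 0\<close>
    by (simp add: odd_at_def sbr_def algebra_simps)
next
  case False
  with serre[of k "k+1"] assms show ?thesis by (simp add: odd_at_def sbr_def)
qed

lemma serre_down:
  assumes "1 \<le> k" "k + 1 < N"
  shows "sbr (odd_at m (k + 1)) (odd_at m (k + 1)) (e (k + 1)) (com (e k) (e (k + 1))) = 0"
proof (cases "k + 1 = m")
  case True
  have "e m * e m = 0" by (rule odd_square)
  then have "\<And>z. e m * (e m * z) = 0" by (metis mult.assoc mult_zero_left)
  then show ?thesis using True \<open>e m * e m = 0\<close>
    by (simp add: odd_at_def sbr_def algebra_simps)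
next
  case False
  with serre[of "k+1" "k"] assms show ?thesis by (simp add: odd_at_def sbr_def algebra_simps)
qed

text \<open>The shortest case of a generator strictly inside a root vector. Every longer case with
  neighbours on both sides reduces to it.\<close>

lemma serre_middle:
  assumes "1 \<le> k" "k + 2 < N"
  shows "sbr (odd_at m (k + 1)) (odd_at m (k + 1)) (e (k + 1))
    (com (com (e k) (e (k + 1))) (e (k + 2))) = 0"
proof -
  let ?u = "e k" and ?x = "e (k + 1)" and ?v = "e (k + 2)"
  have uv: "?u * ?v = ?v * ?u" using far[of k "k+2"] assms by simp
  then have uv': "\<And>z. ?u * (?v * z) = ?v * (?u * z)" by (metis mult.assoc)
  have eq: "com (com ?u ?x) ?v = com ?u (com ?x ?v)"
    using uv uv' by (simp add: algebra_simps)
  show ?thesis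
  proof (cases "k + 1 = m")
    case True
    with odd_quartic assms have "sbr 1 1 ?x (com ?u (com ?x ?v)) = 0"
      by (auto simp: numeral_2_eq_2)
    with eq True show ?thesis by (simp add: odd_at_def)
  next
    case False
    \<comment> \<open>\<open>x\<close> brackets with the two sides of \<open>eq\<close> to opposite values, and there is no 2-torsion\<close>
    have 1: "com ?x (com ?u ?x) = 0" and 2: "com ?x (com ?x ?v) = 0"
      using serre_down[of k] serre_up[of "k+1"] False assms by (simp_all add: odd_at_def sbr_def)
    have "com ?x (com (com ?u ?x) ?v) = com (com ?u ?x) (com ?x ?v)"
    proof -
      have "com ?x (com (com ?u ?x) ?v) = com (com ?x (com ?u ?x)) ?v + com (com ?u ?x) (com ?x ?v)"
        by (simp add: algebra_simps)
      with 1 show ?thesis by simp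
    qed
    moreover have "com ?x (com ?u (com ?x ?v)) = - com (com ?u ?x) (com ?x ?v)"
    proof -
      have "com ?x (com ?u (com ?x ?v)) = com ?u (com ?x (com ?x ?v)) - com (com ?u ?x) (com ?x ?v)"
        by (simp add: algebra_simps)
      with 2 show ?thesis by simp
    qed
    ultimately have "com ?x (com (com ?u ?x) ?v) + com ?x (com (com ?u ?x) ?v) = 0"
      unfolding eq by (metis add.right_inverse)
    then have "com ?x (com (com ?u ?x) ?v) = 0" by (rule torsion_free)
    with False show ?thesis by (simp add: odd_at_def sbr_def)
  qed
qed

lemma root_vec_2: "rv k (k + 2) = com (e k) (e (k + 1))"
  by (simp add: numeral_2_eq_2)

lemma root_vec_3: "rv k (k + 3) = com (com (e k) (e (k + 1))) (e (k + 2))"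
  by (simp add: numeral_3_eq_3)

text \<open>The piece \<open>rv l j\<close> is built from generators with index at least l > k + 1,
  all of which commute with e_k; so only the piece near k matters.\<close>

lemma sbr_extend_right:
  assumes "sbr a b (e k) (rv i l) = 0" "1 \<le> i" "i < l" "1 \<le> k" "k + 1 < l" "l \<le> j" "j \<le> N"
  shows "sbr a b (e k) (rv i j) = 0"
proof (cases "l = j")
  case False
  then have "rv i j = com (rv i l) (rv l j)" using assms root_vec_split[of i l j] by simp
  moreover have "com (e k) (rv l j) = 0" using assms by (intro com_gen_left_of) auto
  ultimately show ?thesis using assms(1) sbr_com_eq_0(1) by metis
qed (use assms in simp)

lemma sbr_extend_left:
  assumes "sbr a b (e k) (rv l j) = 0" "1 \<le> i" "i \<le> l" "l < j" "l < k" "k < N" "j \<le> N"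
  shows "sbr a b (e k) (rv i j) = 0"
proof (cases "l = i")
  case False
  then have "rv i j = com (rv i l) (rv l j)" using assms root_vec_split[of i l j] by simp
  moreover have "com (e k) (rv i l) = 0" using assms by (intro com_gen_right_of) auto
  ultimately show ?thesis using assms(1) sbr_com_eq_0(2) by metis
qed (use assms in simp)

text \<open>Generators not adjacent to e_k commute with it, so the root vector can be cut down to
  the window from k - 1 to k + 1. What remains is one of four short brackets, according to which
  neighbours of k lie in the interval: none, the right one, the left one, or both.\<close>

lemma sbr_gen_inside:
  assumes "1 \<le> i" "i \<le> k" "k < j" "j \<le> N"
  shows "sbr (odd_at m k) (odd_at m k) (e k) (rv i j) = 0"
proof -
  consider "i = k" "j = k + 1" | "i = k" "k + 2 \<le> j" | "i < k" "j = k + 1" | "i < k" "k + 2 \<le> j"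
    using assms by linarith
  then show ?thesis
  proof cases
    case 1
    then show ?thesis by (auto simp: odd_at_def sbr_def odd_square)
  next
    case 2
    have "sbr (odd_at m k) (odd_at m k) (e k) (rv k (k + 2)) = 0"
      unfolding root_vec_2 using serre_up assms 2 by simp
    then show ?thesis using sbr_extend_right[of _ _ k k "k + 2" j] 2 assms by simp
  next
    case 3
    have "sbr (odd_at m k) (odd_at m k) (e k) (rv (k - 1) (k - 1 + 2)) = 0"
      unfolding root_vec_2 using serre_down[of "k - 1"] assms 3 by simp
    moreover have "k - 1 + 2 = j" using 3 by simp
    ultimately have "sbr (odd_at m k) (odd_at m k) (e k) (rv (k - 1) j) = 0" by metis
    then show ?thesis using sbr_extend_left[of _ _ k "k - 1" j i] 3 assms
      by (simp del: root_vec.simps)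
  next
    case 4
    have "sbr (odd_at m k) (odd_at m k) (e k) (rv (k - 1) (k - 1 + 3)) = 0"
      unfolding root_vec_3 using serre_middle[of "k - 1"] assms 4 by simp
    then have "sbr (odd_at m k) (odd_at m k) (e k) (rv (k - 1) (k + 2)) = 0"
      using 4 by (simp add: numeral_3_eq_3)
    then have "sbr (odd_at m k) (odd_at m k) (e k) (rv (k - 1) j) = 0"
      using sbr_extend_right[of _ _ k "k - 1" "k + 2" j] 4 assms
      by (simp del: root_vec.simps)
    then show ?thesis using sbr_extend_left[of _ _ k "k - 1" j i] 4 assms
      by (simp del: root_vec.simps)
  qed
qed

text \<open>Only the two ends contribute: k + 1 = i prolongs the root vector on the left and k = j
  on the right. Outside the range i \<le> k < j at most one label is odd, so the superbracket is a
  commutator there.\<close>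

lemma sbr_gen_root:
  assumes "1 \<le> i" "i < j" "j \<le> N" "1 \<le> k" "k < N"
  shows "sbr (odd_at m k) (unit_par m i j) (e k) (rv i j) =
    (if k + 1 = i then rv k j else 0) - (if j = k then rv i (k + 1) else 0)"
proof -
  consider "k + 1 < i" | "k + 1 = i" | "i \<le> k" "k < j" | "k = j" | "j < k" by linarith
  then show ?thesis
  proof cases
    case 1
    have "com (e k) (rv i j) = 0" using 1 assms com_gen_left_of by simp
    moreover have "odd_at m k = 0 \<or> unit_par m i j = 0" using 1 assms by (auto simp: odd_at_def unit_par_def)
    ultimately show ?thesis using 1 assms by (auto simp: sbr_def)
  next
    case 2
    have "rv k j = com (rv k i) (rv i j)" using 2 assms root_vec_split[of k i j] by simp
    moreover have "rv k i = e k" using 2 by auto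
    moreover have "odd_at m k = 0 \<or> unit_par m i j = 0" using 2 assms by (auto simp: odd_at_def unit_par_def)
    ultimately show ?thesis using 2 assms by (auto simp: sbr_def)
  next
    case 3
    then have "sbr (odd_at m k) (odd_at m k) (e k) (rv i j) = 0" using sbr_gen_inside assms by simp
    \<comment> \<open>For k = m the interval contains m, so both second labels are odd; for other k
      the first label is even and the sign is trivial.\<close>
    moreover have "sbr (odd_at m k) (unit_par m i j) (e k) (rv i j) = sbr (odd_at m k) (odd_at m k) (e k) (rv i j)"
      using 3 by (auto simp: odd_at_def unit_par_def sbr_def)
    ultimately show ?thesis using 3 by simp
  next
    case 4
    have "odd_at m k = 0 \<or> unit_par m i j = 0" using 4 assms by (auto simp: odd_at_def unit_par_def)
    then show ?thesis using 4 assms by (auto simp: sbr_def)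
  next
    case 5
    have "com (e k) (rv i j) = 0" using 5 assms com_gen_right_of by simp
    moreover have "odd_at m k = 0 \<or> unit_par m i j = 0" using 5 assms by (auto simp: odd_at_def unit_par_def)
    ultimately show ?thesis using 5 assms by (auto simp: sbr_def)
  qed
qed

end


text \<open>Each relation is homogeneous in every single generator, so independent sign changes
  preserve it. This yields the twisted family needed to exchange e and f.\<close>

lemma (in serre) serre_sign:
  "serre N m (\<lambda>i. if P i then e i else - e i)"
proof
  fix i j assume "1 \<le> i" "i < N" "1 \<le> j" "j < N" "i = j + 1 \<or> j = i + 1" "i \<noteq> m"
  then have "com (e i) (com (e i) (e j)) = 0" by (rule serre)
  moreover have "com (- e i) (com (- e i) (- e j)) = - com (e i) (com (e i) (e j))"
    "com (- e i) (com (- e i) (e j)) = com (e i) (com (e i) (e j))"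
    "com (e i) (com (e i) (- e j)) = - com (e i) (com (e i) (e j))"
    by (simp_all add: algebra_simps)
  ultimately show "com (if P i then e i else - e i)
    (com (if P i then e i else - e i) (if P j then e j else - e j)) = 0" by simp
next
  assume *: "2 \<le> m" "m + 1 < N"
  have neg: "com (- x) y = - com x y" "com x (- y) = - com x y" for x y :: 'a
    by (simp_all add: algebra_simps)
  show "sbr 1 1 (if P m then e m else - e m)
    (com (if P (m - 1) then e (m - 1) else - e (m - 1))
      (com (if P m then e m else - e m) (if P (m + 1) then e (m + 1) else - e (m + 1)))) = 0"
    using odd_quartic[OF *] by (simp only: if_distrib neg sbr_simps split: if_split) simp
next
  fix i j assume "1 \<le> i" "i + 1 < j" "j < N"
  then show "(if P i then e i else - e i) * (if P j then e j else - e j) =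
    (if P j then e j else - e j) * (if P i then e i else - e i)"
    using far[of i j] by simp
next
  show "(if P m then e m else - e m) * (if P m then e m else - e m) = 0"
    by (simp add: odd_square)
qed (rule torsion_free)

text \<open>Below the diagonal, e_(j+1,i) = [f_j, e_ji] = -[e_ji, f_j] has the new factor on the
  left. Recursion over -f with an outer minus sign absorbs this, and the element at (i + 1, i) is
  f_i.\<close>

definition root_elem ::
    "(nat \<Rightarrow> 'a::ring) \<Rightarrow> (nat \<Rightarrow> 'a) \<Rightarrow> (nat \<Rightarrow> 'a) \<Rightarrow> nat \<Rightarrow> nat \<Rightarrow> 'a"
  where "root_elem e f d i j = (if i < j then root_vec e i j else if i = j then d i
    else - root_vec (\<lambda>k. - f k) j i)"

text \<open>\<open>d i\<close> plays the part of e_ii. \<open>e_f_same\<close> covers the even and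
  the odd case at once: at i = m the sign turns d_m - d_(m+1) into a sum.\<close>

locale chevalley =
  e: serre N m e + f: serre N m f for N m :: nat and e f :: "nat \<Rightarrow> 'a::ring" +
  fixes d :: "nat \<Rightarrow> 'a"
  assumes d_d: "\<lbrakk>1 \<le> i; i \<le> N; 1 \<le> j; j \<le> N\<rbrakk> \<Longrightarrow> com (d i) (d j) = 0"
    and d_e: "\<lbrakk>1 \<le> i; i \<le> N; 1 \<le> j; j < N\<rbrakk> \<Longrightarrow>
      com (d i) (e j) = (if i = j then e j else 0) - (if i = j + 1 then e j else 0)"
    and d_f: "\<lbrakk>1 \<le> i; i \<le> N; 1 \<le> j; j < N\<rbrakk> \<Longrightarrow>
      com (d i) (f j) = (if i = j + 1 then f j else 0) - (if i = j then f j else 0)"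
    and e_f: "\<lbrakk>1 \<le> i; i < N; 1 \<le> j; j < N; i \<noteq> j\<rbrakk> \<Longrightarrow> com (e i) (f j) = 0"
    and e_f_same: "\<lbrakk>1 \<le> i; i < N\<rbrakk> \<Longrightarrow>
      sbr (odd_at m i) (odd_at m i) (e i) (f i) =
        d i - koszul (odd_at m i) (odd_at m i) (d (i + 1))"
begin

abbreviation "mu \<equiv> root_elem e f d"

text \<open>The analogue of the automorphism that sends x to minus its transpose. At m the bracket
  of e and f is an anticommutator, which is symmetric and gains no sign from the exchange; one of
  the two minus signs must therefore be dropped, and f_m goes to e_m. The square of the exchange
  changes the sign of e_m and f_m.\<close>

lemma opp:
  "chevalley N m (\<lambda>k. - f k) (\<lambda>k. if k = m then e k else - e k) (\<lambda>k. - d k)"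
proof (intro chevalley.intro chevalley_axioms.intro)
  show "serre N m (\<lambda>k. - f k)" using f.serre_sign[of "\<lambda>_. False"] by simp
  show "serre N m (\<lambda>k. if k = m then e k else - e k)" by (rule e.serre_sign)
next
  fix i j assume *: "1 \<le> i" "i < N" "1 \<le> j" "j < N" "i \<noteq> j"
  then have "com (e j) (f i) = 0" using e_f[of j i] by auto
  then show "com (- f i) (if j = m then e j else - e j) = 0"
    by (cases "j = m") auto
next
  fix i assume *: "1 \<le> i" "i < N"
  then show "sbr (odd_at m i) (odd_at m i) (- f i) (if i = m then e i else - e i) =
      - d i - koszul (odd_at m i) (odd_at m i) (- d (i + 1))"
    using e_f_same[of i] by (auto simp: odd_at_def sbr_def algebra_simps)
next
  fix i j assume *: "1 \<le> i" "i \<le> N" "1 \<le> j" "j < N"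
  show "com (- d i) (- f j) = (if i = j then - f j else 0) - (if i = j + 1 then - f j else 0)"
    using d_f[OF *] by (simp split: if_splits)
  have "com (- d i) (if j = m then e j else - e j) =
      (if j = m then - com (d i) (e j) else com (d i) (e j))"
    by simp
  then show "com (- d i) (if j = m then e j else - e j) =
      (if i = j + 1 then if j = m then e j else - e j else 0)
      - (if i = j then if j = m then e j else - e j else 0)"
    unfolding d_e[OF *] by simp
next
  fix i j assume "1 \<le> i" "i \<le> N" "1 \<le> j" "j \<le> N"
  then have "com (d i) (d j) = 0" by (rule d_d)
  then show "com (- d i) (- d j) = 0" by simp
qed

text \<open>For i \<le> j only the family -f enters, which carries no twist at m; for i > j a
  passage through m would cost an extra sign.\<close>

lemma mu_opp:
  "i \<le> j \<Longrightarrow>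
    root_elem (\<lambda>k. - f k) (\<lambda>k. if k = m then e k else - e k) (\<lambda>k. - d k) i j = - mu j i"
  by (auto simp: root_elem_def)

lemma mu_diag: "mu i i = d i"
  by (simp add: root_elem_def)

lemma mu_upper: "i < j \<Longrightarrow> mu i j = root_vec e i j"
  by (simp add: root_elem_def)

lemma mu_step_up: "i < j \<Longrightarrow> mu i (Suc j) = com (mu i j) (e j)"
  by (simp add: root_elem_def)

lemma mu_gen: "mu i (Suc i) = e i"
  by (simp add: root_elem_def)

section \<open>Action of the Chevalley generators on the upper triangular elements\<close>

lemma d_mu_upper:
  assumes "1 \<le> k" "k \<le> N" "1 \<le> i" "i \<le> j" "j \<le> N"
  shows "com (d k) (mu i j) = (if i = k then mu k j else 0) - (if j = k then mu i k else 0)"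
  using assms(4,5)
proof (induction j rule: dec_induct)
  case base
  with assms show ?case by (auto simp: mu_diag d_d)
next
  case (step j)
  show ?case
  proof (cases "i = j")
    case True
    with step assms show ?thesis by (auto simp: mu_gen d_e)
  next
    case False
    with step have ij: "i < j" by simp
    have IH: "com (d k) (mu i j) = (if i = k then mu k j else 0) - (if j = k then mu i k else 0)"
      using step by simp
    have de: "com (d k) (e j) = (if k = j then e j else 0) - (if k = j + 1 then e j else 0)"
      using step assms by (intro d_e) auto
    have "com (d k) (mu i (Suc j)) = com (com (d k) (mu i j)) (e j) + com (mu i j) (com (d k) (e j))"
      unfolding mu_step_up[OF ij] by (simp add: algebra_simps)
    then have "com (d k) (mu i (Suc j)) =
        (if i = k then com (mu i j) (e j) else 0) - (if k = Suc j then com (mu i j) (e j) else 0)"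
      unfolding IH de using ij by (cases "i = k"; cases "j = k") auto
    then show ?thesis using ij by (auto simp: mu_step_up)
  qed
qed

lemma e_mu_upper:
  assumes "1 \<le> i" "i \<le> j" "j \<le> N" "1 \<le> k" "k < N"
  shows "sbr (odd_at m k) (unit_par m i j) (e k) (mu i j) =
    (if k + 1 = i then mu k j else 0) - (if j = k then mu i (k + 1) else 0)"
proof (cases "i = j")
  case True
  then show ?thesis using assms d_e[of i k] by (auto simp: mu_diag mu_gen sbr_def algebra_simps)
next
  case False
  then show ?thesis using assms e.sbr_gen_root[of i j k] by (auto simp: mu_upper simp del: root_vec.simps)
qed

text \<open>Write e_(i,j+1) = [e_ij, e_j] and apply the Jacobi identity: the bracket of f_k with
  e_ij is known by induction and that with e_j from the Chevalley relations. An end factor is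
  removed if it has index k; otherwise the bracket is zero.\<close>

lemma f_mu_upper:
  assumes "1 \<le> i" "i < j" "j \<le> N" "1 \<le> k" "k < N"
  shows "sbr (odd_at m k) (unit_par m i j) (f k) (mu i j) =
    (if k = i then mu (k + 1) j else 0)
    - koszul (odd_at m k) (unit_par m i j) (if k + 1 = j then mu i k else 0)"
proof -
  have "Suc i \<le> j" using assms by simp
  then show ?thesis using assms(3)
  proof (induction j rule: dec_induct)
    case base
    show ?case
    proof (cases "k = i")
      case True
      have "sbr (odd_at m i) (odd_at m i) (f i) (e i) =
        d (i + 1) - koszul (odd_at m i) (odd_at m i) (d i)"
        unfolding sbr_swap[of _ _ "f i"] using e_f_same[of i] assms True
        by (simp add: koszul_koszul)
      then show ?thesis using True by (simp add: mu_gen mu_diag unit_par_Suc)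
    next
      case False
      then have "com (e i) (f k) = 0" using e_f[of i k] assms base by simp
      moreover have "odd_at m k = 0 \<or> odd_at m i = 0" using False by (auto simp: odd_at_def)
      ultimately show ?thesis using False by (auto simp: mu_gen unit_par_Suc sbr_def)
    qed
  next
    case (step j)
    have ij: "i < j" "1 \<le> j" "j < N" using step assms by auto
    let ?a = "odd_at m k" and ?b = "unit_par m i j" and ?c = "odd_at m j"
    have bc: "unit_par m i (Suc j) = ?b + ?c"
      using unit_par_add[of m i j "Suc j"] by simp
    \<comment> \<open>One of the two labels is even, so the commutator of the recursion is the
      superbracket to which the Jacobi identity applies.\<close>
    have mu: "mu i (Suc j) = sbr ?b ?c (mu i j) (e j)"
      using ij by (auto simp: mu_step_up sbr_def unit_par_def odd_at_def)
    have IH: "sbr ?a ?b (f k) (mu i j) =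
      (if k = i then mu (k + 1) j else 0) - koszul ?a ?b (if k + 1 = j then mu i k else 0)"
      using step by simp
    have fe: "sbr ?a ?c (f k) (e j) =
      (if k = j then d (j + 1) - koszul ?c ?c (d j) else 0)"
    proof (cases "k = j")
      case True
      then show ?thesis
        unfolding sbr_swap[of _ _ "f k"] using e_f_same[of j] ij
        by (simp add: koszul_koszul)
    next
      case False
      then have "com (e j) (f k) = 0" using e_f[of j k] assms ij by simp
      moreover have "odd_at m k = 0 \<or> odd_at m j = 0" using False by (auto simp: odd_at_def)
      ultimately show ?thesis using False by (auto simp: sbr_def)
    qed
    have jac: "sbr ?a (?b + ?c) (f k) (mu i (Suc j)) =
      sbr (?a + ?b) ?c (sbr ?a ?b (f k) (mu i j)) (e j)
      + koszul ?a ?b (sbr ?b (?a + ?c) (mu i j) (sbr ?a ?c (f k) (e j)))"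
      unfolding mu using sbr_jacobi[of ?a ?b ?c "f k" "mu i j" "e j"] by simp
    consider "k = j" | "k = i" "k + 1 = j" | "k = i" "k + 1 < j" | "k \<noteq> i" "k + 1 = j" | "k \<noteq> i" "k + 1 \<noteq> j" "k \<noteq> j"
      using ij by linarith
    then show ?case
    proof cases
      case 1
      \<comment> \<open>Of the two diagonal elements in [f_j, e_j], d_(j+1) commutes with e_ij and
        d_j acts by -1; the last factor is thereby removed.\<close>
      have D: "com (d (j + 1)) (mu i j) = 0" "com (d j) (mu i j) = - mu i j"
        using d_mu_upper[of "j + 1" i j] d_mu_upper[of j i j] ij assms by auto
      then have "mu i j * d (j + 1) - d (j + 1) * mu i j = 0" "mu i j * d j - d j * mu i j = mu i j"
        by (simp_all add: algebra_simps)
      then have "sbr ?b (?a + ?c) (mu i j) (d (j + 1) - koszul ?c ?c (d j)) = - koszul ?c ?c (mu i j)"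
        using 1 by (auto simp: odd_at_def sbr_def koszul_def algebra_simps)
      then show ?thesis unfolding bc jac unfolding IH fe using 1 ij
        by (auto simp: odd_at_def unit_par_def)
    next
      case 2
      \<comment> \<open>Here [f_i, e_i] is diagonal, and of its two terms only d_(i+1) acts on
        e_(i+1).\<close>
      have "com (d (Suc i)) (e (Suc i)) = e (Suc i)" "com (d i) (e (Suc i)) = 0"
        using d_e[of "Suc i" "Suc i"] d_e[of i "Suc i"] 2 ij assms by auto
      then show ?thesis unfolding bc jac unfolding IH fe using 2 ij
        by (auto simp: odd_at_def sbr_def unit_par_def mu_diag mu_gen koszul_def algebra_simps)
    next
      case 3
      then show ?thesis unfolding bc jac unfolding IH fe using ij mu_step_up[of "Suc k" j]
        by (auto simp: odd_at_def sbr_def unit_par_def)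
    next
      case 4
      \<comment> \<open>The induction hypothesis leaves \<open>mu i k\<close> with k = j - 1, whose
        factors are too far from j to interact with e_j.\<close>
      have "com (e j) (mu i k) = 0" using e.com_gen_right_of[of i k j] 4 ij assms
        by (auto simp: mu_upper simp del: root_vec.simps)
      then show ?thesis unfolding bc jac unfolding IH fe using 4 ij
        by (auto simp: odd_at_def sbr_def unit_par_def koszul_def)
    next
      case 5
      then show ?thesis unfolding bc jac unfolding IH fe using ij
        by (auto simp: odd_at_def sbr_def unit_par_def)
    qed
  qed
qed

section \<open>Closure under brackets: from the generators to all matrix units\<close>

definition acts :: "nat \<Rightarrow> nat \<Rightarrow> bool"
  where "acts i j \<longleftrightarrow> (\<forall>k l. 1 \<le> k \<longrightarrow> k \<le> N \<longrightarrow> 1 \<le> l \<longrightarrow> l \<le> N \<longrightarrow>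
    sbr (unit_par m i j) (unit_par m k l) (mu i j) (mu k l) =
      (if j = k then mu i l else 0)
      - koszul (unit_par m i j) (unit_par m k l) (if i = l then mu k j else 0))"

lemma acts_diag:
  assumes "1 \<le> i" "i \<le> N"
  shows "acts i i"
proof -
  interpret opp: chevalley N m "\<lambda>k. - f k" "\<lambda>k. if k = m then e k else - e k" "\<lambda>k. - d k"
    by (rule opp)
  have "com (d i) (mu k l) = (if i = k then mu i l else 0) - (if i = l then mu k i else 0)"
    if "1 \<le> k" "k \<le> N" "1 \<le> l" "l \<le> N" for k l
  proof (cases "k \<le> l")
    case True
    then show ?thesis using d_mu_upper[of i k l] assms that by auto
  next
    case False
    then show ?thesis using opp.d_mu_upper[of i l k] assms that
      by (auto simp: mu_opp split: if_splits)
  qed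
  then show ?thesis by (auto simp: acts_def sbr_def mu_diag)
qed

text \<open>For \<open>mu k l\<close> on or above the diagonal this is the action of e_i computed
  before. For \<open>mu k l\<close> below it, the exchanged family makes \<open>mu k l\<close> upper
  triangular and e_i an f-generator, both up to sign, so the action of f applies.\<close>

lemma acts_e:
  assumes "1 \<le> i" "i < N"
  shows "acts i (Suc i)"
proof -
  interpret opp: chevalley N m "\<lambda>k. - f k" "\<lambda>k. if k = m then e k else - e k" "\<lambda>k. - d k"
    by (rule opp)
  show ?thesis unfolding acts_def
  proof (intro allI impI)
    fix k l assume kl: "1 \<le> k" "k \<le> N" "1 \<le> l" "l \<le> N"
    show "sbr (unit_par m i (Suc i)) (unit_par m k l) (mu i (Suc i)) (mu k l) =
      (if Suc i = k then mu i l else 0)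
      - koszul (unit_par m i (Suc i)) (unit_par m k l) (if i = l then mu k (Suc i) else 0)"
    proof (cases "k \<le> l")
      case True
      then show ?thesis using e_mu_upper[of k l i] assms kl
        by (auto simp: mu_gen unit_par_Suc) (auto simp: odd_at_def unit_par_def)
    next
      case False
      \<comment> \<open>\<open>X\<close> is the bracket of the twisted e_i with
        \<open>- mu k l\<close> in the exchanged family. The two signs cancel except at i = m, where
        e_i is not negated and one sign remains.\<close>
      define X where "X = (if i = l then opp.mu (i + 1) k else 0)
        - koszul (odd_at m i) (unit_par m l k) (if i + 1 = k then opp.mu l i else 0)"
      have "sbr (odd_at m i) (unit_par m l k) (if i = m then e i else - e i) (- mu k l) = X"
        using opp.f_mu_upper[of l k i] False assms kl by (simp add: mu_opp X_def)
      then have "if i = m then - sbr (odd_at m i) (unit_par m l k) (e i) (mu k l) = X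
          else sbr (odd_at m i) (unit_par m l k) (e i) (mu k l) = X"
        by (cases "i = m") simp_all
      then have "sbr (odd_at m i) (unit_par m k l) (e i) (mu k l) = (if i = m then - X else X)"
        unfolding unit_par_sym[of m l k] by (metis minus_minus)
      then show ?thesis using False assms kl unfolding X_def
        by (auto simp: mu_gen mu_opp)
          (auto simp: odd_at_def unit_par_def koszul_def split: if_splits)
    qed
  qed
qed

lemma mu_gen_lower: "mu (Suc i) i = f i"
  by (simp add: root_elem_def)

lemma acts_f:
  assumes "1 \<le> i" "i < N"
  shows "acts (Suc i) i"
proof -
  interpret opp: chevalley N m "\<lambda>k. - f k" "\<lambda>k. if k = m then e k else - e k" "\<lambda>k. - d k"
    by (rule opp)
  show ?thesis unfolding acts_def
  proof (intro allI impI)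
    fix k l assume kl: "1 \<le> k" "k \<le> N" "1 \<le> l" "l \<le> N"
    show "sbr (unit_par m (Suc i) i) (unit_par m k l) (mu (Suc i) i) (mu k l) =
      (if i = k then mu (Suc i) l else 0)
      - koszul (unit_par m (Suc i) i) (unit_par m k l) (if Suc i = l then mu k i else 0)"
    proof (cases "k < l")
      case True
      then show ?thesis using f_mu_upper[of k l i] assms kl
        by (auto simp: mu_gen_lower unit_par_Suc')
    next
      case False
      then show ?thesis using opp.e_mu_upper[of l k i] assms kl
        by (auto simp: mu_gen_lower unit_par_Suc' mu_opp unit_par_sym[of l k])
           (auto simp: odd_at_def unit_par_def koszul_def split: if_splits)
    qed
  qed
qed

text \<open>When i and l differ, e_il = [e_ij, e_jl]; for i = l a combination of diagonal elements
  would appear instead. The Jacobi identity reduces the bracket with e_il to double brackets, each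
  evaluated by the two hypotheses.\<close>

lemma acts_bracket:
  assumes "acts i j" "acts j l" "1 \<le> i" "i \<le> N" "1 \<le> j" "j \<le> N" "1 \<le> l" "l \<le> N" "i \<noteq> l"
  shows "acts i l"
  unfolding acts_def
proof (intro allI impI)
  fix a b assume ab: "1 \<le> a" "a \<le> N" "1 \<le> b" "b \<le> N"
  have A: "sbr (unit_par m i j) (unit_par m k q) (mu i j) (mu k q) =
      (if j = k then mu i q else 0) - koszul (unit_par m i j) (unit_par m k q) (if i = q then mu k j else 0)"
    if "1 \<le> k" "k \<le> N" "1 \<le> q" "q \<le> N" for k q
    using assms that unfolding acts_def by blast
  have B: "sbr (unit_par m j l) (unit_par m k q) (mu j l) (mu k q) =
      (if l = k then mu j q else 0) - koszul (unit_par m j l) (unit_par m k q) (if j = q then mu k l else 0)"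
    if "1 \<le> k" "k \<le> N" "1 \<le> q" "q \<le> N" for k q
    using assms that unfolding acts_def by blast
  have mu: "mu i l = sbr (unit_par m i j) (unit_par m j l) (mu i j) (mu j l)"
    using A[of j l] assms by simp
  \<comment> \<open>\<open>T1\<close> to \<open>T4\<close> are the four double brackets. In the
    final sum the e_jj terms of \<open>T1\<close> and \<open>T4\<close> cancel, and so do the e_il
    terms of \<open>T2\<close> and \<open>T3\<close>.\<close>
  have T1: "sbr (unit_par m i j) (unit_par m j l + unit_par m a b) (mu i j) (if l = a then mu j b else 0) =
      (if l = a then mu i b - koszul (unit_par m i j) (unit_par m j b) (if i = b then mu j j else 0) else 0)"
    using A[of j b] assms ab by (cases "l = a") (simp_all only: unit_par_add, simp_all)
  have "unit_par m j l + unit_par m a j = unit_par m a l" by (metis add.commute unit_par_add)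
  then have T2: "sbr (unit_par m i j) (unit_par m j l + unit_par m a b) (mu i j) (if j = b then mu a l else 0) =
      (if j = b then if j = a then mu i l else 0 else 0)"
    using A[of a l] assms ab by (cases "j = b") (simp_all only: if_True if_False, simp_all)
  have T3: "sbr (unit_par m j l) (unit_par m i j + unit_par m a b) (mu j l) (if j = a then mu i b else 0) =
      (if j = a then - koszul (unit_par m j l) (unit_par m i b) (if j = b then mu i l else 0) else 0)"
    using B[of i b] assms ab by (cases "j = a") (simp_all only: unit_par_add, simp_all)
  have "unit_par m i j + unit_par m a i = unit_par m a j" by (metis add.commute unit_par_add)
  then have T4: "sbr (unit_par m j l) (unit_par m i j + unit_par m a b) (mu j l) (if i = b then mu a j else 0) =
      (if i = b then (if l = a then mu j j else 0) - koszul (unit_par m j l) (unit_par m a j) (mu a l) else 0)"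
    using B[of a j] assms ab by (cases "i = b") (simp_all only: if_True if_False, simp_all)
  have "sbr (unit_par m i l) (unit_par m a b) (mu i l) (mu a b) =
      sbr (unit_par m i j) (unit_par m j l + unit_par m a b) (mu i j) (sbr (unit_par m j l) (unit_par m a b) (mu j l) (mu a b))
      - koszul (unit_par m i j) (unit_par m j l) (sbr (unit_par m j l) (unit_par m i j + unit_par m a b) (mu j l)
          (sbr (unit_par m i j) (unit_par m a b) (mu i j) (mu a b)))"
    using sbr_jacobi[of "unit_par m i j" "unit_par m j l" "unit_par m a b" "mu i j" "mu j l" "mu a b"]
    unfolding unit_par_add[of m i j l] mu[symmetric] .
  then show "sbr (unit_par m i l) (unit_par m a b) (mu i l) (mu a b) =
      (if l = a then mu i b else 0) - koszul (unit_par m i l) (unit_par m a b) (if i = b then mu a l else 0)"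
    unfolding A[OF ab] B[OF ab] sbr_diff_right sbr_koszul_right T1 T2 T3 T4
    using \<open>i \<noteq> l\<close> by (auto simp: koszul_def unit_par_def)
qed

lemma acts_all:
  assumes "1 \<le> i" "i \<le> N" "1 \<le> j" "j \<le> N"
  shows "acts i j"
proof -
  have "acts i j \<and> acts j i" if "1 \<le> i" "i \<le> j" "j \<le> N" for i j
    using that(2,3)
  proof (induction j rule: dec_induct)
    case base
    then show ?case using acts_diag that by simp
  next
    case (step j)
    then have "acts i j" "acts j i" "acts j (Suc j)" "acts (Suc j) j"
      using acts_e[of j] acts_f[of j] that by auto
    then show ?case using acts_bracket[of i j "Suc j"] acts_bracket[of "Suc j" j i] step that by simp
  qed
  then show ?thesis using assms by (metis linear)
qed

end

section \<open>Computing in quotients of a ring\<close>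

text \<open>
  There is no type \<open>A / I\<close> depending on an ideal \<open>I\<close>, but the product of the quotients of \<open>A\<close> by all
  its two-sided ideals is a type.  For each \<open>I\<close> the map \<open>residue I\<close> below is a (non-unital) ring
  homomorphism into it with kernel \<open>I\<close>, so that congruences modulo \<open>I\<close> become equations in a ring.
\<close>

definition two_sided :: "'a::ring_1 set \<Rightarrow> bool"
  where "two_sided I \<longleftrightarrow>
    0 \<in> I \<and> (\<forall>x\<in>I. \<forall>y\<in>I. x + y \<in> I) \<and> (\<forall>x\<in>I. \<forall>a. a * x \<in> I \<and> x * a \<in> I)"

lemma two_sidedD:
  assumes "two_sided I"
  shows "0 \<in> I" "x \<in> I \<Longrightarrow> y \<in> I \<Longrightarrow> x + y \<in> I" "x \<in> I \<Longrightarrow> a * x \<in> I" "x \<in> I \<Longrightarrow> x * a \<in> I"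
    "x \<in> I \<Longrightarrow> - x \<in> I" "x \<in> I \<Longrightarrow> y \<in> I \<Longrightarrow> x - y \<in> I"
proof -
  show 1: "0 \<in> I" "x \<in> I \<Longrightarrow> y \<in> I \<Longrightarrow> x + y \<in> I" "x \<in> I \<Longrightarrow> a * x \<in> I" "x \<in> I \<Longrightarrow> x * a \<in> I" for x y a
    using assms by (auto simp: two_sided_def)
  show 2: "x \<in> I \<Longrightarrow> - x \<in> I" for x using 1(3)[of x "- 1"] by simp
  show "x \<in> I \<Longrightarrow> y \<in> I \<Longrightarrow> x - y \<in> I" using 1(2)[of x "- y"] 2[of y] by simp
qed

lemma add_diff_add': "(a + b) - (c + d) = (a - c) + (b - d)"
  and diff_diff_diff: "(a - b) - (c - d) = (a - c) - (b - d)"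
  and minus_diff_minus: "- a - - c = - (a - c)"
  for a b c d :: "'a::ab_group_add"
  by (simp_all add: algebra_simps)

\<comment> \<open>Two families are identified when they agree modulo every two-sided ideal, so the
  value at a set that is not an ideal carries no information.\<close>
quotient_type (overloaded) 'a quotients = "'a::ring_1 set \<Rightarrow> 'a" /
  "\<lambda>f g. \<forall>I. two_sided I \<longrightarrow> f I - g I \<in> I"
proof (rule equivpI)
  show "reflp (\<lambda>f g :: 'a set \<Rightarrow> 'a. \<forall>I. two_sided I \<longrightarrow> f I - g I \<in> I)"
    by (auto intro!: reflpI simp: two_sidedD)
  show "symp (\<lambda>f g :: 'a set \<Rightarrow> 'a. \<forall>I. two_sided I \<longrightarrow> f I - g I \<in> I)"
    by (intro sympI) (metis two_sidedD(5) minus_diff_eq)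
  show "transp (\<lambda>f g :: 'a set \<Rightarrow> 'a. \<forall>I. two_sided I \<longrightarrow> f I - g I \<in> I)"
    by (intro transpI) (metis two_sidedD(2) diff_add_cancel add_diff_eq)
qed

instantiation quotients :: (ring_1) ring
begin

lift_definition zero_quotients :: "'a quotients" is "\<lambda>_. 0" .

lift_definition plus_quotients :: "'a quotients \<Rightarrow> 'a quotients \<Rightarrow> 'a quotients" is "\<lambda>f g I. f I + g I"
  by (simp add: add_diff_add' two_sidedD(2))

lift_definition uminus_quotients :: "'a quotients \<Rightarrow> 'a quotients" is "\<lambda>f I. - f I"
  by (metis two_sidedD(5) minus_diff_minus)

lift_definition minus_quotients :: "'a quotients \<Rightarrow> 'a quotients \<Rightarrow> 'a quotients" is "\<lambda>f g I. f I - g I"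
  by (simp add: diff_diff_diff two_sidedD(6))

lift_definition times_quotients :: "'a quotients \<Rightarrow> 'a quotients \<Rightarrow> 'a quotients" is "\<lambda>f g I. f I * g I"
proof -
  fix f g h k :: "'a set \<Rightarrow> 'a" and I :: "'a set"
  assume *: "\<And>I. two_sided I \<Longrightarrow> f I - g I \<in> I" "\<And>I. two_sided I \<Longrightarrow> h I - k I \<in> I" "two_sided I"
  have "f I * h I - g I * k I = (f I - g I) * h I + g I * (h I - k I)"
    by (simp add: algebra_simps)
  with * two_sidedD show "f I * h I - g I * k I \<in> I" by metis
qed

instance
proof
  fix a b c :: "'a quotients"
  show "a + b + c = a + (b + c)" "a + b = b + a" "0 + a = a" "- a + a = 0" "a - b = a + - b"
    "a * b * c = a * (b * c)" "(a + b) * c = a * c + b * c" "a * (b + c) = a * b + a * c"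
    by (transfer; simp add: two_sidedD algebra_simps)+
qed

end

lift_definition residue :: "'a::ring_1 set \<Rightarrow> 'a \<Rightarrow> 'a quotients" is "\<lambda>I x J. if J = I then x else 0" .

lemma residue_add: "residue I (x + y) = residue I x + residue I y"
  by (transfer; simp add: two_sidedD)

lemma residue_diff: "residue I (x - y) = residue I x - residue I y"
  by (transfer; simp add: two_sidedD)

lemma residue_0 [simp]: "residue I 0 = 0"
  using residue_diff[of I 0 0] by simp

lemma residue_minus: "residue I (- x) = - residue I x"
  using residue_diff[of I 0 x] by simp

lemma residue_mult: "residue I (x * y) = residue I x * residue I y"
  by (transfer; simp add: two_sidedD)

lemma residue_eq_0_iff: "two_sided I \<Longrightarrow> residue I x = 0 \<longleftrightarrow> x \<in> I"
  by transfer (auto simp: two_sidedD)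

lemma residue_eq_iff: "two_sided I \<Longrightarrow> residue I x = residue I y \<longleftrightarrow> x - y \<in> I"
  by (metis residue_diff residue_eq_0_iff right_minus_eq)

lemma residue_sum: "residue I (sum f A) = (\<Sum>a\<in>A. residue I (f a))"
  by (induction A rule: infinite_finite_induct) (simp_all add: residue_add)

text \<open>The element \<open>h\<close> is one half in the original ring. Multiplication by it
  preserves each ideal, so the congruence for twice a component can be halved.\<close>

lemma quotients_torsion_free:
  fixes x :: "'a::ring_1 quotients"
  assumes "h + h = (1::'a)" and "x + x = 0"
  shows "x = 0"
  using assms(2)
proof (transfer, intro allI impI)
  fix f :: "'a set \<Rightarrow> 'a" and I :: "'a set"
  assume *: "\<forall>I. two_sided I \<longrightarrow> f I + f I - 0 \<in> I" "two_sided I"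
  have "h * (f I + f I) = f I" by (metis assms(1) distrib_left distrib_right mult_1)
  with * two_sidedD(3) show "f I - 0 \<in> I" by (metis diff_zero)
qed

section \<open>Free algebras and presentations\<close>

lemma zero_word_letters [simp]: "letters 0 = []"
  and plus_word_letters [simp]: "letters (v + w) = letters v @ letters w"
  by (simp_all add: zero_word_def plus_word_def)

lemma free_scalar_add: "free_scalar (a + b) = free_scalar a + free_scalar b"
  and free_scalar_mult: "free_scalar (a * b) = free_scalar a * free_scalar b"
  and free_scalar_0 [simp]: "free_scalar 0 = 0"
  and free_scalar_1 [simp]: "free_scalar 1 = 1"
  and free_scalar_diff: "free_scalar (a - b) = free_scalar a - free_scalar b"
  and free_scalar_minus: "free_scalar (- a) = - free_scalar a"
  by (simp_all add: free_scalar_def single_add single_diff single_uminus mult_single)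

lemma poly_mapping_single_induct [case_names single add]:
  assumes "\<And>w c. P (Poly_Mapping.single w c)"
    and "\<And>p q. P p \<Longrightarrow> P q \<Longrightarrow> P (p + q)"
  shows "P q"
proof (induction q rule: update_induct)
  case const
  then show ?case using assms(1)[of undefined 0] by simp
next
  case (update f a b)
  have "Poly_Mapping.update a b f = f + Poly_Mapping.single a b"
    using update(1) by (intro poly_mapping_eqI)
      (auto simp: lookup_update lookup_add lookup_single when_def in_keys_iff)
  then show ?case using update(3) assms by simp
qed

lemma free_scalar_commute: "free_scalar c * q = q * free_scalar c"
  by (induction q rule: poly_mapping_single_induct)
    (simp_all add: free_scalar_def mult_single algebra_simps)

text \<open>The homomorphic extension of \<open>s\<close>. Its target is again a free algebra,
  because a presented algebra is a structure on cosets and not a type; relations are imposed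
  afterwards by comparing residues.\<close>

definition subst :: "('x \<Rightarrow> 'y free_alg) \<Rightarrow> 'x free_alg \<Rightarrow> 'y free_alg"
  where "subst s q =
    (\<Sum>w\<in>Poly_Mapping.keys q. free_scalar (Poly_Mapping.lookup q w) * prod_list (map s (letters w)))"

lemma subst_superset:
  assumes "finite A" "Poly_Mapping.keys q \<subseteq> A"
  shows "subst s q = (\<Sum>w\<in>A. free_scalar (Poly_Mapping.lookup q w) * prod_list (map s (letters w)))"
  unfolding subst_def using assms
  by (intro sum.mono_neutral_left) (auto simp: in_keys_iff)

lemma subst_single: "subst s (Poly_Mapping.single w c) = free_scalar c * prod_list (map s (letters w))"
  by (cases "c = 0") (simp_all add: subst_def)

lemma subst_0 [simp]: "subst s 0 = 0"
  by (simp add: subst_def)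

lemma subst_add: "subst s (p + q) = subst s p + subst s q"
proof -
  let ?A = "Poly_Mapping.keys p \<union> Poly_Mapping.keys q"
  have "Poly_Mapping.keys (p + q) \<subseteq> ?A" by (rule keys_add)
  then show ?thesis
    by (simp add: subst_superset[of ?A] lookup_add free_scalar_add distrib_right sum.distrib)
qed

lemma subst_minus: "subst s (- p) = - subst s p"
  by (metis add_eq_0_iff subst_0 subst_add)

lemma subst_diff: "subst s (p - q) = subst s p - subst s q"
  using subst_add[of s p "- q"] by (simp add: subst_minus)

text \<open>By linearity it suffices to treat two monomials, where the scalar between the two words
  is pulled out because scalars are central.\<close>

lemma subst_mult: "subst s (p * q) = subst s p * subst s q"
proof (induction p rule: poly_mapping_single_induct)
  case (single v a)
  show ?case
  proof (induction q rule: poly_mapping_single_induct)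
    case (single w b)
    have "prod_list (map s (letters v)) * free_scalar b = free_scalar b * prod_list (map s (letters v))"
      by (rule free_scalar_commute[symmetric])
    then have "free_scalar a * free_scalar b * (prod_list (map s (letters v)) * z) =
        free_scalar a * prod_list (map s (letters v)) * (free_scalar b * z)" for z
      by (metis mult.assoc)
    then show ?case by (simp add: mult_single subst_single free_scalar_mult)
  qed (simp add: subst_add distrib_left)
qed (simp add: subst_add distrib_right)

lemma subst_gen [simp]: "subst s (gen x) = s x"
  by (simp add: gen_def subst_single)

lemma subst_free_scalar [simp]: "subst s (free_scalar c) = free_scalar c"
  by (simp add: free_scalar_def subst_single)

lemma subst_1 [simp]: "subst s 1 = 1"
  using subst_free_scalar[of s 1] by simp

lemma prod_list_gen: "prod_list (map gen xs) = Poly_Mapping.single (Word xs) 1"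
  by (induction xs) (auto simp: gen_def mult_single zero_word_def plus_word_def single_one[symmetric] simp del: single_one)

lemma subst_gen_id: "subst gen q = q"
proof (induction q rule: poly_mapping_single_induct)
  case (single w c)
  then show ?case by (simp add: subst_single prod_list_gen free_scalar_def mult_single)
qed (simp add: subst_add)

lemma subst_prod_list: "subst s (prod_list xs) = prod_list (map (subst s) xs)"
  by (induction xs) (simp_all add: subst_mult)

lemma subst_subst: "subst s (subst t q) = subst (\<lambda>x. subst s (t x)) q"
  by (induction q rule: poly_mapping_single_induct)
    (simp_all add: subst_single subst_add subst_mult subst_prod_list comp_def)

section \<open>Carrier and grading of the free superalgebra\<close>

definition free_carrier :: "'x set \<Rightarrow> 'x free_alg set"
  where "free_carrier X = {q. \<forall>w \<in> Poly_Mapping.keys q. set (letters w) \<subseteq> X}"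

definition free_grade :: "'x set \<Rightarrow> ('x \<Rightarrow> bit) \<Rightarrow> bit \<Rightarrow> 'x free_alg set"
  where "free_grade X p a =
    {q. \<forall>w \<in> Poly_Mapping.keys q. set (letters w) \<subseteq> X \<and> sum_list (map p (letters w)) = a}"

lemma free_grade_add: "u \<in> free_grade X p a \<Longrightarrow> v \<in> free_grade X p a \<Longrightarrow> u + v \<in> free_grade X p a"
  using keys_add[of u v] unfolding free_grade_def by blast

lemma keys_minus_free [simp]: "Poly_Mapping.keys (- u) = Poly_Mapping.keys u"
  for u :: "'k \<Rightarrow>\<^sub>0 'b::ab_group_add"
  by (auto simp: in_keys_iff)

lemma free_grade_minus: "u \<in> free_grade X p a \<Longrightarrow> - u \<in> free_grade X p a"
  by (simp add: free_grade_def)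

lemma free_grade_diff: "u \<in> free_grade X p a \<Longrightarrow> v \<in> free_grade X p a \<Longrightarrow> u - v \<in> free_grade X p a"
  using free_grade_add[of u X p a "- v"] free_grade_minus[of v X p a] by simp

lemma free_grade_mult:
  "u \<in> free_grade X p a \<Longrightarrow> v \<in> free_grade X p b \<Longrightarrow> u * v \<in> free_grade X p (a + b)"
  unfolding free_grade_def
proof (intro CollectI ballI)
  fix w assume u: "u \<in> {q. \<forall>w\<in>Poly_Mapping.keys q. set (letters w) \<subseteq> X \<and> sum_list (map p (letters w)) = a}"
    and v: "v \<in> {q. \<forall>w\<in>Poly_Mapping.keys q. set (letters w) \<subseteq> X \<and> sum_list (map p (letters w)) = b}"
    and "w \<in> Poly_Mapping.keys (u * v)"
  then obtain w1 w2 where w: "w = w1 + w2" "w1 \<in> Poly_Mapping.keys u" "w2 \<in> Poly_Mapping.keys v"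
    using keys_mult[of u v] by auto
  with u v have "set (letters w1) \<subseteq> X" "set (letters w2) \<subseteq> X"
    "sum_list (map p (letters w1)) = a" "sum_list (map p (letters w2)) = b" by auto
  then show "set (letters w) \<subseteq> X \<and> sum_list (map p (letters w)) = a + b"
    unfolding w(1) plus_word_letters map_append set_append sum_list_append by blast
qed

lemma free_grade_scalar: "free_scalar c \<in> free_grade X p 0"
  by (auto simp: free_scalar_def free_grade_def)

lemma free_grade_smult: "u \<in> free_grade X p a \<Longrightarrow> free_scalar c * u \<in> free_grade X p a"
  using free_grade_mult[OF free_grade_scalar, of u X p a c] unfolding add_0 .

lemma free_grade_gen: "x \<in> X \<Longrightarrow> gen x \<in> free_grade X p (p x)"
  by (simp add: gen_def free_grade_def)

lemma free_grade_0: "0 \<in> free_grade X p a"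
  by (simp add: free_grade_def)

lemma free_grade_sum: "(\<And>i. i \<in> A \<Longrightarrow> f i \<in> free_grade X p a) \<Longrightarrow> sum f A \<in> free_grade X p a"
proof (induction A rule: infinite_finite_induct)
  case (insert x A)
  then have "f x \<in> free_grade X p a" "sum f A \<in> free_grade X p a" by blast+
  then show ?case unfolding sum.insert[OF insert.hyps] by (rule free_grade_add)
qed (simp_all add: free_grade_0)

text \<open>If every letter has parity 0, all words over \<open>X\<close> lie in grade 0. Closure
  properties of the carrier thus become special cases of those of the grading.\<close>

lemma free_carrier_grade: "free_carrier X = free_grade X (\<lambda>_. 0) 0"
  by (simp add: free_carrier_def free_grade_def map_replicate_const sum_list_replicate)

lemma free_grade_carrier: "u \<in> free_grade X p a \<Longrightarrow> u \<in> free_carrier X"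
  by (simp add: free_carrier_def free_grade_def)

lemma free_carrier_closed:
  "u \<in> free_carrier X \<Longrightarrow> v \<in> free_carrier X \<Longrightarrow> u + v \<in> free_carrier X"
  "u \<in> free_carrier X \<Longrightarrow> v \<in> free_carrier X \<Longrightarrow> u * v \<in> free_carrier X"
  "u \<in> free_carrier X \<Longrightarrow> v \<in> free_carrier X \<Longrightarrow> u - v \<in> free_carrier X"
  "u \<in> free_carrier X \<Longrightarrow> - u \<in> free_carrier X"
  "0 \<in> free_carrier X" "1 \<in> free_carrier X" "free_scalar c \<in> free_carrier X"
  "x \<in> X \<Longrightarrow> gen x \<in> free_carrier X"
  unfolding free_carrier_grade
  using free_grade_add[of u X "\<lambda>_. 0" 0 v] free_grade_mult[of u X "\<lambda>_. 0" 0 v 0]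
    free_grade_diff[of u X "\<lambda>_. 0" 0 v] free_grade_minus[of u X "\<lambda>_. 0" 0]
    free_grade_0[of X "\<lambda>_. 0" 0] free_grade_scalar[of c X "\<lambda>_. 0"] free_grade_scalar[of 1 X "\<lambda>_. 0"]
    free_grade_gen[of x X "\<lambda>_. 0"]
  by simp_all

lemma free_grade_prod_list:
  assumes "\<And>x. x \<in> set xs \<Longrightarrow> s x \<in> free_grade Y q (p x)"
  shows "prod_list (map s xs) \<in> free_grade Y q (sum_list (map p xs))"
  using assms
proof (induction xs)
  case Nil
  then show ?case using free_grade_scalar[of 1 Y q] by simp
next
  case (Cons x xs)
  then have "s x \<in> free_grade Y q (p x)" "prod_list (map s xs) \<in> free_grade Y q (sum_list (map p xs))"
    by simp_all
  from free_grade_mult[OF this] show ?case by simp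
qed

lemma subst_grade:
  assumes s: "\<And>x. x \<in> X \<Longrightarrow> s x \<in> free_grade Y q (p x)" and u: "u \<in> free_grade X p a"
  shows "subst s u \<in> free_grade Y q a"
  unfolding subst_def
proof (rule free_grade_sum, rule free_grade_smult)
  fix w assume "w \<in> Poly_Mapping.keys u"
  with u have "set (letters w) \<subseteq> X" "sum_list (map p (letters w)) = a"
    unfolding free_grade_def by auto
  with free_grade_prod_list[of "letters w" s Y q p] s
  show "prod_list (map s (letters w)) \<in> free_grade Y q a" by blast
qed

lemma subst_carrier:
  assumes s: "\<And>x. x \<in> X \<Longrightarrow> s x \<in> free_carrier Y" and u: "u \<in> free_carrier X"
  shows "subst s u \<in> free_carrier Y"
  using subst_grade[of X s Y "\<lambda>_. 0" "\<lambda>_. 0" u 0] assms unfolding free_carrier_grade by simp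

lemma subst_cong: "(\<And>x. x \<in> X \<Longrightarrow> s x = t x) \<Longrightarrow> u \<in> free_carrier X \<Longrightarrow> subst s u = subst t u"
  unfolding subst_def free_carrier_def
  by (intro sum.cong refl arg_cong2[of _ _ _ _ "(*)"] arg_cong[of _ _ prod_list] map_cong) auto

lemma free_superalgebra_simps [simp]:
  "carrier (free_superalgebra X p) = free_carrier X"
  "x \<otimes>\<^bsub>free_superalgebra X p\<^esub> y = x * y"
  "\<one>\<^bsub>free_superalgebra X p\<^esub> = 1"
  "\<zero>\<^bsub>free_superalgebra X p\<^esub> = 0"
  "x \<oplus>\<^bsub>free_superalgebra X p\<^esub> y = x + y"
  "c \<odot>\<^bsub>free_superalgebra X p\<^esub> x = free_scalar c * x"
  "grade (free_superalgebra X p) a = free_grade X p a"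
  by (simp_all add: free_superalgebra_def free_carrier_def free_grade_def)

lemma free_superalgebra_ring: "ring (free_superalgebra X p)"
proof (rule ringI)
  show "abelian_group (free_superalgebra X p)"
  proof (rule abelian_groupI)
    fix x assume x: "x \<in> carrier (free_superalgebra X p)"
    then show "\<exists>y\<in>carrier (free_superalgebra X p). y \<oplus>\<^bsub>free_superalgebra X p\<^esub> x = \<zero>\<^bsub>free_superalgebra X p\<^esub>"
      by (intro bexI[of _ "- x"]) (simp_all add: free_carrier_closed)
  qed (simp_all add: free_carrier_closed algebra_simps)
  show "Group.monoid (free_superalgebra X p)"
    by (rule monoidI) (simp_all add: free_carrier_closed mult.assoc)
qed (simp_all add: distrib_left distrib_right)

section \<open>Presented superalgebras: relation ideals, residues and cosets\<close>

locale presentation =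
  fixes X :: "'x set" and p :: "'x \<Rightarrow> bit" and R :: "'x free_alg \<Rightarrow> 'x free_alg \<Rightarrow> bool"
  assumes relation_carrier: "R l r \<Longrightarrow> l - r \<in> free_carrier X"
begin

abbreviation Fr where "Fr \<equiv> free_superalgebra X p"
abbreviation I where "I \<equiv> relation_ideal X p R"

lemma ideal_I: "ideal I Fr"
  unfolding relation_ideal_def
  by (rule ring.genideal_ideal[OF free_superalgebra_ring]) (use relation_carrier in auto)

sublocale ideal I Fr by (rule ideal_I)

lemma relation_I: "R l r \<Longrightarrow> l - r \<in> I"
  unfolding relation_ideal_def
  using genideal_self[of "{l - r |l r. R l r}"] relation_carrier by auto

lemma I_carrier: "x \<in> I \<Longrightarrow> x \<in> free_carrier X"
  using a_Hcarr by simp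

lemma I_closed:
  "0 \<in> I" "x \<in> I \<Longrightarrow> y \<in> I \<Longrightarrow> x + y \<in> I"
  "x \<in> I \<Longrightarrow> a \<in> free_carrier X \<Longrightarrow> a * x \<in> I"
  "x \<in> I \<Longrightarrow> a \<in> free_carrier X \<Longrightarrow> x * a \<in> I"
  using additive_subgroup.zero_closed[OF is_additive_subgroup] additive_subgroup.a_closed[OF is_additive_subgroup, of x y]
    I_l_closed[of x a] I_r_closed[of x a] by simp_all

lemma I_minimal:
  assumes "ideal J Fr" "\<And>l r. R l r \<Longrightarrow> l - r \<in> J"
  shows "I \<subseteq> J"
  unfolding relation_ideal_def using assms by (intro genideal_minimal) auto

text \<open>
  The ideal \<open>I\<close> lives in the subalgebra on the letters \<open>X\<close>; its preimage \<open>J\<close> under the retraction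
  that kills all other letters is a two-sided ideal of the whole type.
\<close>

definition proj :: "'x free_alg \<Rightarrow> 'x free_alg"
  where "proj = subst (\<lambda>x. if x \<in> X then gen x else 0)"

lemma proj_carrier: "proj q \<in> free_carrier X"
  unfolding proj_def
  by (rule subst_carrier[of UNIV]) (simp_all add: free_carrier_closed free_carrier_def[of UNIV])

lemma proj_id: "q \<in> free_carrier X \<Longrightarrow> proj q = q"
  unfolding proj_def using subst_cong[of X "\<lambda>x. if x \<in> X then gen x else 0" gen q]
  by (simp add: subst_gen_id)

definition J :: "'x free_alg set"
  where "J = {q. proj q \<in> I}"

lemma two_sided_J: "two_sided J"
proof -
  have "proj 0 = 0" "proj (x + y) = proj x + proj y" "proj (x * y) = proj x * proj y" for x y
    by (simp_all add: proj_def subst_add subst_mult)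
  then show ?thesis
    unfolding two_sided_def J_def by (simp add: I_closed proj_carrier)
qed

lemma J_iff: "q \<in> free_carrier X \<Longrightarrow> q \<in> J \<longleftrightarrow> q \<in> I"
  by (simp add: J_def proj_id)

definition res :: "'x free_alg \<Rightarrow> 'x free_alg quotients"
  where "res = residue J"

lemma res_simps:
  "res (x + y) = res x + res y" "res (x - y) = res x - res y" "res (- x) = - res x"
  "res (x * y) = res x * res y" "res 0 = 0"
  by (simp_all add: res_def residue_add residue_diff residue_minus residue_mult)

lemma res_relation: "R l r \<Longrightarrow> res l = res r"
  unfolding res_def
  by (simp add: residue_eq_iff two_sided_J J_iff relation_carrier relation_I)

lemma res_eq_iff:
  "x \<in> free_carrier X \<Longrightarrow> y \<in> free_carrier X \<Longrightarrow> res x = res y \<longleftrightarrow> x - y \<in> I"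
  by (simp add: res_def residue_eq_iff two_sided_J J_iff free_carrier_closed)

lemma subst_res_cong:
  assumes "\<And>x. x \<in> Z \<Longrightarrow> res (s x) = res (t x)" and "u \<in> free_carrier Z"
  shows "res (subst s u) = res (subst t u)"
proof -
  have *: "res (prod_list (map s xs)) = res (prod_list (map t xs))" if "set xs \<subseteq> Z" for xs
    using that by (induction xs) (simp_all add: res_simps assms)
  have "res (subst s u) = (\<Sum>w\<in>Poly_Mapping.keys u.
      res (free_scalar (Poly_Mapping.lookup u w)) * res (prod_list (map s (letters w))))" for s
    unfolding subst_def by (simp add: res_def residue_sum residue_mult)
  then show ?thesis using assms(2) * by (simp add: free_carrier_def)
qed

abbreviation P where "P \<equiv> presented_superalgebra X p R"
abbreviation cls where "cls \<equiv> presented_class X p R"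

lemma cls_def: "cls q = I +>\<^bsub>Fr\<^esub> q"
  by (simp add: presented_class_def)

lemma cls_eq: "cls q = (\<lambda>h. h + q) ` I"
  by (auto simp: cls_def a_r_coset_def r_coset_def)

lemma cls_eq_iff:
  assumes "x \<in> free_carrier X" "y \<in> free_carrier X"
  shows "cls x = cls y \<longleftrightarrow> x - y \<in> I"
proof
  assume "cls x = cls y"
  then have "0 + x \<in> (\<lambda>h. h + y) ` I" unfolding cls_eq using I_closed(1) by blast
  then show "x - y \<in> I" by auto
next
  assume *: "x - y \<in> I"
  then have **: "y - x \<in> I" using I_closed(3)[of "x - y" "- 1"] by (simp add: free_carrier_closed)
  show "cls x = cls y" unfolding cls_eq
  proof (intro equalityI image_subsetI)
    fix h assume "h \<in> I"
    then have "h + (x - y) \<in> I" "h + (y - x) \<in> I" using * ** I_closed(2) by blast+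
    then show "h + x \<in> (\<lambda>h. h + y) ` I" "h + y \<in> (\<lambda>h. h + x) ` I"
      using image_eqI[of "h + x" "\<lambda>h. h + y" "h + (x - y)" I]
        image_eqI[of "h + y" "\<lambda>h. h + x" "h + (y - x)" I] by simp_all
  qed
qed

text \<open>Passes from equality of cosets to equations in a ring type, where the usual algebraic
  rewriting is available.\<close>

lemma cls_res: "x \<in> free_carrier X \<Longrightarrow> y \<in> free_carrier X \<Longrightarrow> cls x = cls y \<longleftrightarrow> res x = res y"
  by (simp add: cls_eq_iff res_eq_iff)

lemma P_simps:
  "carrier P = cls ` free_carrier X"
  "x \<in> free_carrier X \<Longrightarrow> y \<in> free_carrier X \<Longrightarrow> cls x \<otimes>\<^bsub>P\<^esub> cls y = cls (x * y)"
  "x \<in> free_carrier X \<Longrightarrow> y \<in> free_carrier X \<Longrightarrow> cls x \<oplus>\<^bsub>P\<^esub> cls y = cls (x + y)"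
  "\<one>\<^bsub>P\<^esub> = cls 1"
  "grade P a = cls ` free_grade X p a"
  "c \<odot>\<^bsub>P\<^esub> C = (\<Union>x\<in>C. cls (free_scalar c * x))"
proof -
  show "carrier P = cls ` free_carrier X"
    by (auto simp: presented_superalgebra_def super_quot_def ring.defs FactRing_def
        A_RCOSETS_def RCOSETS_def cls_def a_r_coset_def)
  show "x \<in> free_carrier X \<Longrightarrow> y \<in> free_carrier X \<Longrightarrow> cls x \<otimes>\<^bsub>P\<^esub> cls y = cls (x * y)"
    using rcoset_mult_add[of x y]
    by (simp add: presented_superalgebra_def super_quot_def ring.defs FactRing_def cls_def)
  show "x \<in> free_carrier X \<Longrightarrow> y \<in> free_carrier X \<Longrightarrow> cls x \<oplus>\<^bsub>P\<^esub> cls y = cls (x + y)"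
    using a_rcos_sum[of x y]
    by (simp add: presented_superalgebra_def super_quot_def ring.defs FactRing_def cls_def)
qed (auto simp: presented_superalgebra_def super_quot_def ring.defs FactRing_def cls_def)

text \<open>The scalar action is a union over representatives. They all give the same coset, since
  the ideal absorbs multiplication by scalars.\<close>

lemma P_smult:
  assumes "x \<in> free_carrier X"
  shows "c \<odot>\<^bsub>P\<^esub> cls x = cls (free_scalar c * x)"
proof -
  have "cls (free_scalar c * y) = cls (free_scalar c * x)" if "y \<in> cls x" for y
  proof -
    from that obtain h where h: "h \<in> I" "y = h + x" unfolding cls_eq by auto
    then have "free_scalar c * y - free_scalar c * x \<in> I"
      using I_closed(3)[of h "free_scalar c"] by (simp add: free_carrier_closed algebra_simps)
    then show ?thesis using h assms I_carrier
      by (subst cls_eq_iff) (auto simp: free_carrier_closed)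
  qed
  moreover have "x \<in> cls x" unfolding cls_eq using I_closed(1) by force
  ultimately show ?thesis unfolding P_simps by blast
qed

end

text \<open>A substitution descends to the quotients once it respects the relations, and whether the
  two induced maps are inverse to each other can be tested on generators. Both substitutions
  preserve parity, hence so does the isomorphism.\<close>

theorem presented_superalgebra_has_presentation:
  assumes P1: "presentation X R" and P2: "presentation Y R'"
    and s: "\<And>x. x \<in> X \<Longrightarrow> s x \<in> free_grade Y q (p x)"
    and t: "\<And>y. y \<in> Y \<Longrightarrow> t y \<in> free_grade X p (q y)"
    and s_rel: "\<And>l r. R l r \<Longrightarrow> presentation.res Y q R' (subst s l) = presentation.res Y q R' (subst s r)"
    and t_rel: "\<And>l r. R' l r \<Longrightarrow> presentation.res X p R (subst t l) = presentation.res X p R (subst t r)"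
    and ts: "\<And>x. x \<in> X \<Longrightarrow> presentation.res X p R (subst t (s x)) = presentation.res X p R (gen x)"
    and st: "\<And>y. y \<in> Y \<Longrightarrow> presentation.res Y q R' (subst s (t y)) = presentation.res Y q R' (gen y)"
    and g: "\<And>x. x \<in> X \<Longrightarrow> g x = presented_class Y q R' (s x)"
  shows "has_presentation (presented_superalgebra Y q R') X p R g"
proof -
  interpret A: presentation X p R by (rule P1)
  interpret B: presentation Y q R' by (rule P2)
  have sc: "subst s u \<in> free_carrier Y" if "u \<in> free_carrier X" for u
    using that s free_grade_carrier by (blast intro: subst_carrier)
  have tc: "subst t u \<in> free_carrier X" if "u \<in> free_carrier Y" for u
    using that t free_grade_carrier by (blast intro: subst_carrier)
  have S: "B.res (subst s u) = 0" if "u \<in> A.I" for u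
  proof -
    \<comment> \<open>The kernel of substitution followed by residue is an ideal that contains the
      relations, hence the ideal generated by them.\<close>
    let ?K = "{u \<in> free_carrier X. B.res (subst s u) = 0}"
    have "ideal ?K A.Fr"
    proof (rule idealI)
      show "ring A.Fr" by (rule free_superalgebra_ring)
      show "subgroup ?K (add_monoid A.Fr)"
      proof (rule group.subgroupI)
        show "group (add_monoid A.Fr)"
          using abelian_group.a_group[OF ring.is_abelian_group[OF free_superalgebra_ring]] .
        fix u assume u: "u \<in> ?K"
        then have "inv\<^bsub>add_monoid A.Fr\<^esub> u = - u"
          using A.minus_equality[of "- u" u] by (simp add: a_inv_def free_carrier_closed)
        then show "inv\<^bsub>add_monoid A.Fr\<^esub> u \<in> ?K"
          using u by (simp add: free_carrier_closed subst_minus B.res_simps)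
      qed (auto simp: free_carrier_closed subst_add B.res_simps intro!: exI[of _ 0])
    qed (auto simp: free_carrier_closed subst_mult B.res_simps)
    moreover have "l - r \<in> ?K" if "R l r" for l r
      using s_rel[OF that] A.relation_carrier[OF that] by (simp add: subst_diff B.res_simps)
    ultimately have "A.I \<subseteq> ?K" by (rule A.I_minimal)
    with that show ?thesis by blast
  qed
  have T: "A.res (subst t u) = 0" if "u \<in> B.I" for u
  proof -
    let ?K = "{u \<in> free_carrier Y. A.res (subst t u) = 0}"
    have "ideal ?K B.Fr"
    proof (rule idealI)
      show "ring B.Fr" by (rule free_superalgebra_ring)
      show "subgroup ?K (add_monoid B.Fr)"
      proof (rule group.subgroupI)
        show "group (add_monoid B.Fr)"
          using abelian_group.a_group[OF ring.is_abelian_group[OF free_superalgebra_ring]] .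
        fix u assume u: "u \<in> ?K"
        then have "inv\<^bsub>add_monoid B.Fr\<^esub> u = - u"
          using B.minus_equality[of "- u" u] by (simp add: a_inv_def free_carrier_closed)
        then show "inv\<^bsub>add_monoid B.Fr\<^esub> u \<in> ?K"
          using u by (simp add: free_carrier_closed subst_minus A.res_simps)
      qed (auto simp: free_carrier_closed subst_add A.res_simps intro!: exI[of _ 0])
    qed (auto simp: free_carrier_closed subst_mult A.res_simps)
    moreover have "l - r \<in> ?K" if "R' l r" for l r
      using t_rel[OF that] B.relation_carrier[OF that] by (simp add: subst_diff A.res_simps)
    ultimately have "B.I \<subseteq> ?K" by (rule B.I_minimal)
    with that show ?thesis by blast
  qed
  have TS: "A.res (subst t (subst s u)) = A.res u" if "u \<in> free_carrier X" for u
    using A.subst_res_cong[of X "\<lambda>x. subst t (s x)" gen u] ts that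
    by (simp add: subst_subst subst_gen_id)
  have ST: "B.res (subst s (subst t u)) = B.res u" if "u \<in> free_carrier Y" for u
    using B.subst_res_cong[of Y "\<lambda>x. subst s (t x)" gen u] st that
    by (simp add: subst_subst subst_gen_id)
  have S_eq: "B.res (subst s u) = B.res (subst s v)"
    if "A.res u = A.res v" "u \<in> free_carrier X" "v \<in> free_carrier X" for u v
    using S[of "u - v"] that by (simp add: A.res_eq_iff subst_diff B.res_simps)
  have T_eq: "A.res (subst t u) = A.res (subst t v)"
    if "B.res u = B.res v" "u \<in> free_carrier Y" "v \<in> free_carrier Y" for u v
    using T[of "u - v"] that by (simp add: B.res_eq_iff subst_diff A.res_simps)
  \<comment> \<open>All representatives of a class have the same image coset, so the union is that
    coset.\<close>
  define \<phi> where "\<phi> C = (\<Union>u\<in>C. B.cls (subst s u))" for C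
  have \<phi>: "\<phi> (A.cls u) = B.cls (subst s u)" if u: "u \<in> free_carrier X" for u
  proof -
    have "B.cls (subst s v) = B.cls (subst s u)" if "v \<in> A.cls u" for v
    proof -
      from that obtain h where h: "h \<in> A.I" "v = h + u" unfolding A.cls_eq by auto
      then have "v \<in> free_carrier X" using A.I_carrier u by (simp add: free_carrier_closed)
      moreover have "B.res (subst s v) = B.res (subst s u)"
        using S[OF h(1)] h(2) by (simp add: subst_add B.res_simps)
      ultimately show ?thesis using u sc by (simp add: B.cls_res)
    qed
    moreover have "u \<in> A.cls u" unfolding A.cls_eq using A.I_closed(1) by force
    ultimately show ?thesis unfolding \<phi>_def by blast
  qed
  have grade_S: "subst s u \<in> free_grade Y q a" if "u \<in> free_grade X p a" for u a
    using that s by (rule subst_grade[rotated])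
  have grade_T: "subst t u \<in> free_grade X p a" if "u \<in> free_grade Y q a" for u a
    using that t by (rule subst_grade[rotated])
  have "\<phi> \<in> ring_iso A.P B.P"
  proof (rule ring_iso_memI)
    fix C D assume "C \<in> carrier A.P" "D \<in> carrier A.P"
    then obtain u v where uv: "u \<in> free_carrier X" "v \<in> free_carrier X" "C = A.cls u" "D = A.cls v"
      unfolding A.P_simps by auto
    then show "\<phi> C \<in> carrier B.P"
      "\<phi> (C \<otimes>\<^bsub>A.P\<^esub> D) = \<phi> C \<otimes>\<^bsub>B.P\<^esub> \<phi> D" "\<phi> (C \<oplus>\<^bsub>A.P\<^esub> D) = \<phi> C \<oplus>\<^bsub>B.P\<^esub> \<phi> D"
      using sc by (auto simp: A.P_simps B.P_simps \<phi> free_carrier_closed subst_mult subst_add)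
  next
    show "\<phi> \<one>\<^bsub>A.P\<^esub> = \<one>\<^bsub>B.P\<^esub>"
      by (simp add: A.P_simps B.P_simps \<phi> free_carrier_closed)
  next
    show "bij_betw \<phi> (carrier A.P) (carrier B.P)"
      unfolding A.P_simps B.P_simps
    proof (rule bij_betw_imageI)
      show "inj_on \<phi> (A.cls ` free_carrier X)"
      proof (rule inj_onI, clarify)
        fix u v assume uv: "u \<in> free_carrier X" "v \<in> free_carrier X" "\<phi> (A.cls u) = \<phi> (A.cls v)"
        then have "B.res (subst s u) = B.res (subst s v)"
          using sc by (simp add: \<phi> B.cls_res)
        \<comment> \<open>Applying \<open>t\<close> recovers u and v modulo the relations.\<close>
        then have "A.res u = A.res v" using T_eq uv sc TS by metis
        with uv show "A.cls u = A.cls v" by (simp add: A.cls_res)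
      qed
      show "\<phi> ` A.cls ` free_carrier X = B.cls ` free_carrier Y"
      proof (intro equalityI subsetI)
        fix D assume "D \<in> B.cls ` free_carrier Y"
        then obtain v where v: "v \<in> free_carrier Y" "D = B.cls v" by auto
        then have "D = \<phi> (A.cls (subst t v))"
          using tc sc ST[of v] by (simp add: \<phi> B.cls_res)
        then show "D \<in> \<phi> ` A.cls ` free_carrier X" using v tc by blast
      qed (use sc \<phi> in auto)
    qed
  qed
  moreover have "\<phi> (c \<odot>\<^bsub>A.P\<^esub> C) = c \<odot>\<^bsub>B.P\<^esub> \<phi> C" if "C \<in> carrier A.P" for c C
  proof -
    from that obtain u where u: "u \<in> free_carrier X" "C = A.cls u"
      unfolding A.P_simps by auto
    then show ?thesis using sc
      by (simp add: A.P_smult B.P_smult \<phi> free_carrier_closed subst_mult)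
  qed
  moreover have "\<phi> ` grade A.P a = grade B.P a" for a
    unfolding A.P_simps B.P_simps
  proof (intro equalityI subsetI)
    fix D assume "D \<in> \<phi> ` A.cls ` free_grade X p a"
    then show "D \<in> B.cls ` free_grade Y q a"
      using grade_S free_grade_carrier[of _ X p a] by (auto simp: \<phi>)
  next
    fix D assume "D \<in> B.cls ` free_grade Y q a"
    then obtain v where v: "v \<in> free_grade Y q a" "D = B.cls v" by auto
    then have "v \<in> free_carrier Y" by (blast intro: free_grade_carrier)
    with v have "D = \<phi> (A.cls (subst t v))"
      using tc sc ST[of v] by (simp add: \<phi> B.cls_res)
    then show "D \<in> \<phi> ` A.cls ` free_grade X p a" using v grade_T by blast
  qed
  ultimately have "\<phi> \<in> superalgebra_iso A.P B.P"
    by (simp add: superalgebra_iso_def)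
  moreover have "\<phi> (A.cls (gen x)) = g x" if "x \<in> X" for x
    using that by (simp add: \<phi> free_carrier_closed g)
  ultimately show ?thesis unfolding has_presentation_def by blast
qed

section \<open>The Lie superalgebra of matrices\<close>

lemma UNIV_bit_eq: "(UNIV :: bit set) = {0, 1}"
  using bit.exhaust by auto

lemma bit_add_1_neq: "a + 1 \<noteq> (a :: bit)"
  by (cases a) simp_all

lemma bit_neq_iff: "a \<noteq> b \<longleftrightarrow> a = b + (1 :: bit)"
  by (cases a; cases b) simp_all

text \<open>The structure needed to evaluate \<open>super_bracket\<close> on homogeneous elements:
  \<open>grade_unique\<close> makes the description in \<open>hom_part\<close> definite, and the
  zero laws clear the terms of the wrong parity.\<close>

locale graded_algebra =
  fixes A :: "('a, 'z) superalgebra_scheme" (structure)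
  assumes abelian_group: "abelian_group A"
    and mult_closed: "x \<in> carrier A \<Longrightarrow> y \<in> carrier A \<Longrightarrow> x \<otimes> y \<in> carrier A"
    and mult_zero: "x \<in> carrier A \<Longrightarrow> \<zero> \<otimes> x = \<zero>" "x \<in> carrier A \<Longrightarrow> x \<otimes> \<zero> = \<zero>"
    and smult_closed: "x \<in> carrier A \<Longrightarrow> c \<odot>\<^bsub>A\<^esub> x \<in> carrier A"
    and smult_zero: "c \<odot>\<^bsub>A\<^esub> \<zero> = \<zero>"
    and grade_carrier: "x \<in> grade A a \<Longrightarrow> x \<in> carrier A"
    and grade_zero: "\<zero> \<in> grade A a"
    and grade_unique: "\<lbrakk>u \<in> grade A a; v \<in> grade A (a + 1); u' \<in> grade A a; v' \<in> grade A (a + 1);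
      u \<oplus> v = u' \<oplus> v'\<rbrakk> \<Longrightarrow> u = u'"
begin

sublocale abelian_group A by (rule abelian_group)

lemma hom_part_homogeneous:
  assumes "x \<in> grade A a"
  shows "hom_part A b x = (if b = a then x else \<zero>)"
proof -
  have *: "hom_part A b x = u" if "u \<in> grade A b" "v \<in> grade A (b + 1)" "x = u \<oplus> v" for u v
    unfolding hom_part_def using that by (intro the_equality) (auto intro: grade_unique)
  show ?thesis
  proof (cases "b = a")
    case True
    then show ?thesis using *[of x \<zero>] assms grade_zero grade_carrier by simp
  next
    case False
    then have "a = b + 1" using bit_neq_iff[of a b] by simp
    then show ?thesis using *[of \<zero> x] assms grade_zero grade_carrier False by simp
  qed
qed

text \<open>In the double sum over parities only the term at (a, b) survives, since the other
  homogeneous parts are zero.\<close>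

lemma super_bracket_homogeneous:
  assumes x: "x \<in> grade A a" and y: "y \<in> grade A b"
  shows "super_bracket A x y = x \<otimes> y \<ominus> super_sign a b \<odot>\<^bsub>A\<^esub> (y \<otimes> x)"
proof -
  let ?z = "x \<otimes> y \<ominus> super_sign a b \<odot>\<^bsub>A\<^esub> (y \<otimes> x)"
  have c: "x \<in> carrier A" "y \<in> carrier A" using x y grade_carrier by auto
  then have z: "?z \<in> carrier A" by (simp add: mult_closed smult_closed)
  have "hom_part A a' x \<otimes> hom_part A b' y
      \<ominus> super_sign a' b' \<odot>\<^bsub>A\<^esub> (hom_part A b' y \<otimes> hom_part A a' x) =
      (if a = a' then (if b = b' then ?z else \<zero>) else \<zero>)" for a' b'
    using c by (auto simp: hom_part_homogeneous[OF x] hom_part_homogeneous[OF y]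
        mult_zero smult_zero minus_eq)
  then have "super_bracket A x y =
      (\<Oplus>a'\<in>UNIV. \<Oplus>b'\<in>UNIV. (if a = a' then (if b = b' then ?z else \<zero>) else \<zero>))"
    by (simp add: super_bracket_def)
  also have "\<dots> = (\<Oplus>a'\<in>UNIV. (if a = a' then (\<Oplus>b'\<in>UNIV. if b = b' then ?z else \<zero>) else \<zero>))"
    by (intro arg_cong[of _ _ "\<lambda>f. finsum A f UNIV"] ext) simp
  also have "(\<Oplus>b'\<in>UNIV. if b = b' then ?z else \<zero>) = ?z"
    using z by (intro add.finprod_singleton[where f = "\<lambda>_. ?z"]) (auto simp: UNIV_bit_eq)
  also have "(\<Oplus>a'\<in>UNIV. if a = a' then ?z else \<zero>) = ?z"
    using z by (intro add.finprod_singleton[where f = "\<lambda>_. ?z"]) (auto simp: UNIV_bit_eq)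
  finally show ?thesis .
qed

end

section \<open>Brackets in the free superalgebra\<close>

lemma free_grade_disjoint:
  assumes "u \<in> free_grade X p a" "u \<in> free_grade X p (a + 1)"
  shows "u = 0"
proof -
  have "Poly_Mapping.keys u = {}"
    using assms bit_add_1_neq[of a] unfolding free_grade_def by force
  then show ?thesis by simp
qed

lemma free_superalgebra_minus:
  assumes "x \<in> free_carrier X" "y \<in> free_carrier X"
  shows "x \<ominus>\<^bsub>free_superalgebra X p\<^esub> y = x - y"
proof -
  interpret ring "free_superalgebra X p" by (rule free_superalgebra_ring)
  have "\<ominus>\<^bsub>free_superalgebra X p\<^esub> y = - y"
    using assms by (intro minus_equality) (simp_all add: free_carrier_closed)
  then show ?thesis by (simp add: minus_eq)
qed

lemma graded_algebra_free: "graded_algebra (free_superalgebra X p)"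
proof (rule graded_algebra.intro)
  show "abelian_group (free_superalgebra X p)"
    by (rule ring.is_abelian_group[OF free_superalgebra_ring])
  fix u v u' v' a
  assume *: "u \<in> grade (free_superalgebra X p) a" "v \<in> grade (free_superalgebra X p) (a + 1)"
    "u' \<in> grade (free_superalgebra X p) a" "v' \<in> grade (free_superalgebra X p) (a + 1)"
    "u \<oplus>\<^bsub>free_superalgebra X p\<^esub> v = u' \<oplus>\<^bsub>free_superalgebra X p\<^esub> v'"
  then have "u - u' = v' - v" by (simp add: algebra_simps)
  moreover have "u - u' \<in> free_grade X p a" "v' - v \<in> free_grade X p (a + 1)"
    using * free_grade_diff by (auto simp del: One_nat_def)
  ultimately have "u - u' = 0" using free_grade_disjoint by metis
  then show "u = u'" by simp
qed (auto simp: free_carrier_closed free_grade_0 intro: free_grade_carrier)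

lemma koszul_eq_super_sign: "koszul a b x = free_scalar (super_sign a b) * x"
  by (auto simp: koszul_def super_sign_def free_scalar_minus)

lemma free_bracket:
  assumes "u \<in> free_grade X p a" "v \<in> free_grade X p b"
  shows "super_bracket (free_superalgebra X p) u v = sbr a b u v"
proof -
  have "u \<in> free_carrier X" "v \<in> free_carrier X" using assms free_grade_carrier by auto
  then show ?thesis
    using graded_algebra.super_bracket_homogeneous[OF graded_algebra_free[of X p], of u a v b] assms
    by (simp add: free_superalgebra_minus free_carrier_closed sbr_def koszul_eq_super_sign)
qed

lemma free_grade_sbr:
  assumes "u \<in> free_grade X p a" "v \<in> free_grade X p b"
  shows "sbr a b u v \<in> free_grade X p (a + b)"
  unfolding sbr_def koszul_eq_super_sign
  by (rule free_grade_diff[OF free_grade_mult[OF assms] free_grade_smult])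
    (use free_grade_mult[OF assms(2,1)] in \<open>simp only: add.commute\<close>)

section \<open>The superalgebra of matrices and its grading\<close>

lemma super_mat_simps [simp]:
  "carrier (super_mat m n) = carrier_mat (m + n) (m + n)"
  "x \<otimes>\<^bsub>super_mat m n\<^esub> y = x * y"
  "\<one>\<^bsub>super_mat m n\<^esub> = 1\<^sub>m (m + n)"
  "\<zero>\<^bsub>super_mat m n\<^esub> = 0\<^sub>m (m + n) (m + n)"
  "x \<oplus>\<^bsub>super_mat m n\<^esub> y = x + y"
  "c \<odot>\<^bsub>super_mat m n\<^esub> x = c \<cdot>\<^sub>m x"
  "grade (super_mat m n) a = {M \<in> carrier_mat (m + n) (m + n).
     \<forall>i < m + n. \<forall>j < m + n. block_parity m i + block_parity m j \<noteq> a \<longrightarrow> M $$ (i, j) = 0}"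
  by (simp_all add: super_mat_def module.defs module_mat_simps)

lemma gl_simps [simp]:
  "carrier (gl m n) = carrier (super_mat m n)"
  "x \<oplus>\<^bsub>gl m n\<^esub> y = x \<oplus>\<^bsub>super_mat m n\<^esub> y"
  "x \<otimes>\<^bsub>gl m n\<^esub> y = x \<otimes>\<^bsub>super_mat m n\<^esub> y"
  "\<zero>\<^bsub>gl m n\<^esub> = \<zero>\<^bsub>super_mat m n\<^esub>"
  "c \<odot>\<^bsub>gl m n\<^esub> x = c \<odot>\<^bsub>super_mat m n\<^esub> x"
  "grade (gl m n) a = grade (super_mat m n) a"
  "lie_bracket (gl m n) x y = super_bracket (super_mat m n) x y"
  by (simp_all add: gl_def lie_superalgebra_of_def superalgebra.defs)

declare add_bit_eq_xor [simp del]

lemma super_mat_ring: "ring (super_mat m n)"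
proof (rule ringI)
  show "abelian_group (super_mat m n)"
  proof (rule abelian_groupI)
    fix x assume "x \<in> carrier (super_mat m n)"
    then show "\<exists>y\<in>carrier (super_mat m n). y \<oplus>\<^bsub>super_mat m n\<^esub> x = \<zero>\<^bsub>super_mat m n\<^esub>"
      by (intro bexI[of _ "- x"]) auto
  qed (auto intro: assoc_add_mat comm_add_mat)
  show "Group.monoid (super_mat m n)"
    by (rule monoidI) (auto intro: assoc_mult_mat)
qed (auto intro: add_mult_distrib_mat mult_add_distrib_mat)

lemma super_mat_minus:
  assumes "x \<in> carrier_mat (m + n) (m + n)" "y \<in> carrier_mat (m + n) (m + n)"
  shows "x \<ominus>\<^bsub>super_mat m n\<^esub> y = x - y"
proof -
  interpret ring "super_mat m n" by (rule super_mat_ring)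
  have "\<ominus>\<^bsub>super_mat m n\<^esub> y = - y"
    using assms by (intro minus_equality) auto
  then show ?thesis using assms by (simp add: minus_eq minus_add_uminus_mat)
qed

lemma super_mat_grade_unique:
  assumes "u \<in> grade (super_mat m n) a" "v \<in> grade (super_mat m n) (a + 1)"
    "u' \<in> grade (super_mat m n) a" "v' \<in> grade (super_mat m n) (a + 1)" "u + v = u' + v'"
  shows "u = u'"
proof (rule eq_matI)
  fix i j assume "i < dim_row u'" "j < dim_col u'"
  then have ij: "i < m + n" "j < m + n" using assms by auto
  have "u \<in> carrier_mat (m + n) (m + n)" "v \<in> carrier_mat (m + n) (m + n)"
    "u' \<in> carrier_mat (m + n) (m + n)" "v' \<in> carrier_mat (m + n) (m + n)"
    using assms(1-4) by simp_all
  then have eq: "u $$ (i, j) + v $$ (i, j) = u' $$ (i, j) + v' $$ (i, j)"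
    using arg_cong[OF assms(5), of "\<lambda>M. M $$ (i, j)"] ij by simp
  show "u $$ (i, j) = u' $$ (i, j)"
  proof (cases "block_parity m i + block_parity m j = a")
    case True
    then have "block_parity m i + block_parity m j \<noteq> a + 1" using bit_add_1_neq[of a] by simp
    then have "v $$ (i, j) = 0" "v' $$ (i, j) = 0" using assms(2,4) ij by auto
    then show ?thesis using eq by simp
  next
    case False
    then show ?thesis using assms(1,3) ij by simp
  qed
qed (use assms in auto)

lemma graded_algebra_super_mat: "graded_algebra (super_mat m n)"
proof (rule graded_algebra.intro)
  show "abelian_group (super_mat m n)" by (rule ring.is_abelian_group[OF super_mat_ring])
  show "u = u'" if "u \<in> grade (super_mat m n) a" "v \<in> grade (super_mat m n) (a + 1)"
    "u' \<in> grade (super_mat m n) a" "v' \<in> grade (super_mat m n) (a + 1)"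
    "u \<oplus>\<^bsub>super_mat m n\<^esub> v = u' \<oplus>\<^bsub>super_mat m n\<^esub> v'" for u v u' v' a
    using super_mat_grade_unique[OF that(1-4)] that(5) by simp
qed auto

text \<open>\<open>gl\<close> has the operations of \<open>super_mat\<close> but is a different
  record, and \<open>uea_map\<close> takes homogeneous parts with respect to this one.\<close>

lemma graded_algebra_gl: "graded_algebra (gl m n)"
proof -
  interpret A: graded_algebra "super_mat m n" by (rule graded_algebra_super_mat)
  show ?thesis
  proof (rule graded_algebra.intro)
    show "abelian_group (gl m n)"
    proof (rule abelian_groupI)
      fix x assume "x \<in> carrier (gl m n)"
      then show "\<exists>y\<in>carrier (gl m n). y \<oplus>\<^bsub>gl m n\<^esub> x = \<zero>\<^bsub>gl m n\<^esub>"
        by (intro bexI[of _ "- x"]) auto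
    qed (auto intro: assoc_add_mat comm_add_mat)
    show "u = u'" if "u \<in> grade (gl m n) a" "v \<in> grade (gl m n) (a + 1)"
      "u' \<in> grade (gl m n) a" "v' \<in> grade (gl m n) (a + 1)"
      "u \<oplus>\<^bsub>gl m n\<^esub> v = u' \<oplus>\<^bsub>gl m n\<^esub> v'" for u v u' v' a
      using super_mat_grade_unique[of u m n a v u' v'] that by simp
  qed auto
qed

lemma gl_bracket_homogeneous:
  assumes "x \<in> grade (super_mat m n) a" "y \<in> grade (super_mat m n) b"
  shows "super_bracket (super_mat m n) x y = x * y - super_sign a b \<cdot>\<^sub>m (y * x)"
proof -
  have "x \<in> carrier_mat (m + n) (m + n)" "y \<in> carrier_mat (m + n) (m + n)" using assms by auto
  then show ?thesis
    using graded_algebra.super_bracket_homogeneous[OF graded_algebra_super_mat assms]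
    by (simp add: super_mat_minus)
qed

lemma super_mat_grade_add:
  "x \<in> grade (super_mat m n) a \<Longrightarrow> y \<in> grade (super_mat m n) a \<Longrightarrow> x + y \<in> grade (super_mat m n) a"
  by auto

lemma super_mat_grade_smult:
  "x \<in> grade (super_mat m n) a \<Longrightarrow> c \<cdot>\<^sub>m x \<in> grade (super_mat m n) a"
  by auto

lemma super_mat_grade_diff:
  "x \<in> grade (super_mat m n) a \<Longrightarrow> y \<in> grade (super_mat m n) a \<Longrightarrow> x - y \<in> grade (super_mat m n) a"
  by auto

text \<open>A nonzero product of the entries at ik and kj forces these positions to have parities a
  and b. Their sum is the parity of ij, because the parity of k is counted twice.\<close>

lemma super_mat_grade_mult:
  assumes "x \<in> grade (super_mat m n) a" "y \<in> grade (super_mat m n) b"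
  shows "x * y \<in> grade (super_mat m n) (a + b)"
proof -
  have "(x * y) $$ (i, j) = 0"
    if ij: "i < m + n" "j < m + n" "block_parity m i + block_parity m j \<noteq> a + b" for i j
  proof -
    have "x $$ (i, k) * y $$ (k, j) = 0" if k: "k < m + n" for k
    proof (rule ccontr)
      assume "x $$ (i, k) * y $$ (k, j) \<noteq> 0"
      then have "block_parity m i + block_parity m k = a" "block_parity m k + block_parity m j = b"
        using assms k ij(1,2) by auto
      moreover have "block_parity m i + block_parity m j =
          (block_parity m i + block_parity m k) + (block_parity m k + block_parity m j)"
        by (simp add: block_parity_def)
      ultimately show False using ij(3) by simp
    qed
    moreover have "(x * y) $$ (i, j) = (\<Sum>k<m + n. x $$ (i, k) * y $$ (k, j))"
      using assms ij by (auto simp: scalar_prod_def lessThan_atLeast0)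
    ultimately show ?thesis by (simp add: sum.neutral)
  qed
  then show ?thesis using assms by auto
qed

lemma super_mat_grade_bracket:
  assumes "x \<in> grade (super_mat m n) a" "y \<in> grade (super_mat m n) b"
  shows "super_bracket (super_mat m n) x y \<in> grade (super_mat m n) (a + b)"
  unfolding gl_bracket_homogeneous[OF assms]
  by (rule super_mat_grade_diff[OF super_mat_grade_mult[OF assms] super_mat_grade_smult])
    (use super_mat_grade_mult[OF assms(2,1)] in \<open>simp only: add.commute\<close>)

section \<open>Matrix units\<close>

lemma mat_unit_carrier [simp]: "mat_unit m n i j \<in> carrier_mat (m + n) (m + n)"
  by (simp add: mat_unit_def)

lemma mat_unit_index [simp]:
  "r < m + n \<Longrightarrow> c < m + n \<Longrightarrow> mat_unit m n i j $$ (r, c) = (if r + 1 = i \<and> c + 1 = j then 1 else 0)"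
  by (simp add: mat_unit_def)

lemma unit_par_block_parity: "block_parity m i + block_parity m j = unit_par m (Suc i) (Suc j)"
  by (auto simp: unit_par_def block_parity_def)

text \<open>An index out of range gives the zero matrix, which lies in both grades; so images of
  generators can be graded without range conditions.\<close>

lemma mat_unit_grade: "mat_unit m n i j \<in> grade (super_mat m n) (unit_par m i j)"
  by (auto simp: unit_par_block_parity simp del: add_bit_eq_xor)

lemma mat_unit_mult:
  assumes "1 \<le> j" "j \<le> m + n" "1 \<le> k" "k \<le> m + n"
  shows "mat_unit m n i j * mat_unit m n k l = (if j = k then mat_unit m n i l else 0\<^sub>m (m + n) (m + n))"
proof (rule eq_matI)
  fix r c assume "r < dim_row (if j = k then mat_unit m n i l else 0\<^sub>m (m + n) (m + n))"
    "c < dim_col (if j = k then mat_unit m n i l else 0\<^sub>m (m + n) (m + n))"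
  then have rc: "r < m + n" "c < m + n" by (auto split: if_splits simp: mat_unit_def)
  have "(mat_unit m n i j * mat_unit m n k l) $$ (r, c) =
    (\<Sum>q<m + n. (if r + 1 = i \<and> q + 1 = j then 1 else 0) * (if q + 1 = k \<and> c + 1 = l then 1 else 0))"
    using rc by (simp add: scalar_prod_def mat_unit_def lessThan_atLeast0)
  \<comment> \<open>The 1-based inner index j sits at position j - 1, which the bounds on j and k
    make the only contributing summand.\<close>
  also have "\<dots> = (\<Sum>q<m + n. if q = j - 1 then (if r + 1 = i \<and> j = k \<and> c + 1 = l then 1 else 0) else 0)"
    using assms by (intro sum.cong) auto
  also have "\<dots> = (if r + 1 = i \<and> j = k \<and> c + 1 = l then 1 else 0)"
    using assms by (simp, arith)
  also have "\<dots> = (if j = k then mat_unit m n i l else 0\<^sub>m (m + n) (m + n)) $$ (r, c)"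
    using rc by auto
  finally show "(mat_unit m n i j * mat_unit m n k l) $$ (r, c) = \<dots>" .
qed (auto simp: mat_unit_def)

lemma presentation_uea: "presentation (uea_generators (gl m n)) (uea_relation (gl m n))"
proof
  fix l r assume "uea_relation (gl m n) l r"
  then show "l - r \<in> free_carrier (uea_generators (gl m n))"
  proof cases
    case (add x a y)
    then show ?thesis using super_mat_grade_add[of x m n a y]
      by (simp only: gl_simps super_mat_simps(5))
        (intro free_carrier_closed; simp only: uea_generators_def gl_simps mem_Collect_eq prod.case)
  next
    case (smult x a c)
    then show ?thesis using super_mat_grade_smult[of x m n a c]
      by (simp only: gl_simps super_mat_simps(6))
        (intro free_carrier_closed; simp only: uea_generators_def gl_simps mem_Collect_eq prod.case)
  next
    case (bracket x a y b)
    then show ?thesis using super_mat_grade_bracket[of x m n a y b]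
      by (simp only: gl_simps)
        (intro free_carrier_closed; simp only: uea_generators_def gl_simps mem_Collect_eq prod.case)
  qed
qed

section \<open>The presentation of the enveloping superalgebra\<close>

lemma gl_gen_grade:
  assumes "x \<in> gl_generators m n"
  shows "gen x \<in> free_grade (gl_generators m n) (gl_parity m) (gl_parity m x)"
  using assms by (rule free_grade_gen)

text \<open>Evaluated from the inside: the two inner brackets each have an even factor and are
  commutators of parity 1, and the outermost bracket joins two odd elements. \<open>C\<close> ranges
  over constructors so that e and f are treated together.\<close>

lemma gl_quartic:
  assumes "C = E \<or> C = F" "2 \<le> m" "2 \<le> n"
  shows "gl_bracket m n (gen (C m)) (gl_bracket m n (gen (C (m - 1)))
      (gl_bracket m n (gen (C m)) (gen (C (m + 1))))) =
    sbr 1 1 (gen (C m)) (com (gen (C (m - 1))) (com (gen (C m)) (gen (C (m + 1)))))"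
    and "sbr 1 1 (gen (C m)) (com (gen (C (m - 1))) (com (gen (C m)) (gen (C (m + 1))))) \<in>
      free_carrier (gl_generators m n)"
proof -
  let ?g = "free_grade (gl_generators m n) (gl_parity m)"
  have g: "gen (C k) \<in> ?g (odd_at m k)" if "1 \<le> k" "k < m + n" for k
    using gl_gen_grade[of "C k" m n] that assms(1)
    by (auto simp: gl_generators_def gl_parity_def odd_at_def)
  have x: "gen (C m) \<in> ?g 1" and y: "gen (C (m - 1)) \<in> ?g 0" and z: "gen (C (m + 1)) \<in> ?g 0"
  proof -
    have "odd_at m (m - 1) = 0" using assms(2) by (auto simp: odd_at_def)
    then show "gen (C m) \<in> ?g 1" "gen (C (m - 1)) \<in> ?g 0" "gen (C (m + 1)) \<in> ?g 0"
      using g[of m] g[of "m - 1"] g[of "m + 1"] assms by (auto simp: odd_at_def)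
  qed
  have 1: "gl_bracket m n (gen (C m)) (gen (C (m + 1))) = com (gen (C m)) (gen (C (m + 1)))"
    unfolding gl_bracket_def using free_bracket[OF x z] by (simp add: sbr_def)
  have xz: "com (gen (C m)) (gen (C (m + 1))) \<in> ?g 1"
    using free_grade_sbr[OF x z] by (simp add: sbr_def)
  have 2: "gl_bracket m n (gen (C (m - 1))) (com (gen (C m)) (gen (C (m + 1)))) =
    com (gen (C (m - 1))) (com (gen (C m)) (gen (C (m + 1))))"
    unfolding gl_bracket_def using free_bracket[OF y xz] by (simp add: sbr_def)
  have yxz: "com (gen (C (m - 1))) (com (gen (C m)) (gen (C (m + 1)))) \<in> ?g 1"
    using free_grade_sbr[OF y xz] by (simp add: sbr_def)
  show "gl_bracket m n (gen (C m)) (gl_bracket m n (gen (C (m - 1)))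
      (gl_bracket m n (gen (C m)) (gen (C (m + 1))))) =
    sbr 1 1 (gen (C m)) (com (gen (C (m - 1))) (com (gen (C m)) (gen (C (m + 1)))))"
    unfolding 1 2 unfolding gl_bracket_def by (rule free_bracket[OF x yxz])
  show "sbr 1 1 (gen (C m)) (com (gen (C (m - 1))) (com (gen (C m)) (gen (C (m + 1))))) \<in>
      free_carrier (gl_generators m n)"
    by (rule free_grade_carrier[OF free_grade_sbr[OF x yxz]])
qed

lemma free_carrier_sum:
  "(\<And>i. i \<in> A \<Longrightarrow> f i \<in> free_carrier X) \<Longrightarrow> sum f A \<in> free_carrier X"
  unfolding free_carrier_grade by (rule free_grade_sum)

lemma free_carrier_of_int: "of_int k \<in> free_carrier X"
  and free_carrier_numeral: "numeral l \<in> free_carrier X"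
  using free_carrier_closed(7)[of "of_int k" X] free_carrier_closed(7)[of "numeral l" X]
  by (simp_all add: free_scalar_def)

lemma free_carrier_power: "u \<in> free_carrier X \<Longrightarrow> u ^ k \<in> free_carrier X"
  by (induction k) (simp_all add: free_carrier_closed)

context
  fixes m n :: nat
  assumes mn: "1 \<le> m" "1 \<le> n"
begin

lemma gl_gen_carrier:
  "1 \<le> i \<Longrightarrow> i < m + n \<Longrightarrow> gen (E i) \<in> free_carrier (gl_generators m n)"
  "1 \<le> i \<Longrightarrow> i < m + n \<Longrightarrow> gen (F i) \<in> free_carrier (gl_generators m n)"
  "1 \<le> i \<Longrightarrow> i \<le> m + n \<Longrightarrow> i \<noteq> m \<Longrightarrow> gen (H i) \<in> free_carrier (gl_generators m n)"
  "gen Emm \<in> free_carrier (gl_generators m n)"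
  by (auto intro!: free_carrier_closed(8) simp: gl_generators_def)

lemma gl_h_carrier:
  "1 \<le> i \<Longrightarrow> i \<le> m + n \<Longrightarrow> gl_h m n i \<in> free_carrier (gl_generators m n)"
  unfolding gl_h_def
  by (auto intro!: gl_gen_carrier free_carrier_closed(1) free_carrier_sum)

lemma presentation_gl: "presentation (gl_generators m n) (gl_relation m n)"
proof
  fix u v assume "gl_relation m n u v"
  then show "u - v \<in> free_carrier (gl_generators m n)"
  proof cases
    case a9
    then show ?thesis using gl_quartic[of E m n] by simp
  next
    case a10
    then show ?thesis using gl_quartic[of F m n] by simp
  qed (use mn in \<open>auto intro!: free_carrier_closed(1-7) gl_gen_carrier gl_h_carrier
      free_carrier_of_int free_carrier_numeral free_carrier_power\<close>)
qed

interpretation A: presentation "gl_generators m n" "gl_parity m" "gl_relation m n"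
  by (rule presentation_gl)

interpretation B: presentation "uea_generators (gl m n)" fst "uea_relation (gl m n)"
  by (rule presentation_uea)

section \<open>Matrix units in the enveloping superalgebra\<close>

definition uea_cls :: "bit \<Rightarrow> complex mat \<Rightarrow> (bit \<times> complex mat) free_alg quotients"
  where "uea_cls a x = B.res (gen (a, x))"

abbreviation G where "G a \<equiv> grade (super_mat m n) a"

lemma uea_cls_add: "x \<in> G a \<Longrightarrow> y \<in> G a \<Longrightarrow> uea_cls a (x + y) = uea_cls a x + uea_cls a y"
  using B.res_relation[OF uea_relation.add, of x a y] by (simp add: uea_cls_def B.res_simps)

lemma uea_cls_smult: "x \<in> G a \<Longrightarrow> uea_cls a (c \<cdot>\<^sub>m x) = B.res (free_scalar c) * uea_cls a x"
  using B.res_relation[OF uea_relation.smult, of x a c] by (simp add: uea_cls_def B.res_simps)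

lemma zero_grade: "0\<^sub>m (m + n) (m + n) \<in> G a"
  by auto

lemma uea_cls_zero: "uea_cls a (0\<^sub>m (m + n) (m + n)) = 0"
  using uea_cls_add[OF zero_grade zero_grade, of a] by simp

lemma uea_cls_koszul:
  assumes "x \<in> G c"
  shows "uea_cls c (super_sign a b \<cdot>\<^sub>m x) = koszul a b (uea_cls c x)"
  using uea_cls_smult[OF assms, of "super_sign a b"]
    by (simp add: uea_cls_def B.res_simps flip: B.res_simps(4) koszul_eq_super_sign)
      (simp add: koszul_def B.res_simps)

lemma uea_cls_diff:
  assumes "x \<in> G a" "y \<in> G a"
  shows "uea_cls a (x - y) = uea_cls a x - uea_cls a y"
proof -
  have "(x - y) + y = x" using assms by auto
  then show ?thesis using uea_cls_add[OF super_mat_grade_diff[OF assms] assms(2)]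
    by (metis add_diff_cancel_right')
qed

text \<open>Both xy and yx lie in grade a + b, so the class of their Lie bracket splits by
  linearity. Brackets of matrix units can then be read off from matrix products.\<close>

lemma uea_cls_bracket:
  assumes "x \<in> G a" "y \<in> G b"
  shows "sbr a b (uea_cls a x) (uea_cls b y) = uea_cls (a + b) (x * y) - koszul a b (uea_cls (a + b) (y * x))"
proof -
  have "sbr a b (uea_cls a x) (uea_cls b y) =
    B.res (gen (a, x) * gen (b, y) - free_scalar (super_sign a b) * (gen (b, y) * gen (a, x)))"
    unfolding koszul_eq_super_sign[symmetric] by (simp add: sbr_def uea_cls_def koszul_def B.res_simps)
  also have "\<dots> = uea_cls (a + b) (super_bracket (super_mat m n) x y)"
    using B.res_relation[OF uea_relation.bracket, of x a y b] assms
    unfolding uea_cls_def gl_simps by blast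
  also have "\<dots> = uea_cls (a + b) (x * y - super_sign a b \<cdot>\<^sub>m (y * x))"
    by (simp only: gl_bracket_homogeneous[OF assms])
  also have "\<dots> = uea_cls (a + b) (x * y) - koszul a b (uea_cls (a + b) (y * x))"
    using super_mat_grade_mult[OF assms] super_mat_grade_mult[OF assms(2,1)]
    by (simp only: uea_cls_diff super_mat_grade_smult uea_cls_koszul add.commute[of b a])
  finally show ?thesis .
qed

definition uea_unit where "uea_unit i j = uea_cls (unit_par m i j) (mat_unit m n i j)"

lemma uea_unit_bracket:
  assumes "1 \<le> i" "i \<le> m + n" "1 \<le> j" "j \<le> m + n" "1 \<le> k" "k \<le> m + n" "1 \<le> l" "l \<le> m + n"
  shows "sbr (unit_par m i j) (unit_par m k l) (uea_unit i j) (uea_unit k l) =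
    (if j = k then uea_unit i l else 0) - koszul (unit_par m i j) (unit_par m k l) (if i = l then uea_unit k j else 0)"
proof -
  have 1: "uea_cls (unit_par m i j + unit_par m k l) (mat_unit m n i j * mat_unit m n k l) = (if j = k then uea_unit i l else 0)"
    unfolding mat_unit_mult[OF assms(3-6)] by (auto simp only: uea_unit_def unit_par_add uea_cls_zero split: if_split)
  have 2: "uea_cls (unit_par m i j + unit_par m k l) (mat_unit m n k l * mat_unit m n i j) = (if i = l then uea_unit k j else 0)"
    unfolding mat_unit_mult[OF assms(7,8,1,2)] add.commute[of "unit_par m i j"]
    by (auto simp only: uea_unit_def unit_par_add uea_cls_zero split: if_split)
  show ?thesis
    unfolding uea_unit_def uea_cls_bracket[OF mat_unit_grade mat_unit_grade] 1 2 unfolding uea_unit_def ..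
qed

lemma uea_unit_diag:
  assumes "1 \<le> i" "i \<le> m + n" "1 \<le> k" "k \<le> m + n" "1 \<le> l" "l \<le> m + n"
  shows "com (uea_unit i i) (uea_unit k l) = (if i = k then uea_unit k l else 0) - (if i = l then uea_unit k l else 0)"
  using uea_unit_bracket[of i i k l] assms by (auto simp: sbr_def)


section \<open>Images of the Chevalley generators and of their relations\<close>

definition gl_to_uea :: "gl_gen \<Rightarrow> (bit \<times> complex mat) free_alg"
  where "gl_to_uea x = gen (gl_parity m x, gl_gen_mat m n x)"

lemma gl_gen_mat_grade: "gl_gen_mat m n x \<in> G (gl_parity m x)"
proof (cases x)
  case (E i)
  then show ?thesis using mat_unit_grade[of m n i "i + 1"]
    by (simp add: gl_parity_def odd_at_def del: super_mat_simps)
next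
  case (F i)
  then show ?thesis using mat_unit_grade[of m n "i + 1" i]
    by (simp add: gl_parity_def unit_par_Suc' odd_at_def del: super_mat_simps)
next
  case (H i)
  then show ?thesis using mat_unit_grade[of m n i i] mat_unit_grade[of m n "i + 1" "i + 1"]
      super_mat_grade_diff[of "mat_unit m n i i" m n 0 "mat_unit m n (i + 1) (i + 1)"]
    by (auto simp: gl_parity_def simp del: super_mat_simps)
next
  case Emm
  then show ?thesis using mat_unit_grade[of m n m m]
    by (simp add: gl_parity_def del: super_mat_simps)
qed

lemma gl_to_uea_grade: "gl_to_uea x \<in> free_grade (uea_generators (gl m n)) fst (gl_parity m x)"
proof -
  have "(gl_parity m x, gl_gen_mat m n x) \<in> uea_generators (gl m n)"
    using gl_gen_mat_grade[of x] unfolding uea_generators_def gl_simps by blast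
  from free_grade_gen[OF this, of fst] show ?thesis unfolding gl_to_uea_def fst_conv .
qed

definition in_uea where "in_uea u = B.res (subst gl_to_uea u)"

lemma in_uea_simps:
  "in_uea (x + y) = in_uea x + in_uea y" "in_uea (x - y) = in_uea x - in_uea y" "in_uea (- x) = - in_uea x"
  "in_uea (x * y) = in_uea x * in_uea y" "in_uea 0 = 0"
  by (simp_all add: in_uea_def subst_add subst_diff subst_minus subst_mult B.res_simps)

lemma in_uea_sum: "in_uea (sum f K) = (\<Sum>k\<in>K. in_uea (f k))"
  by (induction K rule: infinite_finite_induct) (simp_all add: in_uea_simps)

lemma in_uea_E: "in_uea (gen (E i)) = uea_unit i (Suc i)"
  by (simp add: in_uea_def gl_to_uea_def uea_unit_def uea_cls_def gl_parity_def odd_at_def)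

lemma in_uea_F: "in_uea (gen (F i)) = uea_unit (Suc i) i"
  by (simp add: in_uea_def gl_to_uea_def uea_unit_def uea_cls_def gl_parity_def unit_par_Suc' odd_at_def)

lemma in_uea_Emm: "in_uea (gen Emm) = uea_unit m m"
  by (simp add: in_uea_def gl_to_uea_def uea_unit_def uea_cls_def gl_parity_def)

lemma in_uea_H: "in_uea (gen (H i)) = (if i = m + n then uea_unit i i else uea_unit i i - uea_unit (Suc i) (Suc i))"
proof -
  have "mat_unit m n i i \<in> G 0" "mat_unit m n (Suc i) (Suc i) \<in> G 0"
    using mat_unit_grade[of m n i i] mat_unit_grade[of m n "Suc i" "Suc i"] by (simp_all del: super_mat_simps)
  from uea_cls_diff[OF this] show ?thesis
    by (simp add: in_uea_def gl_to_uea_def uea_unit_def uea_cls_def gl_parity_def)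
qed

text \<open>The step from i + 1 to i uses h_i = e_ii - e_(i+1,i+1), which fails at i = m. The
  descent therefore has two chains, one starting from h_(m+n) and one from e_mm.\<close>

lemma diag_induct [consumes 2, case_names last middle step]:
  assumes "1 \<le> i" "i \<le> m + n"
    and "Q (m + n)" "Q m" "\<And>i. \<lbrakk>1 \<le> i; i < m + n; i \<noteq> m; Q (Suc i)\<rbrakk> \<Longrightarrow> Q i"
  shows "Q i"
proof (cases "i \<le> m")
  case True
  then show ?thesis using assms(1)
    by (induction i rule: inc_induct) (use assms in auto)
next
  case False
  show ?thesis using \<open>i \<le> m + n\<close> False
    by (induction i rule: inc_induct) (use assms in auto)
qed

text \<open>The element e_ii in terms of generators: the differences h_j = e_jj - e_(j+1,j+1)
  telescope up to e_mm if i \<le> m, and up to h_(m+n) = e_(m+n,m+n) if i > m.\<close>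

definition gl_diag :: "nat \<Rightarrow> gl_gen free_alg"
  where "gl_diag i = (if i \<le> m then gen Emm + (\<Sum>j = i..<m. gen (H j)) else (\<Sum>j = i..m + n. gen (H j)))"

lemma gl_diag_last: "gl_diag (m + n) = gen (H (m + n))"
  and gl_diag_middle: "gl_diag m = gen Emm"
  using mn by (simp_all add: gl_diag_def)

lemma gl_diag_step: "i < m + n \<Longrightarrow> i \<noteq> m \<Longrightarrow> gl_diag i = gen (H i) + gl_diag (Suc i)"
  by (auto simp: gl_diag_def sum.atLeast_Suc_lessThan sum.atLeast_Suc_atMost algebra_simps)

text \<open>The sum of all h_j with j > m telescopes to e_(m+1,m+1), so h_m is a sum of two diagonal
  units, in contrast to the differences elsewhere.\<close>

lemma gl_h_gl_diag:
  "gl_h m n i = (if i = m then gl_diag m + gl_diag (Suc m) else if i < m + n then gl_diag i - gl_diag (Suc i) else gen (H i))"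
  using mn by (auto simp: gl_h_def gl_diag_step gl_diag_middle) (simp add: gl_diag_def)

lemma in_uea_gl_diag: "1 \<le> i \<Longrightarrow> i \<le> m + n \<Longrightarrow> in_uea (gl_diag i) = uea_unit i i"
  by (induction i rule: diag_induct) (use mn in \<open>simp_all add: gl_diag_last gl_diag_middle gl_diag_step in_uea_simps in_uea_H in_uea_Emm\<close>)

lemma in_uea_h:
  assumes "1 \<le> i" "i \<le> m + n"
  shows "in_uea (gl_h m n i) = (if i = m then uea_unit m m + uea_unit (Suc m) (Suc m)
    else if i = m + n then uea_unit i i else uea_unit i i - uea_unit (Suc i) (Suc i))"
  using assms mn by (auto simp: gl_h_gl_diag in_uea_simps in_uea_gl_diag in_uea_H)

lemma res_torsion_free: "x + x = 0 \<Longrightarrow> x = 0" for x :: "'x free_alg quotients"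
  using quotients_torsion_free[of "free_scalar (1/2)" x] by (simp flip: free_scalar_add)

lemma serre_expand: "e ^ 2 * f - 2 * e * f * e + f * e ^ 2 = com e (com e f)" for e f :: "'x free_alg"
  by (simp add: power2_eq_square algebra_simps mult_2)

lemma gl_coeff_mult:
  "of_int (gl_coeff m n i j) * x =
    (if i = m then (if j + 1 = m then - x else if j = m then x else 0)
     else if i = m + n then (if j + 1 = m + n then - x else 0)
     else (if i = j then x + x else if i = j + 1 \<or> j = i + 1 then - x else 0))"
  for x :: "'x free_alg"
  by (simp add: gl_coeff_def mult_2)

lemma uea_unit_e_e:
  assumes "1 \<le> i" "i < m + n" "1 \<le> j" "j < m + n" "Suc i \<noteq> j" "Suc j \<noteq> i" "i \<noteq> j"
  shows "com (uea_unit i (Suc i)) (uea_unit j (Suc j)) = 0"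
  using uea_unit_bracket[of i "Suc i" j "Suc j"] assms by (auto simp: sbr_def odd_at_def split: if_splits)

lemma uea_unit_f_f:
  assumes "1 \<le> i" "i < m + n" "1 \<le> j" "j < m + n" "Suc i \<noteq> j" "Suc j \<noteq> i" "i \<noteq> j"
  shows "com (uea_unit (Suc i) i) (uea_unit (Suc j) j) = 0"
  using uea_unit_bracket[of "Suc i" i "Suc j" j] assms by (auto simp: sbr_def unit_par_Suc' odd_at_def split: if_splits)

lemma com_uea_unit:
  assumes "1 \<le> i" "i \<le> m + n" "1 \<le> j" "j \<le> m + n" "1 \<le> k" "k \<le> m + n" "1 \<le> l" "l \<le> m + n"
    and "unit_par m i j = 0 \<or> unit_par m k l = 0"
  shows "com (uea_unit i j) (uea_unit k l) = (if j = k then uea_unit i l else 0) - (if i = l then uea_unit k j else 0)"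
  using uea_unit_bracket[OF assms(1-8)] assms(9) by (auto simp: sbr_def)

lemma in_uea_relation:
  assumes "gl_relation m n u v"
  shows "in_uea u = in_uea v"
  using assms
proof cases
  case (a1 i j)
  have "com (uea_unit i i) (uea_unit j j) = 0" if "1 \<le> i" "i \<le> m + n" "1 \<le> j" "j \<le> m + n" for i j
    using uea_unit_diag[of i j j] that by simp
  then have *: "uea_unit i i * uea_unit j j = uea_unit j j * uea_unit i i" if "1 \<le> i" "i \<le> m + n" "1 \<le> j" "j \<le> m + n" for i j
    using that by simp
  show ?thesis using a1 *[of i j] *[of i "Suc j"] *[of "Suc i" j] *[of "Suc i" "Suc j"]
    by (auto simp: in_uea_simps in_uea_h algebra_simps)
next
  case (a1' i)
  have *: "uea_unit i i * uea_unit m m = uea_unit m m * uea_unit i i" if "1 \<le> i" "i \<le> m + n" for i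
    using uea_unit_diag[of i m m] that mn by simp
  show ?thesis using a1' *[of i] *[of "Suc i"]
    by (auto simp: in_uea_simps in_uea_h in_uea_Emm algebra_simps)
next
  case (a2 i j)
  have *: "com (uea_unit k k) (uea_unit j (Suc j)) = (if k = j then uea_unit j (Suc j) else 0) - (if k = Suc j then uea_unit j (Suc j) else 0)"
    if "1 \<le> k" "k \<le> m + n" for k
    using uea_unit_diag[of k j "Suc j"] that a2 by simp
  \<comment> \<open>h_i is a difference of diagonal units except at i = m + n, where it is a single
    one; the weights combine to the entry a_ij.\<close>
  have "in_uea u = (if i = m + n then com (uea_unit i i) (uea_unit j (Suc j))
      else com (uea_unit i i) (uea_unit j (Suc j)) - com (uea_unit (Suc i) (Suc i)) (uea_unit j (Suc j)))"
    unfolding a2(1) using a2(3-) by (auto simp: in_uea_simps in_uea_h in_uea_E algebra_simps)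
  then show ?thesis unfolding a2 gl_coeff_mult using a2 mn *[of i] *[of "Suc i"]
    by (auto simp: in_uea_simps in_uea_E)
next
  case (a2' j)
  show ?thesis unfolding a2'(1,2) gl_coeff_mult using a2'(3) uea_unit_diag[of m j "Suc j"] mn
    by (simp add: if_distrib[of in_uea] in_uea_simps in_uea_E in_uea_Emm)
next
  case (a3 i j)
  have *: "com (uea_unit k k) (uea_unit (Suc j) j) = (if k = Suc j then uea_unit (Suc j) j else 0) - (if k = j then uea_unit (Suc j) j else 0)"
    if "1 \<le> k" "k \<le> m + n" for k
    using uea_unit_diag[of k "Suc j" j] that a3 by simp
  have "in_uea u = (if i = m + n then com (uea_unit i i) (uea_unit (Suc j) j)
      else com (uea_unit i i) (uea_unit (Suc j) j) - com (uea_unit (Suc i) (Suc i)) (uea_unit (Suc j) j))"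
    unfolding a3(1) using a3(3-) by (auto simp: in_uea_simps in_uea_h in_uea_F algebra_simps)
  then show ?thesis unfolding a3 mult_minus_left gl_coeff_mult using a3 mn *[of i] *[of "Suc i"]
    by (auto simp: in_uea_simps in_uea_F)
next
  case (a3' j)
  show ?thesis unfolding a3'(1,2) mult_minus_left gl_coeff_mult using a3'(3) uea_unit_diag[of m "Suc j" j] mn
    by (simp add: if_distrib[of in_uea] in_uea_simps in_uea_F in_uea_Emm)
next
  case (a4 i j)
  then show ?thesis using com_uea_unit[of i "Suc i" "Suc j" j]
    by (auto simp: in_uea_simps in_uea_E in_uea_F in_uea_h unit_par_Suc' odd_at_def)
next
  case a4'
  then show ?thesis using uea_unit_bracket[of m "Suc m" "Suc m" m] mn
    by (auto simp: in_uea_simps in_uea_E in_uea_F in_uea_h unit_par_Suc' odd_at_def sbr_def)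
next
  case (a5 i j)
  then show ?thesis using uea_unit_e_e[of i j] by (auto simp: in_uea_simps in_uea_E)
next
  case (a5' i j)
  then show ?thesis using uea_unit_f_f[of i j] by (auto simp: in_uea_simps in_uea_F)
next
  case (a6 i j)
  \<comment> \<open>The inner bracket is e_(i,i+2) or -e_(i-1,i+1), and neither has an index that
    matches in a further bracket with e_(i,i+1). All brackets are commutators, as e_i is
    even.\<close>
  have "com (uea_unit i (Suc i)) (com (uea_unit i (Suc i)) (uea_unit j (Suc j))) = 0"
    using com_uea_unit[of i "Suc i" j "Suc j"] com_uea_unit[of i "Suc i" i "Suc j"] com_uea_unit[of i "Suc i" j "Suc i"] a6
    by (auto simp: odd_at_def)
  then show ?thesis unfolding a6 serre_expand by (simp add: in_uea_simps in_uea_E)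
next
  case (a7 i j)
  have "com (uea_unit (Suc i) i) (com (uea_unit (Suc i) i) (uea_unit (Suc j) j)) = 0"
    using com_uea_unit[of "Suc i" i "Suc j" j] com_uea_unit[of "Suc i" i "Suc i" j] com_uea_unit[of "Suc i" i "Suc j" i] a7
    by (auto simp: odd_at_def unit_par_Suc')
  then show ?thesis unfolding a7 serre_expand by (simp add: in_uea_simps in_uea_F)
next
  case a8
  \<comment> \<open>The superbracket of an odd element with itself is twice its square, so the
    vanishing bracket has to be halved.\<close>
  have "uea_unit m (Suc m) * uea_unit m (Suc m) = 0"
    by (rule res_torsion_free)
      (use uea_unit_bracket[of m "Suc m" m "Suc m"] mn in \<open>simp add: sbr_def odd_at_def\<close>)
  then show ?thesis unfolding a8 by (simp add: in_uea_simps in_uea_E power2_eq_square)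
next
  case a8'
  have "uea_unit (Suc m) m * uea_unit (Suc m) m = 0"
    by (rule res_torsion_free)
      (use uea_unit_bracket[of "Suc m" m "Suc m" m] mn in \<open>simp add: sbr_def unit_par_Suc' odd_at_def\<close>)
  then show ?thesis unfolding a8' by (simp add: in_uea_simps in_uea_F power2_eq_square)
next
  case a9
  \<comment> \<open>The inner brackets build up e_(m-1,m+2), which shares no matching index with
    e_(m,m+1).\<close>
  then have 1: "com (uea_unit m (m + 1)) (uea_unit (m + 1) (m + 2)) = uea_unit m (m + 2)"
    and 2: "com (uea_unit (m - 1) m) (uea_unit m (m + 2)) = uea_unit (m - 1) (m + 2)"
    and 3: "sbr 1 1 (uea_unit m (m + 1)) (uea_unit (m - 1) (m + 2)) = 0"
    using com_uea_unit[of m "m + 1" "m + 1" "m + 2"] com_uea_unit[of "m - 1" m m "m + 2"]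
      uea_unit_bracket[of m "m + 1" "m - 1" "m + 2"] by (auto simp: unit_par_def)
  have "in_uea (sbr 1 1 x y) = sbr 1 1 (in_uea x) (in_uea y)" for x y by (simp add: sbr_def in_uea_simps)
  then show ?thesis unfolding a9(1,2) using gl_quartic(1)[of E m n] a9 1 2 3
    by (simp add: in_uea_simps in_uea_E)
next
  case a10
  then have 1: "com (uea_unit (m + 1) m) (uea_unit (m + 2) (m + 1)) = - uea_unit (m + 2) m"
    and 2: "com (uea_unit m (m - 1)) (uea_unit (m + 2) m) = - uea_unit (m + 2) (m - 1)"
    and 3: "sbr 1 1 (uea_unit (m + 1) m) (uea_unit (m + 2) (m - 1)) = 0"
    using com_uea_unit[of "m + 1" m "m + 2" "m + 1"] com_uea_unit[of m "m - 1" "m + 2" m]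
      uea_unit_bracket[of "m + 1" m "m + 2" "m - 1"] by (auto simp: unit_par_def)
  have 4: "com x (- y) = - com x y" for x y :: "(bit \<times> complex mat) free_alg quotients" by simp
  have "in_uea (sbr 1 1 x y) = sbr 1 1 (in_uea x) (in_uea y)" for x y by (simp add: sbr_def in_uea_simps)
  \<comment> \<open>Each of the two lower triangular brackets produces a minus sign, and the signs
    cancel.\<close>
  moreover have "com (uea_unit m (m - 1)) (com (uea_unit (m + 1) m) (uea_unit (m + 2) (m + 1))) = uea_unit (m + 2) (m - 1)"
    unfolding 1 4 2 by simp
  ultimately show ?thesis unfolding a10(1,2) using gl_quartic(1)[of F m n] a10 3
    by (simp add: in_uea_simps in_uea_F)
qed


section \<open>The Chevalley relations in the presented superalgebra\<close>

lemma
  shows res_e_far: "\<lbrakk>1 \<le> i; i + 1 < j; j < m + n\<rbrakk> \<Longrightarrow>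
      A.res (gen (E i)) * A.res (gen (E j)) = A.res (gen (E j)) * A.res (gen (E i))"
    and res_f_far: "\<lbrakk>1 \<le> i; i + 1 < j; j < m + n\<rbrakk> \<Longrightarrow>
      A.res (gen (F i)) * A.res (gen (F j)) = A.res (gen (F j)) * A.res (gen (F i))"
    and res_e_serre: "\<lbrakk>1 \<le> i; i < m + n; 1 \<le> j; j < m + n; i = j + 1 \<or> j = i + 1; i \<noteq> m\<rbrakk> \<Longrightarrow>
      com (A.res (gen (E i))) (com (A.res (gen (E i))) (A.res (gen (E j)))) = 0"
    and res_f_serre: "\<lbrakk>1 \<le> i; i < m + n; 1 \<le> j; j < m + n; i = j + 1 \<or> j = i + 1; i \<noteq> m\<rbrakk> \<Longrightarrow>
      com (A.res (gen (F i))) (com (A.res (gen (F i))) (A.res (gen (F j)))) = 0"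
    and res_e_square: "A.res (gen (E m)) * A.res (gen (E m)) = 0"
    and res_f_square: "A.res (gen (F m)) * A.res (gen (F m)) = 0"
  using A.res_relation[OF gl_relation.a5, of i j] A.res_relation[OF gl_relation.a5', of i j]
    A.res_relation[OF gl_relation.a6, of i j] A.res_relation[OF gl_relation.a7, of i j]
    A.res_relation[OF gl_relation.a8] A.res_relation[OF gl_relation.a8']
  unfolding serre_expand by (auto simp: A.res_simps power2_eq_square)

lemma res_sbr: "A.res (sbr a b x y) = sbr a b (A.res x) (A.res y)"
  by (simp add: sbr_def koszul_def A.res_simps)

lemma res_com: "A.res (com x y) = com (A.res x) (A.res y)"
  by (simp add: A.res_simps)

lemma serre_res_e: "serre (m + n) m (\<lambda>i. A.res (gen (E i)))"
proof
  assume "2 \<le> m" "m + 1 < m + n"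
  then have "2 \<le> m" "2 \<le> n" by auto
  then show "sbr 1 1 (A.res (gen (E m))) (com (A.res (gen (E (m - 1))))
      (com (A.res (gen (E m))) (A.res (gen (E (m + 1)))))) = 0"
    using A.res_relation[OF gl_relation.a9] gl_quartic(1)[of E m n]
    by (simp only: res_sbr res_com A.res_simps(5) simp_thms)
qed (use res_torsion_free res_e_far res_e_serre res_e_square in blast)+

lemma serre_res_f: "serre (m + n) m (\<lambda>i. A.res (gen (F i)))"
proof
  assume "2 \<le> m" "m + 1 < m + n"
  then have "2 \<le> m" "2 \<le> n" by auto
  then show "sbr 1 1 (A.res (gen (F m))) (com (A.res (gen (F (m - 1))))
      (com (A.res (gen (F m))) (A.res (gen (F (m + 1)))))) = 0"
    using A.res_relation[OF gl_relation.a10] gl_quartic(1)[of F m n]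
    by (simp only: res_sbr res_com A.res_simps(5) simp_thms)
qed (use res_torsion_free res_f_far res_f_serre res_f_square in blast)+

lemma res_H:
  assumes "1 \<le> i" "i \<le> m + n" "i \<noteq> m"
  shows "com (A.res (gen (H i))) (A.res (gen Emm)) = 0"
    and "1 \<le> j \<Longrightarrow> j \<le> m + n \<Longrightarrow> j \<noteq> m \<Longrightarrow> com (A.res (gen (H i))) (A.res (gen (H j))) = 0"
  using A.res_relation[OF gl_relation.a1', of i] A.res_relation[OF gl_relation.a1, of i j] assms
  by (simp_all add: gl_h_def A.res_simps)

lemma res_H_gl_diag:
  assumes "1 \<le> i" "i \<le> m + n" "i \<noteq> m" "1 \<le> j" "j \<le> m + n"
  shows "com (A.res (gen (H i))) (A.res (gl_diag j)) = 0"
  using assms(4,5)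
proof (induction j rule: diag_induct)
  case last
  then show ?case using res_H(2)[of i "m + n"] assms mn by (simp add: gl_diag_last)
next
  case middle
  then show ?case using res_H(1)[of i] assms by (simp add: gl_diag_middle)
next
  case (step j)
  then show ?case using res_H(2)[of i j] assms by (simp add: gl_diag_step A.res_simps algebra_simps)
qed

lemma res_gl_diag_gl_diag:
  assumes "1 \<le> i" "i \<le> m + n" "1 \<le> j" "j \<le> m + n"
  shows "com (A.res (gl_diag i)) (A.res (gl_diag j)) = 0"
  using assms(1,2)
proof (induction i rule: diag_induct)
  case last
  then show ?case using res_H_gl_diag[of "m + n" j] assms mn by (simp add: gl_diag_last)
next
  case middle
  show ?case using assms(3,4)
  proof (induction j rule: diag_induct)
    case last
    then show ?case using res_H(1)[of "m + n"] mn by (simp add: gl_diag_middle gl_diag_last)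
  next
    case (step j)
    then show ?case using res_H(1)[of j] by (simp add: gl_diag_middle gl_diag_step A.res_simps algebra_simps)
  qed simp
next
  case (step i)
  then show ?case using res_H_gl_diag[of i j] assms by (simp add: gl_diag_step A.res_simps algebra_simps)
qed

text \<open>Going down from i + 1 to i adds the entry a_ij to the weight: 2 - 1 = 1 for i = j, -1 +
  1 = 0 for i = j - 1, and -1 + 0 = -1 for i = j + 1. The starting weights are the rows m + n and m
  of the coefficient matrix.\<close>

lemma res_gl_diag_E:
  assumes "1 \<le> i" "i \<le> m + n" "1 \<le> j" "j < m + n"
  shows "com (A.res (gl_diag i)) (A.res (gen (E j))) =
    (if i = j then A.res (gen (E j)) else 0) - (if i = j + 1 then A.res (gen (E j)) else 0)"
  using assms(1,2)
proof (induction i rule: diag_induct)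
  case last
  have "A.res (gen (H (m + n)) * gen (E j) - gen (E j) * gen (H (m + n))) =
      A.res (of_int (gl_coeff m n (m + n) j) * gen (E j))"
    using A.res_relation[OF gl_relation.a2, of "m + n" j] assms mn by (simp add: gl_h_def)
  then show ?case unfolding gl_coeff_mult using assms mn
    by (simp add: gl_diag_last if_distrib[of A.res] A.res_simps)
next
  case middle
  have "A.res (gen Emm * gen (E j) - gen (E j) * gen Emm) = A.res (of_int (gl_coeff m n m j) * gen (E j))"
    using A.res_relation[OF gl_relation.a2', of j] assms by simp
  then show ?case unfolding gl_coeff_mult
    by (simp add: gl_diag_middle if_distrib[of A.res] A.res_simps)
next
  case (step i)
  have "A.res (gen (H i) * gen (E j) - gen (E j) * gen (H i)) =
      A.res (of_int (gl_coeff m n i j) * gen (E j))"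
    using A.res_relation[OF gl_relation.a2, of i j] assms step by (simp add: gl_h_def)
  then have "com (A.res (gen (H i))) (A.res (gen (E j))) = (if i = j then A.res (gen (E j)) + A.res (gen (E j))
      else if i = j + 1 \<or> j = i + 1 then - A.res (gen (E j)) else 0)"
    unfolding gl_coeff_mult using step by (simp add: if_distrib[of A.res] A.res_simps)
  moreover have "com (A.res (gl_diag i)) (A.res (gen (E j))) =
      com (A.res (gen (H i))) (A.res (gen (E j))) + com (A.res (gl_diag (Suc i))) (A.res (gen (E j)))"
    using step by (simp add: gl_diag_step A.res_simps algebra_simps)
  ultimately show ?case using step.IH by (simp only:) auto
qed

lemma res_gl_diag_F:
  assumes "1 \<le> i" "i \<le> m + n" "1 \<le> j" "j < m + n"
  shows "com (A.res (gl_diag i)) (A.res (gen (F j))) =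
    (if i = j + 1 then A.res (gen (F j)) else 0) - (if i = j then A.res (gen (F j)) else 0)"
  using assms(1,2)
proof (induction i rule: diag_induct)
  case last
  have "A.res (gen (H (m + n)) * gen (F j) - gen (F j) * gen (H (m + n))) =
      A.res (- of_int (gl_coeff m n (m + n) j) * gen (F j))"
    using A.res_relation[OF gl_relation.a3, of "m + n" j] assms mn by (simp add: gl_h_def)
  then show ?case unfolding mult_minus_left gl_coeff_mult using assms mn
    by (simp add: gl_diag_last if_distrib[of A.res] A.res_simps)
next
  case middle
  have "A.res (gen Emm * gen (F j) - gen (F j) * gen Emm) = A.res (- of_int (gl_coeff m n m j) * gen (F j))"
    using A.res_relation[OF gl_relation.a3', of j] assms by simp
  then show ?case unfolding mult_minus_left gl_coeff_mult A.res_simps if_distrib[of A.res] gl_diag_middle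
    by simp
next
  case (step i)
  have "A.res (gen (H i) * gen (F j) - gen (F j) * gen (H i)) =
      A.res (- of_int (gl_coeff m n i j) * gen (F j))"
    using A.res_relation[OF gl_relation.a3, of i j] assms step by (simp add: gl_h_def)
  then have "com (A.res (gen (H i))) (A.res (gen (F j))) = - (if i = j then A.res (gen (F j)) + A.res (gen (F j))
      else if i = j + 1 \<or> j = i + 1 then - A.res (gen (F j)) else 0)"
    unfolding mult_minus_left gl_coeff_mult using step by (simp add: if_distrib[of A.res] A.res_simps)
  moreover have "com (A.res (gl_diag i)) (A.res (gen (F j))) =
      com (A.res (gen (H i))) (A.res (gen (F j))) + com (A.res (gl_diag (Suc i))) (A.res (gen (F j)))"
    using step by (simp add: gl_diag_step A.res_simps algebra_simps)
  ultimately show ?case using step.IH by (simp only:) auto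
qed

lemma chevalley_res:
  "chevalley (m + n) m (\<lambda>i. A.res (gen (E i))) (\<lambda>i. A.res (gen (F i))) (\<lambda>i. A.res (gl_diag i))"
proof (intro chevalley.intro chevalley_axioms.intro serre_res_e serre_res_f)
  show "com (A.res (gen (E i))) (A.res (gen (F j))) = 0"
    if "1 \<le> i" "i < m + n" "1 \<le> j" "j < m + n" "i \<noteq> j" for i j
    using A.res_relation[OF gl_relation.a4, of i j] that by (auto simp: A.res_simps)
  show "sbr (odd_at m i) (odd_at m i) (A.res (gen (E i))) (A.res (gen (F i))) =
      A.res (gl_diag i) - koszul (odd_at m i) (odd_at m i) (A.res (gl_diag (i + 1)))"
    if "1 \<le> i" "i < m + n" for i
    using A.res_relation[OF gl_relation.a4, of i i] A.res_relation[OF gl_relation.a4'] that mn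
    by (cases "i = m") (simp_all add: gl_h_gl_diag odd_at_def sbr_def A.res_simps)
qed (use res_gl_diag_gl_diag res_gl_diag_E res_gl_diag_F in blast)+

section \<open>Matrix units in the presented superalgebra\<close>

interpretation C: chevalley "m + n" m "\<lambda>i. A.res (gen (E i))" "\<lambda>i. A.res (gen (F i))" "\<lambda>i. A.res (gl_diag i)"
  by (rule chevalley_res)

definition gl_unit :: "nat \<Rightarrow> nat \<Rightarrow> gl_gen free_alg"
  where "gl_unit = root_elem (\<lambda>i. gen (E i)) (\<lambda>i. gen (F i)) gl_diag"


lemma res_root_vec: "A.res (root_vec e i j) = root_vec (\<lambda>k. A.res (e k)) i j"
  by (induction j) (simp_all add: A.res_simps)

lemma res_gl_unit: "A.res (gl_unit i j) = C.mu i j"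
  unfolding gl_unit_def root_elem_def by (simp add: A.res_simps res_root_vec)

lemma in_uea_root_vec: "in_uea (root_vec e i j) = root_vec (\<lambda>k. in_uea (e k)) i j"
  by (induction j) (simp_all add: in_uea_simps)

lemma uea_unit_root_vec_upper:
  assumes "1 \<le> i" "i < j" "j \<le> m + n"
  shows "root_vec (\<lambda>k. uea_unit k (Suc k)) i j = uea_unit i j"
proof -
  from assms(2) have "Suc i \<le> j" by simp
  then show ?thesis using assms(3)
  proof (induction j rule: dec_induct)
    case (step j)
    have "unit_par m i j = 0 \<or> unit_par m j (Suc j) = 0" using step by (auto simp: unit_par_def)
    then show ?case using step com_uea_unit[of i j j "Suc j"] assms(1) by auto
  qed simp
qed

text \<open>With both factors negated the commutator is [e_ji, e_(j+1,j)] = -e_(j+1,i), so exactly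
  one minus sign persists at every length.\<close>

lemma uea_unit_root_vec_lower:
  assumes "1 \<le> i" "i < j" "j \<le> m + n"
  shows "root_vec (\<lambda>k. - uea_unit (Suc k) k) i j = - uea_unit j i"
proof -
  from assms(2) have "Suc i \<le> j" by simp
  then show ?thesis using assms(3)
  proof (induction j rule: dec_induct)
    case (step j)
    have "unit_par m (Suc j) j = 0 \<or> unit_par m j i = 0" using step by (auto simp: unit_par_def)
    then have "com (uea_unit (Suc j) j) (uea_unit j i) = uea_unit (Suc j) i"
      using step com_uea_unit[of "Suc j" j j i] assms(1) by auto
    then show ?case using step by (simp add: algebra_simps)
  qed simp
qed

lemma in_uea_gl_unit:
  assumes "1 \<le> i" "i \<le> m + n" "1 \<le> j" "j \<le> m + n"
  shows "in_uea (gl_unit i j) = uea_unit i j"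
  using assms uea_unit_root_vec_upper[of i j] uea_unit_root_vec_lower[of j i]
  by (auto simp: gl_unit_def root_elem_def in_uea_gl_diag in_uea_simps in_uea_root_vec in_uea_E in_uea_F)

abbreviation "Fg \<equiv> free_grade (gl_generators m n) (gl_parity m)"

lemma gen_E_grade: "1 \<le> i \<Longrightarrow> i < m + n \<Longrightarrow> gen (E i) \<in> Fg (odd_at m i)"
  using gl_gen_grade[of "E i" m n] by (simp add: gl_generators_def gl_parity_def odd_at_def)

lemma gen_F_grade: "1 \<le> i \<Longrightarrow> i < m + n \<Longrightarrow> gen (F i) \<in> Fg (odd_at m i)"
  using gl_gen_grade[of "F i" m n] by (simp add: gl_generators_def gl_parity_def odd_at_def)

lemma gen_diag_grade: "1 \<le> i \<Longrightarrow> i \<le> m + n \<Longrightarrow> i \<noteq> m \<Longrightarrow> gen (H i) \<in> Fg 0"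
    "gen Emm \<in> Fg 0"
  using gl_gen_grade[of "H i" m n] gl_gen_grade[of Emm m n]
  by (simp_all add: gl_generators_def gl_parity_def[of m "H i"] gl_parity_def[of m Emm])

lemma gl_diag_grade: "1 \<le> i \<Longrightarrow> i \<le> m + n \<Longrightarrow> gl_diag i \<in> Fg 0"
proof (induction i rule: diag_induct)
  case (step i)
  then show ?case unfolding gl_diag_step[OF step(2,3)]
    by (intro free_grade_add gen_diag_grade) auto
qed (use mn in \<open>auto simp: gl_diag_last gl_diag_middle intro!: gen_diag_grade\<close>)

lemma root_vec_grade:
  assumes "1 \<le> i" "i < j" "j \<le> m + n" and e: "\<And>k. 1 \<le> k \<Longrightarrow> k < m + n \<Longrightarrow> e k \<in> Fg (odd_at m k)"
  shows "root_vec e i j \<in> Fg (unit_par m i j)"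
proof -
  from assms(2) have "Suc i \<le> j" by simp
  then show ?thesis using assms(3)
  proof (induction j rule: dec_induct)
    case base
    then show ?case using e[of i] assms(1) by simp
  next
    case (step j)
    then have IH: "root_vec e i j \<in> Fg (unit_par m i j)" and ej: "e j \<in> Fg (odd_at m j)"
      using e[of j] by simp_all
    have "root_vec e i j * e j \<in> Fg (unit_par m i j + odd_at m j)" by (rule free_grade_mult[OF IH ej])
    moreover have "e j * root_vec e i j \<in> Fg (odd_at m j + unit_par m i j)" by (rule free_grade_mult[OF ej IH])
    moreover have "unit_par m i j + odd_at m j = unit_par m i (Suc j)" using unit_par_add[of m i j "Suc j"] by simp
    ultimately have "com (root_vec e i j) (e j) \<in> Fg (unit_par m i (Suc j))"
      using free_grade_diff by (simp add: add.commute)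
    then show ?case using step by simp
  qed
qed

lemma gl_unit_grade:
  assumes "1 \<le> i" "i \<le> m + n" "1 \<le> j" "j \<le> m + n"
  shows "gl_unit i j \<in> Fg (unit_par m i j)"
proof -
  consider "i < j" | "i = j" | "j < i" by linarith
  then show ?thesis
  proof cases
    case 1
    then show ?thesis using root_vec_grade[of i j "\<lambda>k. gen (E k)"] gen_E_grade assms
      by (simp add: gl_unit_def root_elem_def)
  next
    case 2
    then show ?thesis using gl_diag_grade assms by (simp add: gl_unit_def root_elem_def)
  next
    case 3
    have "root_vec (\<lambda>k. - gen (F k)) j i \<in> Fg (unit_par m j i)"
      using 3 assms by (intro root_vec_grade free_grade_minus gen_F_grade)
    then show ?thesis using 3 free_grade_minus by (simp add: gl_unit_def root_elem_def unit_par_sym[of m i])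
  qed
qed

section \<open>From matrices to the presented superalgebra\<close>

abbreviation "K \<equiv> {1..m + n}"

definition entry :: "complex mat \<Rightarrow> nat \<Rightarrow> nat \<Rightarrow> complex"
  where "entry M i j = M $$ (i - 1, j - 1)"

text \<open>The enveloping superalgebra is generated by the symbols of all homogeneous matrices and
  not just by those of matrix units, so the inverse substitution is a linear combination. It only
  reads the matrix: entries at positions of the other parity are zero.\<close>

definition uea_to_gl :: "bit \<times> complex mat \<Rightarrow> gl_gen free_alg"
  where "uea_to_gl y = (\<Sum>i\<in>K. \<Sum>j\<in>K. free_scalar (entry (snd y) i j) * gl_unit i j)"

lemma entry_grade:
  assumes "M \<in> G a" "i \<in> K" "j \<in> K" "unit_par m i j \<noteq> a"
  shows "entry M i j = 0"
proof -
  have "block_parity m (i - 1) + block_parity m (j - 1) = unit_par m i j"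
    using unit_par_block_parity[of m "i - 1" "j - 1"] assms(2,3) by simp
  then show ?thesis using assms by (auto simp: entry_def)
qed

lemma uea_to_gl_grade:
  assumes "M \<in> G a"
  shows "uea_to_gl (a, M) \<in> Fg a"
  unfolding uea_to_gl_def snd_conv
proof (intro free_grade_sum)
  fix i j assume ij: "i \<in> K" "j \<in> K"
  show "free_scalar (entry M i j) * gl_unit i j \<in> Fg a"
  proof (cases "unit_par m i j = a")
    case True
    then show ?thesis using gl_unit_grade[of i j] ij by (auto intro: free_grade_smult)
  next
    case False
    then show ?thesis using entry_grade[OF assms ij] by (simp add: free_grade_0)
  qed
qed

lemma entry_simps:
  assumes "x \<in> carrier_mat (m + n) (m + n)" "y \<in> carrier_mat (m + n) (m + n)" "i \<in> K" "j \<in> K"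
  shows "entry (x + y) i j = entry x i j + entry y i j"
    and "entry (x - y) i j = entry x i j - entry y i j"
    and "entry (c \<cdot>\<^sub>m x) i j = c * entry x i j"
    and "entry (x * y) i j = (\<Sum>k\<in>K. entry x i k * entry y k j)"
proof -
  have ij: "i - 1 < m + n" "j - 1 < m + n" using assms by auto
  show "entry (x + y) i j = entry x i j + entry y i j"
    "entry (x - y) i j = entry x i j - entry y i j"
    "entry (c \<cdot>\<^sub>m x) i j = c * entry x i j"
    using assms(1,2) ij by (simp_all add: entry_def)
  have "entry (x * y) i j = (\<Sum>k<m + n. x $$ (i - 1, k) * y $$ (k, j - 1))"
    using assms(1,2) ij by (auto simp: entry_def scalar_prod_def lessThan_atLeast0)
  also have "\<dots> = (\<Sum>k\<in>K. entry x i k * entry y k j)"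
    unfolding entry_def by (rule sum.reindex_bij_witness[of _ "\<lambda>k. k - 1" Suc]) auto
  finally show "entry (x * y) i j = (\<Sum>k\<in>K. entry x i k * entry y k j)" .
qed

lemma uea_to_gl_diff:
  assumes "x \<in> carrier_mat (m + n) (m + n)" "y \<in> carrier_mat (m + n) (m + n)"
  shows "uea_to_gl (a, x - y) = uea_to_gl (a, x) - uea_to_gl (a, y)"
  unfolding uea_to_gl_def snd_conv sum_subtractf[symmetric]
  by (intro sum.cong refl) (simp only: entry_simps[OF assms] free_scalar_diff left_diff_distrib)

lemma uea_to_gl_mat_unit:
  assumes "k \<in> K" "l \<in> K"
  shows "uea_to_gl (a, mat_unit m n k l) = gl_unit k l"
proof -
  have "uea_to_gl (a, mat_unit m n k l) = (\<Sum>i\<in>K. \<Sum>j\<in>K. if j = l then if i = k then gl_unit i j else 0 else 0)"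
    unfolding uea_to_gl_def snd_conv using assms
    by (intro sum.cong refl) (auto simp: entry_def)
  also have "\<dots> = gl_unit k l" using assms by simp
  finally show ?thesis .
qed

abbreviation scal where "scal c \<equiv> A.res (free_scalar c)"

lemma scal_commute: "scal c * A.res u = A.res u * scal c"
  by (metis A.res_simps(4) free_scalar_commute)

lemma scal_mult: "scal c * scal d = scal (c * d)"
  by (simp add: free_scalar_mult A.res_simps)

lemma res_sum: "A.res (sum f S) = (\<Sum>s\<in>S. A.res (f s))"
  by (induction S rule: infinite_finite_induct) (simp_all add: A.res_simps)

lemma res_uea_to_gl: "A.res (uea_to_gl y) = (\<Sum>i\<in>K. \<Sum>j\<in>K. scal (entry (snd y) i j) * C.mu i j)"
  unfolding uea_to_gl_def by (simp add: res_sum A.res_simps res_gl_unit)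

lemma free_scalar_sum: "free_scalar (sum f S) = (\<Sum>s\<in>S. free_scalar (f s))"
  by (induction S rule: infinite_finite_induct) (simp_all add: free_scalar_add)

lemma scal_entry_mult:
  assumes "x \<in> carrier_mat (m + n) (m + n)" "y \<in> carrier_mat (m + n) (m + n)" "i \<in> K" "j \<in> K"
  shows "scal (entry (x * y) i j) = (\<Sum>k\<in>K. scal (entry x i k * entry y k j))"
  unfolding entry_simps(4)[OF assms] free_scalar_sum res_sum ..

lemma sum_sum_delta:
  assumes "finite S" "j \<in> S"
  shows "(\<Sum>k\<in>S. \<Sum>l\<in>T. if k = j then g k l else 0) = (\<Sum>l\<in>T. g j l)"
proof -
  have "(\<Sum>k\<in>S. \<Sum>l\<in>T. if k = j then g k l else 0) = (\<Sum>k\<in>S. if k = j then \<Sum>l\<in>T. g k l else 0)"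
    by (intro sum.cong refl) simp
  then show ?thesis using assms by simp
qed

lemma koszul_sum: "koszul a b (sum f S) = (\<Sum>s\<in>S. koszul a b (f s))"
  by (auto simp: koszul_def sum_negf)

lemma sbr_sum_left: "sbr a b (sum f S) y = (\<Sum>s\<in>S. sbr a b (f s) y)"
  and sbr_sum_right: "sbr a b y (sum f S) = (\<Sum>s\<in>S. sbr a b y (f s))"
  by (simp_all add: sbr_def sum_distrib_left sum_distrib_right koszul_sum sum_subtractf)

text \<open>If the positions ij and kl have parities a and b, central scalars are pulled out of a
  bracket of matrix units. Otherwise one of the two entries is zero and both sides vanish.\<close>

lemma sbr_term:
  assumes "x \<in> G a" "y \<in> G b" "i \<in> K" "j \<in> K" "k \<in> K" "l \<in> K"
  shows "sbr a b (scal (entry x i j) * C.mu i j) (scal (entry y k l) * C.mu k l) =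
    (if k = j then scal (entry x i j * entry y k l) * C.mu i l else 0)
    - koszul a b (if l = i then scal (entry y k l * entry x i j) * C.mu k j else 0)"
proof (cases "unit_par m i j = a \<and> unit_par m k l = b")
  case True
  have mult: "(scal c * C.mu s t) * (scal d * C.mu u v) = scal (c * d) * (C.mu s t * C.mu u v)" for c d s t u v
  proof -
    have "(scal c * C.mu s t) * (scal d * C.mu u v) = scal c * ((C.mu s t * scal d) * C.mu u v)"
      by (simp only: mult.assoc)
    also have "C.mu s t * scal d = scal d * C.mu s t"
      unfolding res_gl_unit[symmetric] by (rule scal_commute[symmetric])
    also have "scal c * ((scal d * C.mu s t) * C.mu u v) = (scal c * scal d) * (C.mu s t * C.mu u v)"
      by (simp only: mult.assoc)
    finally show ?thesis by (simp only: scal_mult)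
  qed
  have "sbr a b (scal (entry x i j) * C.mu i j) (scal (entry y k l) * C.mu k l) =
      scal (entry x i j * entry y k l) * sbr a b (C.mu i j) (C.mu k l)"
    unfolding sbr_def mult mult.commute[of "entry y k l"]
    by (simp add: koszul_def right_diff_distrib distrib_left)
  also have "sbr a b (C.mu i j) (C.mu k l) =
      (if j = k then C.mu i l else 0) - koszul a b (if i = l then C.mu k j else 0)"
    using C.acts_all[of i j] assms(3-6) True unfolding C.acts_def by auto
  finally show ?thesis
    by (auto simp: koszul_def right_diff_distrib mult.commute)
next
  case False
  then have "entry x i j = 0 \<or> entry y k l = 0"
    using entry_grade[OF assms(1,3,4)] entry_grade[OF assms(2,5,6)] by auto
  then show ?thesis by (auto simp: A.res_simps)
qed

text \<open>Bilinear expansion gives fourfold sums of brackets of matrix units. The delta in each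
  term removes one index, and the inner sum that remains is an entry of xy or of yx.\<close>

lemma res_uea_to_gl_bracket:
  assumes x: "x \<in> G a" and y: "y \<in> G b"
  shows "sbr a b (A.res (uea_to_gl (a, x))) (A.res (uea_to_gl (b, y))) = A.res (uea_to_gl (a + b, x * y - super_sign a b \<cdot>\<^sub>m (y * x)))"
proof -
  have c: "x \<in> carrier_mat (m + n) (m + n)" "y \<in> carrier_mat (m + n) (m + n)"
    using x y by auto
  have "sbr a b (A.res (uea_to_gl (a, x))) (A.res (uea_to_gl (b, y))) =
    (\<Sum>i\<in>K. \<Sum>j\<in>K. \<Sum>k\<in>K. \<Sum>l\<in>K. sbr a b (scal (entry x i j) * C.mu i j) (scal (entry y k l) * C.mu k l))"
    by (simp only: res_uea_to_gl snd_conv sbr_sum_left) (simp only: sbr_sum_right)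
  also have "\<dots> = (\<Sum>i\<in>K. \<Sum>j\<in>K. \<Sum>k\<in>K. \<Sum>l\<in>K.
      (if k = j then scal (entry x i j * entry y k l) * C.mu i l else 0)
      - koszul a b (if l = i then scal (entry y k l * entry x i j) * C.mu k j else 0))"
    by (intro sum.cong refl sbr_term[OF x y])
  also have "\<dots> =
      (\<Sum>i\<in>K. \<Sum>j\<in>K. \<Sum>k\<in>K. \<Sum>l\<in>K. if k = j then scal (entry x i j * entry y k l) * C.mu i l else 0)
      - koszul a b (\<Sum>i\<in>K. \<Sum>j\<in>K. \<Sum>k\<in>K. \<Sum>l\<in>K. if l = i then scal (entry y k l * entry x i j) * C.mu k j else 0)"
    by (simp only: sum_subtractf koszul_sum)
  also have "(\<Sum>i\<in>K. \<Sum>j\<in>K. \<Sum>k\<in>K. \<Sum>l\<in>K. if k = j then scal (entry x i j * entry y k l) * C.mu i l else 0) =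
      (\<Sum>i\<in>K. \<Sum>j\<in>K. \<Sum>l\<in>K. scal (entry x i j * entry y j l) * C.mu i l)"
    by (rule sum.cong[OF refl], rule sum.cong[OF refl], rule sum_sum_delta) auto
  also have "\<dots> = (\<Sum>i\<in>K. \<Sum>l\<in>K. scal (entry (x * y) i l) * C.mu i l)"
  proof (rule sum.cong[OF refl])
    fix i assume i: "i \<in> K"
    have "(\<Sum>j\<in>K. \<Sum>l\<in>K. scal (entry x i j * entry y j l) * C.mu i l) =
        (\<Sum>l\<in>K. \<Sum>j\<in>K. scal (entry x i j * entry y j l) * C.mu i l)"
      by (rule sum.swap)
    then show "(\<Sum>j\<in>K. \<Sum>l\<in>K. scal (entry x i j * entry y j l) * C.mu i l) =
        (\<Sum>l\<in>K. scal (entry (x * y) i l) * C.mu i l)"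
      using i by (simp add: scal_entry_mult[OF c] sum_distrib_right)
  qed
  \<comment> \<open>Here the delta eliminates l, and the sums are reordered so that i becomes the
    inner index of the product yx.\<close>
  also have "(\<Sum>i\<in>K. \<Sum>j\<in>K. \<Sum>k\<in>K. \<Sum>l\<in>K. if l = i then scal (entry y k l * entry x i j) * C.mu k j else 0) =
      (\<Sum>k\<in>K. \<Sum>j\<in>K. scal (entry (y * x) k j) * C.mu k j)"
  proof -
    have "(\<Sum>i\<in>K. \<Sum>j\<in>K. \<Sum>k\<in>K. \<Sum>l\<in>K. if l = i then scal (entry y k l * entry x i j) * C.mu k j else 0) =
        (\<Sum>i\<in>K. \<Sum>j\<in>K. \<Sum>k\<in>K. scal (entry y k i * entry x i j) * C.mu k j)"
      by (intro sum.cong refl) simp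
    also have "\<dots> = (\<Sum>j\<in>K. \<Sum>k\<in>K. \<Sum>i\<in>K. scal (entry y k i * entry x i j) * C.mu k j)"
      by (subst sum.swap) (intro sum.cong refl sum.swap)
    also have "\<dots> = (\<Sum>k\<in>K. \<Sum>j\<in>K. \<Sum>i\<in>K. scal (entry y k i * entry x i j) * C.mu k j)"
      by (rule sum.swap)
    also have "\<dots> = (\<Sum>k\<in>K. \<Sum>j\<in>K. scal (entry (y * x) k j) * C.mu k j)"
      by (intro sum.cong refl) (simp add: scal_entry_mult[OF c(2,1)] sum_distrib_right)
    finally show ?thesis .
  qed
  finally have "sbr a b (A.res (uea_to_gl (a, x))) (A.res (uea_to_gl (b, y))) =
    (\<Sum>i\<in>K. \<Sum>l\<in>K. scal (entry (x * y) i l) * C.mu i l)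
    - koszul a b (\<Sum>i\<in>K. \<Sum>l\<in>K. scal (entry (y * x) i l) * C.mu i l)" .
  also have "\<dots> = (\<Sum>i\<in>K. \<Sum>l\<in>K. scal (entry (x * y) i l) * C.mu i l - koszul a b (scal (entry (y * x) i l) * C.mu i l))"
    by (simp only: sum_subtractf koszul_sum)
  also have "\<dots> = A.res (uea_to_gl (a + b, x * y - super_sign a b \<cdot>\<^sub>m (y * x)))"
    unfolding res_uea_to_gl snd_conv
  proof (intro sum.cong refl)
    fix i l assume il: "i \<in> K" "l \<in> K"
    have cc: "x * y \<in> carrier_mat (m + n) (m + n)" "y * x \<in> carrier_mat (m + n) (m + n)"
      "super_sign a b \<cdot>\<^sub>m (y * x) \<in> carrier_mat (m + n) (m + n)" using c by auto
    show "scal (entry (x * y) i l) * C.mu i l - koszul a b (scal (entry (y * x) i l) * C.mu i l) =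
        scal (entry (x * y - super_sign a b \<cdot>\<^sub>m (y * x)) i l) * C.mu i l"
      unfolding entry_simps(2)[OF cc(1,3) il] entry_simps(3)[OF cc(2,2) il]
      by (auto simp: koszul_def super_sign_def free_scalar_minus free_scalar_diff A.res_simps
          left_diff_distrib)
  qed
  finally show ?thesis .
qed


section \<open>Enveloping relations and the two inverse identities\<close>

lemma uea_to_gl_relation:
  assumes "uea_relation (gl m n) u v"
  shows "A.res (subst uea_to_gl u) = A.res (subst uea_to_gl v)"
  using assms
proof cases
  case (add x a y)
  then have c: "x \<in> carrier_mat (m + n) (m + n)" "y \<in> carrier_mat (m + n) (m + n)" by auto
  have "uea_to_gl (a, x + y) = uea_to_gl (a, x) + uea_to_gl (a, y)"
    unfolding uea_to_gl_def snd_conv sum.distrib[symmetric]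
    by (intro sum.cong refl) (simp only: entry_simps[OF c] free_scalar_add distrib_right)
  then show ?thesis unfolding add by (simp add: subst_add)
next
  case (smult x a s)
  then have c: "x \<in> carrier_mat (m + n) (m + n)" by auto
  have "uea_to_gl (a, s \<cdot>\<^sub>m x) = free_scalar s * uea_to_gl (a, x)"
    unfolding uea_to_gl_def snd_conv sum_distrib_left
    by (intro sum.cong refl) (simp only: entry_simps[OF c c] free_scalar_mult mult.assoc)
  then show ?thesis unfolding smult by (simp add: subst_mult)
next
  case (bracket x a y b)
  then have xy: "x \<in> G a" "y \<in> G b" by (simp_all only: gl_simps)
  have "A.res (subst uea_to_gl u) = sbr a b (A.res (uea_to_gl (a, x))) (A.res (uea_to_gl (b, y)))"
    unfolding bracket(1) koszul_eq_super_sign[symmetric]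
    by (simp add: sbr_def koszul_def subst_diff subst_mult subst_minus A.res_simps)
  also have "\<dots> = A.res (subst uea_to_gl v)"
    unfolding bracket(2) gl_simps(7) res_uea_to_gl_bracket[OF xy] gl_bracket_homogeneous[OF xy] by simp
  finally show ?thesis .
qed

text \<open>This already holds in the free algebra, before passing to residues:
  \<open>gl_unit\<close> at adjacent indices is a generator, and for h_i the two telescoping sums
  differ by a single term.\<close>

lemma uea_to_gl_gl_to_uea:
  assumes "x \<in> gl_generators m n"
  shows "subst uea_to_gl (gl_to_uea x) = gen x"
proof (cases x)
  case (E i)
  then show ?thesis using assms uea_to_gl_mat_unit[of i "i + 1"]
    by (auto simp: gl_generators_def gl_to_uea_def gl_unit_def root_elem_def)
next
  case (F i)
  then show ?thesis using assms uea_to_gl_mat_unit[of "i + 1" i]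
    by (auto simp: gl_generators_def gl_to_uea_def gl_unit_def root_elem_def)
next
  case (H i)
  then have i: "1 \<le> i" "i \<le> m + n" "i \<noteq> m" using assms by (auto simp: gl_generators_def)
  show ?thesis
  proof (cases "i = m + n")
    case True
    then show ?thesis using uea_to_gl_mat_unit[of "m + n" "m + n"] i H
      by (simp add: gl_to_uea_def gl_unit_def root_elem_def gl_diag_last)
  next
    case False
    then have "uea_to_gl (a, mat_unit m n i i - mat_unit m n (Suc i) (Suc i)) = gl_diag i - gl_diag (Suc i)" for a
      using uea_to_gl_diff[OF mat_unit_carrier mat_unit_carrier] uea_to_gl_mat_unit[of i i] uea_to_gl_mat_unit[of "Suc i" "Suc i"] i
      by (simp add: gl_unit_def root_elem_def)
    then show ?thesis using i H False by (simp add: gl_to_uea_def gl_diag_step)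
  qed
next
  case Emm
  then show ?thesis using uea_to_gl_mat_unit[of m m] mn
    by (simp add: gl_to_uea_def gl_unit_def root_elem_def gl_diag_middle)
qed

text \<open>Additivity of \<open>uea_cls a\<close> is available only inside grade a, so M is
  assembled position by position: every restriction of M to a set of positions stays in grade a, and
  entries of the wrong parity are zero.\<close>

lemma uea_cls_sum_units:
  assumes M: "M \<in> G a" and S: "finite S" "S \<subseteq> K \<times> K"
  shows "(\<Sum>(i, j)\<in>S. B.res (free_scalar (entry M i j)) * uea_unit i j) =
    uea_cls a (mat (m + n) (m + n) (\<lambda>(p, q). if (Suc p, Suc q) \<in> S then M $$ (p, q) else 0))"
  using S
proof (induction S)
  case empty
  have "mat (m + n) (m + n) (\<lambda>_. 0 :: complex) = 0\<^sub>m (m + n) (m + n)"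
    by (rule eq_matI) auto
  then show ?case by (simp add: uea_cls_zero)
next
  case (insert ij S)
  obtain i j where ij: "ij = (i, j)" by fastforce
  with insert have K: "i \<in> K" "j \<in> K" by auto
  let ?M = "\<lambda>S. mat (m + n) (m + n) (\<lambda>(p, q). if (Suc p, Suc q) \<in> S then M $$ (p, q) else 0)"
  have grade: "?M S \<in> G a" for S using M by auto
  have gl_unit: "entry M i j \<cdot>\<^sub>m mat_unit m n i j \<in> G a"
    and uea_clsgl_unit: "uea_cls a (entry M i j \<cdot>\<^sub>m mat_unit m n i j) = B.res (free_scalar (entry M i j)) * uea_unit i j"
  proof -
    have "entry M i j \<cdot>\<^sub>m mat_unit m n i j \<in> G a \<and>
      uea_cls a (entry M i j \<cdot>\<^sub>m mat_unit m n i j) = B.res (free_scalar (entry M i j)) * uea_unit i j"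
    proof (cases "unit_par m i j = a")
      case True
      then have "mat_unit m n i j \<in> G a" using mat_unit_grade[of m n i j] by simp
      then show ?thesis using True uea_cls_smult super_mat_grade_smult unfolding uea_unit_def by blast
    next
      case False
      then have "entry M i j = 0" using entry_grade[OF M K] by simp
      moreover have "0 \<cdot>\<^sub>m mat_unit m n i j = 0\<^sub>m (m + n) (m + n)"
        by (rule eq_matI) (auto simp: mat_unit_def)
      ultimately show ?thesis using zero_grade uea_cls_zero by (simp add: B.res_simps)
    qed
    then show "entry M i j \<cdot>\<^sub>m mat_unit m n i j \<in> G a"
      "uea_cls a (entry M i j \<cdot>\<^sub>m mat_unit m n i j) = B.res (free_scalar (entry M i j)) * uea_unit i j" by auto
  qed
  have "?M (insert ij S) = entry M i j \<cdot>\<^sub>m mat_unit m n i j + ?M S"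
    using insert ij K by (intro eq_matI) (auto simp: entry_def mat_unit_def)
  then have "uea_cls a (?M (insert ij S)) = B.res (free_scalar (entry M i j)) * uea_unit i j + uea_cls a (?M S)"
    using uea_cls_add[OF gl_unit grade] uea_clsgl_unit by simp
  then show ?case using insert ij by simp
qed

lemma gl_to_uea_uea_to_gl:
  assumes "M \<in> G a"
  shows "B.res (subst gl_to_uea (uea_to_gl (a, M))) = B.res (gen (a, M))"
proof -
  have "B.res (subst gl_to_uea (uea_to_gl (a, M))) = in_uea (uea_to_gl (a, M))" by (simp add: in_uea_def)
  also have "\<dots> = (\<Sum>i\<in>K. \<Sum>j\<in>K. B.res (free_scalar (entry M i j)) * uea_unit i j)"
  proof -
    have "in_uea (free_scalar c) = B.res (free_scalar c)" for c by (simp add: in_uea_def)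
    then show ?thesis unfolding uea_to_gl_def snd_conv by (simp add: in_uea_sum in_uea_simps in_uea_gl_unit)
  qed
  also have "\<dots> = (\<Sum>(i, j)\<in>K \<times> K. B.res (free_scalar (entry M i j)) * uea_unit i j)"
    by (rule sum.cartesian_product)
  also have "\<dots> = uea_cls a (mat (m + n) (m + n) (\<lambda>(p, q). if (Suc p, Suc q) \<in> K \<times> K then M $$ (p, q) else 0))"
    by (rule uea_cls_sum_units[OF assms]) auto
  also have "mat (m + n) (m + n) (\<lambda>(p, q). if (Suc p, Suc q) \<in> K \<times> K then M $$ (p, q) else 0) = M"
    using assms by (intro eq_matI) auto
  finally show ?thesis by (simp add: uea_cls_def)
qed

text \<open>\<open>uea_map\<close> adds the symbols of both homogeneous parts. The symbol of a zero
  matrix is a nonzero element of the free algebra, but the linearity relations kill it.\<close>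

lemma uea_map_homogeneous:
  assumes "M \<in> G a"
  shows "uea_map (gl m n) M = B.cls (gen (a, M))"
proof -
  have h: "hom_part (gl m n) b M = (if b = a then M else 0\<^sub>m (m + n) (m + n))" for b
    using graded_algebra.hom_part_homogeneous[OF graded_algebra_gl, of M m n a b] assms by simp
  have mem: "(b, if b = a then M else 0\<^sub>m (m + n) (m + n)) \<in> uea_generators (gl m n)" for b
    using assms zero_grade unfolding uea_generators_def gl_simps by auto
  have z: "B.res (gen (b, 0\<^sub>m (m + n) (m + n))) = 0" for b
    using uea_cls_zero[of b] by (simp add: uea_cls_def)
  have "B.res (gen (0, hom_part (gl m n) 0 M) + gen (1, hom_part (gl m n) 1 M)) = B.res (gen (a, M))"
    unfolding h by (cases a) (simp_all add: B.res_simps z)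
  moreover have "gen (0, hom_part (gl m n) 0 M) + gen (1, hom_part (gl m n) 1 M) \<in>
      free_carrier (uea_generators (gl m n))"
    unfolding h using mem by (intro free_carrier_closed)
  moreover have "gen (a, M) \<in> free_carrier (uea_generators (gl m n))"
    using mem[of a] by (intro free_carrier_closed) simp
  ultimately show ?thesis unfolding uea_map_def by (simp add: B.cls_res)
qed

lemma gl_presentation:
  "has_presentation (uea (gl m n)) (gl_generators m n) (gl_parity m) (gl_relation m n)
    (\<lambda>x. uea_map (gl m n) (gl_gen_mat m n x))"
  unfolding uea_def
proof (rule presented_superalgebra_has_presentation[OF presentation_gl presentation_uea])
  show "gl_to_uea x \<in> free_grade (uea_generators (gl m n)) fst (gl_parity m x)" for x by (rule gl_to_uea_grade)
  show "uea_to_gl y \<in> Fg (fst y)" if "y \<in> uea_generators (gl m n)" for y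
    using that uea_to_gl_grade[of "snd y" "fst y"] unfolding uea_generators_def gl_simps by auto
  show "B.res (subst gl_to_uea u) = B.res (subst gl_to_uea v)" if "gl_relation m n u v" for u v
    using in_uea_relation[OF that] by (simp add: in_uea_def)
  show "A.res (subst uea_to_gl u) = A.res (subst uea_to_gl v)" if "uea_relation (gl m n) u v" for u v
    using that by (rule uea_to_gl_relation)
  show "A.res (subst uea_to_gl (gl_to_uea x)) = A.res (gen x)" if "x \<in> gl_generators m n" for x
    using uea_to_gl_gl_to_uea[OF that] by simp
  show "B.res (subst gl_to_uea (uea_to_gl y)) = B.res (gen y)" if "y \<in> uea_generators (gl m n)" for y
    using that gl_to_uea_uea_to_gl[of "snd y" "fst y"] unfolding uea_generators_def gl_simps by auto
  show "uea_map (gl m n) (gl_gen_mat m n x) = B.cls (gl_to_uea x)" for x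
    unfolding gl_to_uea_def by (rule uea_map_homogeneous[OF gl_gen_mat_grade])
qed

end

theorem theorem2p1:
  fixes m n :: nat
  assumes "m \<ge> 1" and "n \<ge> 1"
  shows "has_presentation (uea (gl m n)) (gl_generators m n) (gl_parity m) (gl_relation m n)
    (\<lambda>x. uea_map (gl m n) (gl_gen_mat m n x))"
  using assms by (rule gl_presentation)

end
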